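(* Let $G$ be a Lie group with Lie algebra $\mathfrak g$. Assume that $A\in\mathrm{Der}(\mathfrak g)$ is such that $\lambda\mapsto\lambda^A\in\mathrm{Aut}(\mathfrak g)$, $\lambda\in(0,\infty)$, defines a one-parameter group of Lie group automorphisms $\lambda\mapsto\delta_\lambda\in\mathrm{Aut}(G)$ with $(\delta_\lambda)_*=\lambda^A$ for all $\lambda>0$. Let $d$ be an $A$-homogeneous distance on $G$, that is, a left-invariant distance on $G$ (not assumed to induce the manifold topology) with $d(\delta_\lambda x,\delta_\lambda y)=\lambda d(x,y)$ for all $x,y\in G$ and $\lambda>0$. Then $d$ is admissible, i.e., $d$ induces the manifold topology of $G$, and $G$ is connected.
   Context: Lie groups are real and finite-dimensional; $G$ is not assumed connected. $\mathrm{Der}(\mathfrak g)$ is the space of derivations of $\mathfrak g$, $\mathrm{Aut}$ denotes Lie algebra, respectively Lie group, automorphisms, and $\phi_*$ is the Lie algebra automorphism induced by a Lie group automorphism $\phi$. For $\lambda>0$, $\lambda^A:=e^{(\log\lambda)A}\in\mathrm{Aut}(\mathfrak g)$. A (multiplicative) one-parameter group of Lie group automorphisms is a family $(\delta_\lambda)_{\lambda>0}\subset\mathrm{Aut}(G)$ with $\delta_{\lambda\mu}=\delta_\lambda\circ\delta_\mu$ and with $(\lambda,p)\mapsto\delta_\lambda(p)$ continuous for the manifold topology. A distance $d$ on $G$ (a metric with finite values) is left-invariant if $d(gx,gy)=d(x,y)$ for all $g,x,y\in G$. *)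

theory Defs
  imports "HOL-Analysis.Analysis" "HOL-Algebra.Group"
begin

section \<open>Smooth maps between open subsets of linear spaces\<close>

text \<open>
  Every Euclidean space type has dimension at least one. To admit zero-dimensional manifolds
  (discrete groups) as well, manifolds are modelled on a linear subspace \<open>V\<close> of a Euclidean
  space. Below, \<open>S\<close> is meant to be relatively open in \<open>V\<close>; then the derivative \<open>D x\<close> within
  \<open>S\<close> is uniquely determined on \<open>V\<close>, and only its values on \<open>V\<close> are used.
\<close>

primrec C_k_on ::
  "nat \<Rightarrow> 'a::euclidean_space set \<Rightarrow> 'a set \<Rightarrow> ('a \<Rightarrow> 'b::real_normed_vector) \<Rightarrow> bool"
where
  "C_k_on 0 V S f \<longleftrightarrow> continuous_on S f"
| "C_k_on (Suc k) V S f \<longleftrightarrow>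
     (\<exists>D. (\<forall>x\<in>S. (f has_derivative D x) (at x within S)) \<and>
          (\<forall>v\<in>V. C_k_on k V S (\<lambda>x. D x v)))"

definition smooth_on ::
  "'a::euclidean_space set \<Rightarrow> 'a set \<Rightarrow> ('a \<Rightarrow> 'b::real_normed_vector) \<Rightarrow> bool"
where
  "smooth_on V S f \<longleftrightarrow> (\<forall>k. C_k_on k V S f)"


section \<open>Smooth manifolds\<close>

text \<open>
  A chart is a pair \<open>(U, \<phi>)\<close>; the values of \<open>\<phi>\<close> outside \<open>U\<close> are irrelevant. The atlas need
  not be maximal.
\<close>

record ('p, 'e) mfd =
  mfd_top :: "'p topology"
  model :: "'e set"
  atlas :: "('p set \<times> ('p \<Rightarrow> 'e)) set"

abbreviation pts :: "('p, 'e) mfd \<Rightarrow> 'p set"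
  where "pts M \<equiv> topspace (mfd_top M)"

definition is_chart :: "('p, 'e::euclidean_space) mfd \<Rightarrow> 'p set \<times> ('p \<Rightarrow> 'e) \<Rightarrow> bool"
where
  "is_chart M = (\<lambda>(U, \<phi>).
     openin (mfd_top M) U \<and>
     openin (top_of_set (model M)) (\<phi> ` U) \<and>
     homeomorphic_map (subtopology (mfd_top M) U) (top_of_set (\<phi> ` U)) \<phi>)"

definition smooth_manifold :: "('p, 'e::euclidean_space) mfd \<Rightarrow> bool"
where
  "smooth_manifold M \<longleftrightarrow>
     subspace (model M) \<and>
     Hausdorff_space (mfd_top M) \<and>
     second_countable (mfd_top M) \<and>
     (\<forall>c\<in>atlas M. is_chart M c) \<and>
     (\<Union>c\<in>atlas M. fst c) = pts M \<and>
     (\<forall>(U, \<phi>)\<in>atlas M. \<forall>(W, \<psi>)\<in>atlas M.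
        smooth_on (model M) (\<phi> ` (U \<inter> W)) (\<psi> \<circ> inv_into U \<phi>))"

definition smooth_map ::
  "('p, 'e::euclidean_space) mfd \<Rightarrow> ('q, 'f::euclidean_space) mfd \<Rightarrow> ('p \<Rightarrow> 'q) \<Rightarrow> bool"
where
  "smooth_map M N f \<longleftrightarrow>
     continuous_map (mfd_top M) (mfd_top N) f \<and>
     (\<forall>(U, \<phi>)\<in>atlas M. \<forall>(W, \<psi>)\<in>atlas N.
        smooth_on (model M) (\<phi> ` {p \<in> U. f p \<in> W}) (\<psi> \<circ> f \<circ> inv_into U \<phi>))"

definition prod_mfd ::
  "('p, 'e::euclidean_space) mfd \<Rightarrow> ('q, 'f::euclidean_space) mfd \<Rightarrow> ('p \<times> 'q, 'e \<times> 'f) mfd"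
where
  "prod_mfd M N =
     \<lparr>mfd_top = prod_topology (mfd_top M) (mfd_top N),
      model = model M \<times> model N,
      atlas = {(U \<times> W, map_prod \<phi> \<psi>) | U \<phi> W \<psi>. (U, \<phi>) \<in> atlas M \<and> (W, \<psi>) \<in> atlas N}\<rparr>"

definition real_line :: "(real, real) mfd"
where
  "real_line = \<lparr>mfd_top = euclidean, model = UNIV, atlas = {(UNIV, id)}\<rparr>"


section \<open>Vector fields\<close>

text \<open>
  Functions and vector fields on \<open>M\<close> are kept \<open>extensional\<close>, so that HOL equality is
  equality on \<open>M\<close>. Vector fields are the derivations of the algebra of smooth functions.
\<close>

definition smooth_funs :: "('p, 'e::euclidean_space) mfd \<Rightarrow> ('p \<Rightarrow> real) set"
where
  "smooth_funs M = {f \<in> extensional (pts M). smooth_map M real_line f}"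

type_synonym 'p vfield = "('p \<Rightarrow> real) \<Rightarrow> ('p \<Rightarrow> real)"

definition vector_fields :: "('p, 'e::euclidean_space) mfd \<Rightarrow> 'p vfield set"
where
  "vector_fields M = {X \<in> smooth_funs M \<rightarrow>\<^sub>E smooth_funs M.
     (\<forall>f\<in>smooth_funs M. \<forall>g\<in>smooth_funs M. \<forall>a b.
        X (\<lambda>p\<in>pts M. a * f p + b * g p) = (\<lambda>p\<in>pts M. a * X f p + b * X g p)) \<and>
     (\<forall>f\<in>smooth_funs M. \<forall>g\<in>smooth_funs M.
        X (\<lambda>p\<in>pts M. f p * g p) = (\<lambda>p\<in>pts M. X f p * g p + f p * X g p))}"

definition vf_add :: "('p, 'e::euclidean_space) mfd \<Rightarrow> 'p vfield \<Rightarrow> 'p vfield \<Rightarrow> 'p vfield"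
where
  "vf_add M X Y = (\<lambda>f\<in>smooth_funs M. \<lambda>p\<in>pts M. X f p + Y f p)"

definition vf_scale :: "('p, 'e::euclidean_space) mfd \<Rightarrow> real \<Rightarrow> 'p vfield \<Rightarrow> 'p vfield"
where
  "vf_scale M a X = (\<lambda>f\<in>smooth_funs M. \<lambda>p\<in>pts M. a * X f p)"

definition vf_bracket :: "('p, 'e::euclidean_space) mfd \<Rightarrow> 'p vfield \<Rightarrow> 'p vfield \<Rightarrow> 'p vfield"
where
  "vf_bracket M X Y = (\<lambda>f\<in>smooth_funs M. \<lambda>p\<in>pts M. X (Y f) p - Y (X f) p)"

text \<open>The push-forward of a vector field by a diffeomorphism \<open>\<phi>\<close> of \<open>M\<close> onto itself.\<close>

definition vf_push :: "('p, 'e::euclidean_space) mfd \<Rightarrow> ('p \<Rightarrow> 'p) \<Rightarrow> 'p vfield \<Rightarrow> 'p vfield"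
where
  "vf_push M \<phi> X =
     (\<lambda>f\<in>smooth_funs M. \<lambda>p\<in>pts M. X (\<lambda>q\<in>pts M. f (\<phi> q)) (inv_into (pts M) \<phi> p))"


section \<open>Lie groups and their Lie algebras\<close>

definition lie_group :: "('p, 'r) monoid_scheme \<Rightarrow> ('p, 'e::euclidean_space) mfd \<Rightarrow> bool"
where
  "lie_group G M \<longleftrightarrow>
     group G \<and> smooth_manifold M \<and> pts M = carrier G \<and>
     smooth_map (prod_mfd M M) M (\<lambda>(x, y). x \<otimes>\<^bsub>G\<^esub> y) \<and>
     smooth_map M M (\<lambda>x. inv\<^bsub>G\<^esub> x)"

definition lie_group_aut ::
  "('p, 'r) monoid_scheme \<Rightarrow> ('p, 'e::euclidean_space) mfd \<Rightarrow> ('p \<Rightarrow> 'p) set"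
where
  "lie_group_aut G M =
     {\<phi> \<in> iso G G. smooth_map M M \<phi> \<and> smooth_map M M (inv_into (carrier G) \<phi>)}"

definition lie_algebra ::
  "('p, 'r) monoid_scheme \<Rightarrow> ('p, 'e::euclidean_space) mfd \<Rightarrow> 'p vfield set"
where
  "lie_algebra G M = {X \<in> vector_fields M. \<forall>g\<in>carrier G. \<forall>f\<in>smooth_funs M.
     X (\<lambda>p\<in>carrier G. f (g \<otimes>\<^bsub>G\<^esub> p)) = (\<lambda>p\<in>carrier G. X f (g \<otimes>\<^bsub>G\<^esub> p))}"

definition lie_derivations ::
  "('p, 'r) monoid_scheme \<Rightarrow> ('p, 'e::euclidean_space) mfd \<Rightarrow> ('p vfield \<Rightarrow> 'p vfield) set"
where
  "lie_derivations G M = {A \<in> lie_algebra G M \<rightarrow> lie_algebra G M.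
     (\<forall>X\<in>lie_algebra G M. \<forall>Y\<in>lie_algebra G M. A (vf_add M X Y) = vf_add M (A X) (A Y)) \<and>
     (\<forall>X\<in>lie_algebra G M. \<forall>a. A (vf_scale M a X) = vf_scale M a (A X)) \<and>
     (\<forall>X\<in>lie_algebra G M. \<forall>Y\<in>lie_algebra G M.
        A (vf_bracket M X Y) = vf_add M (vf_bracket M (A X) Y) (vf_bracket M X (A Y)))}"

text \<open>
  The exponential series \<open>\<Sum>k. B\<^sup>k X / k!\<close> of a linear endomorphism \<open>B\<close> of the Lie algebra.
  The maps \<open>X \<mapsto> X f p\<close> are linear functionals that separate the points of the
  finite-dimensional Lie algebra, so convergence of this series in the Lie algebra is the
  same as convergence of all the real series below (and both always hold).
\<close>

definition endo_exp ::
  "('p, 'e::euclidean_space) mfd \<Rightarrow> ('p vfield \<Rightarrow> 'p vfield) \<Rightarrow> 'p vfield \<Rightarrow> 'p vfield"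
where
  "endo_exp M B X = (\<lambda>f\<in>smooth_funs M. \<lambda>p\<in>pts M. \<Sum>k. (B ^^ k) X f p / fact k)"

definition endo_powr ::
  "('p, 'e::euclidean_space) mfd \<Rightarrow> real \<Rightarrow> ('p vfield \<Rightarrow> 'p vfield) \<Rightarrow> 'p vfield \<Rightarrow> 'p vfield"
where
  "endo_powr M s A = endo_exp M (\<lambda>X. vf_scale M (ln s) (A X))"


section \<open>Dilations and homogeneous distances\<close>

definition one_param_aut_group ::
  "('p, 'r) monoid_scheme \<Rightarrow> ('p, 'e::euclidean_space) mfd \<Rightarrow> (real \<Rightarrow> 'p \<Rightarrow> 'p) \<Rightarrow> bool"
where
  "one_param_aut_group G M \<delta> \<longleftrightarrow>
     (\<forall>s>0. \<delta> s \<in> lie_group_aut G M) \<and>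
     (\<forall>s>0. \<forall>t>0. \<forall>x\<in>carrier G. \<delta> (s * t) x = \<delta> s (\<delta> t x)) \<and>
     continuous_map (prod_topology (top_of_set {0<..}) (mfd_top M)) (mfd_top M)
       (\<lambda>(s, p). \<delta> s p)"

definition left_invariant_distance ::
  "('p, 'r) monoid_scheme \<Rightarrow> ('p \<Rightarrow> 'p \<Rightarrow> real) \<Rightarrow> bool"
where
  "left_invariant_distance G d \<longleftrightarrow>
     Metric_space (carrier G) d \<and>
     (\<forall>g\<in>carrier G. \<forall>x\<in>carrier G. \<forall>y\<in>carrier G. d (g \<otimes>\<^bsub>G\<^esub> x) (g \<otimes>\<^bsub>G\<^esub> y) = d x y)"

definition homogeneous_distance ::
  "('p, 'r) monoid_scheme \<Rightarrow> (real \<Rightarrow> 'p \<Rightarrow> 'p) \<Rightarrow> ('p \<Rightarrow> 'p \<Rightarrow> real) \<Rightarrow> bool"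
where
  "homogeneous_distance G \<delta> d \<longleftrightarrow>
     left_invariant_distance G d \<and>
     (\<forall>s>0. \<forall>x\<in>carrier G. \<forall>y\<in>carrier G. d (\<delta> s x) (\<delta> s y) = s * d x y)"

definition admissible ::
  "('p, 'r) monoid_scheme \<Rightarrow> ('p, 'e::euclidean_space) mfd \<Rightarrow> ('p \<Rightarrow> 'p \<Rightarrow> real) \<Rightarrow> bool"
where
  "admissible G M d \<longleftrightarrow> Metric_space.mtopology (carrier G) d = mfd_top M"

end

theory Submission
  imports Defs
begin

text \<open>
  Write \<open>\<sigma> t\<close> for the dilation \<open>\<delta> (exp t)\<close> and
  \<open>len x\<close> for the distance of \<open>x\<close> from the identity, so that
  \<open>len (\<sigma> t x) = exp t * len x\<close>. In particular \<open>\<sigma> t\<close>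
  with \<open>t \<noteq> 0\<close> fixes only the identity.

  The heart of the matter is that \<open>len\<close> is bounded near the identity of the
  manifold. On a single orbit \<open>len\<close> is under control: for fixed \<open>x\<close>
  and \<open>\<bar>t\<bar> \<le> 1\<close> the displacement \<open>inv x \<otimes> \<sigma> t
  x\<close> has length at most \<open>(1 + exp 1) * len x\<close>. Hence it suffices that
  products of displacements of finitely many given points fill a neighbourhood of the identity.
  In a chart at the identity the group law is addition up to first order, and \<open>\<sigma>
  t\<close> is the linear map \<open>D t\<close> up to first order, uniformly in small
  \<open>t\<close>. The maps \<open>D t\<close>, the differentials of the dilations at the
  identity, form a continuous linear one-parameter group on the model space, so they have a
  generator; it is the derivation \<open>A\<close>, seen on the tangent space at the identity. A
  vector killed by the generator is fixed by all \<open>D t\<close>, and a small nonzero fixed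
  vector \<open>v\<close> yields a fixed point of \<open>\<sigma> t\<close> other than the
  identity, namely an accumulation point of the \<open>n\<close>-th powers of the points with
  coordinate \<open>v / n\<close> (this stands in for the one-parameter subgroup tangent to
  \<open>v\<close>). So the generator is bijective. Choosing points whose velocities form an
  orthonormal basis, and scaling them by a small \<open>\<epsilon>\<close>, the product of their
  displacements with times \<open>v\<^sub>1, \<dots>, v\<^sub>n\<close> has coordinates
  \<open>\<epsilon> v\<close> up to a small error, and Brouwer's fixed point theorem shows that
  the products cover a ball (\<open>displacement_products_cover\<close>).

  The rest is topology. Scaling the bounded neighbourhood makes \<open>len\<close> continuous.
  Then \<open>len\<close> has a positive minimum \<open>m\<close> on a small coordinate sphere,
  and a backward orbit starting at a point with \<open>len x < m\<close> cannot cross that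
  sphere. It follows that the points whose backward orbits converge to the identity form an open
  subgroup, and that on this subgroup small \<open>len\<close> means close to the identity
  (\<open>contracted_nbhd\<close>, \<open>contracted_len_small\<close>). Every orbit stays in
  one coset of the subgroup, and its lengths tend to zero; by local compactness the coset then
  contains the identity (\<open>contracted_all\<close>). So the subgroup is everything, both
  topologies agree, and each point is joined to the identity by its orbit.
\<close>

section \<open>Strict differentiability and linear one-parameter groups\<close>

text \<open>
  Strict differentiability, rather than differentiability, is what compares \<open>f\<close> at
  two points that are both near \<open>a\<close>. It is the mean value inequality for \<open>f -
  L\<close> along a segment in \<open>V\<close>, on which the derivatives of \<open>f\<close>
  are close to \<open>L\<close> by continuity. The derivatives \<open>D x\<close> are meaningful
  only on \<open>V\<close>, so their distance is measured on an orthonormal basis of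
  \<open>V\<close> and not by the operator norm on the whole space.
\<close>

lemma C_1_strictly_differentiable:
  fixes f :: "'a::euclidean_space \<Rightarrow> 'b::real_normed_vector"
  assumes V: "subspace V" and S: "r1 > 0" "ball a r1 \<inter> V \<subseteq> S" and a: "a \<in> S"
    and f: "C_k_on 1 V S f"
  obtains L where "(f has_derivative L) (at a within S)"
    and "\<And>\<eta>. \<eta> > 0 \<Longrightarrow> \<exists>r>0. \<forall>x\<in>V. \<forall>y\<in>V. norm (x - a) < r \<longrightarrow> norm (y - a) < r \<longrightarrow>
           norm (f x - f y - L (x - y)) \<le> \<eta> * norm (x - y)"
proof -
  from f obtain D where D: "\<And>x. x \<in> S \<Longrightarrow> (f has_derivative D x) (at x within S)"
    and contD: "\<And>v. v \<in> V \<Longrightarrow> continuous_on S (\<lambda>x. D x v)"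
    by auto
  obtain B where B: "B \<subseteq> V" "pairwise orthogonal B" "\<And>b. b \<in> B \<Longrightarrow> norm b = 1"
      "independent B" "span B = V"
    using orthonormal_basis_subspace[OF V] by metis
  have finB: "finite B" using B(4) by (simp add: independent_imp_finite)
  define \<epsilon> where "\<epsilon> x = (\<Sum>b\<in>B. norm (D x b - D a b))" for x
  have cont: "continuous_on S \<epsilon>"
    unfolding \<epsilon>_def using contD B(1) by (intro continuous_intros) auto
  have D\<epsilon>: "norm (D x w - D a w) \<le> \<epsilon> x * norm w" if "x \<in> S" "w \<in> V" for x w
  proof -
    have lx: "linear (D x)" "linear (D a)"
      using D[OF that(1)] D[OF a] has_derivative_linear by auto
    have w: "(\<Sum>b\<in>B. (w \<bullet> b) *\<^sub>R b) = w"
      using orthonormal_basis_expand[OF B(2) B(3) _ finB] that(2) B(5) by auto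
    have "D x w - D a w = D x (\<Sum>b\<in>B. (w \<bullet> b) *\<^sub>R b) - D a (\<Sum>b\<in>B. (w \<bullet> b) *\<^sub>R b)"
      by (simp add: w)
    also have "\<dots> = (\<Sum>b\<in>B. (w \<bullet> b) *\<^sub>R (D x b - D a b))"
      by (simp add: linear_sum[OF lx(1)] linear_sum[OF lx(2)] linear_cmul[OF lx(1)]
          linear_cmul[OF lx(2)] sum_subtractf scaleR_diff_right)
    also have "norm \<dots> \<le> (\<Sum>b\<in>B. norm w * norm (D x b - D a b))"
    proof (rule sum_norm_le)
      fix b assume "b \<in> B"
      then have "\<bar>w \<bullet> b\<bar> \<le> norm w" using Cauchy_Schwarz_ineq2[of w b] B(3) by simp
      then show "norm ((w \<bullet> b) *\<^sub>R (D x b - D a b)) \<le> norm w * norm (D x b - D a b)"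
        by (simp add: mult_right_mono)
    qed
    also have "\<dots> = \<epsilon> x * norm w" by (simp add: \<epsilon>_def sum_distrib_left mult.commute)
    finally show ?thesis .
  qed
  show thesis
  proof (rule that[OF D[OF a]])
    fix \<eta> :: real assume \<eta>: "\<eta> > 0"
    obtain r2 where r2: "r2 > 0" "\<And>x. x \<in> S \<Longrightarrow> dist x a < r2 \<Longrightarrow> dist (\<epsilon> x) (\<epsilon> a) < \<eta>"
      using cont a \<eta> unfolding continuous_on_iff by blast
    define r where "r = min r1 r2"
    have small: "x \<in> S \<and> \<epsilon> x \<le> \<eta>" if "x \<in> V" "norm (x - a) < r" for x
    proof -
      have "x \<in> S" using S(2) that by (auto simp: r_def dist_norm norm_minus_commute)
      moreover have "\<epsilon> a = 0" by (simp add: \<epsilon>_def)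
      ultimately show ?thesis
        using r2(2)[of x] that by (auto simp: r_def dist_norm)
    qed
    have "norm (f x - f y - D a (x - y)) \<le> \<eta> * norm (x - y)"
      if xy: "x \<in> V" "y \<in> V" "norm (x - a) < r" "norm (y - a) < r" for x y
    proof -
      define w where "w = x - y"
      have wV: "w \<in> V" using V xy by (simp add: w_def subspace_diff)
      have lin: "linear (D a)" using D[OF a] has_derivative_linear by auto
      have seg: "y + t *\<^sub>R w \<in> V \<and> norm (y + t *\<^sub>R w - a) < r" if "t \<in> {0..1}" for t
      proof
        show "y + t *\<^sub>R w \<in> V" using V xy wV by (simp add: subspace_add subspace_scale)
        have "y + t *\<^sub>R w = (1 - t) *\<^sub>R y + t *\<^sub>R x" by (simp add: w_def algebra_simps)
        moreover have "(1 - t) *\<^sub>R y + t *\<^sub>R x \<in> ball a r"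
          using convex_ball[of a r] xy that
          by (intro convexD) (auto simp: dist_norm norm_minus_commute)
        ultimately show "norm (y + t *\<^sub>R w - a) < r" by (simp add: dist_norm norm_minus_commute)
      qed
      define g where "g t = f (y + t *\<^sub>R w) - t *\<^sub>R D a w" for t
      have "norm (g 1 - g 0) \<le> \<eta> * norm w * norm (1 - (0::real))"
      proof (rule differentiable_bound[of "{0..1}"])
        fix t :: real assume t: "t \<in> {0..1}"
        let ?x = "y + t *\<^sub>R w"
        have xS: "?x \<in> S" and \<epsilon>x: "\<epsilon> ?x \<le> \<eta>" using small seg[OF t] by auto
        have "((\<lambda>t. y + t *\<^sub>R w) has_derivative (\<lambda>h. h *\<^sub>R w)) (at t within {0..1})"
          by (auto intro!: derivative_eq_intros)
        moreover have "(f has_derivative D ?x) (at ?x within (\<lambda>t. y + t *\<^sub>R w) ` {0..1})"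
          by (rule has_derivative_subset[OF D[OF xS]]) (use small seg in auto)
        ultimately have "((\<lambda>t. f (y + t *\<^sub>R w)) has_derivative (\<lambda>h. D ?x (h *\<^sub>R w))) (at t within {0..1})"
          by (rule has_derivative_in_compose[where g=f])
        then show "(g has_derivative (\<lambda>h. D ?x (h *\<^sub>R w) - h *\<^sub>R D a w)) (at t within {0..1})"
          unfolding g_def by (auto intro!: derivative_eq_intros)
        have lx: "linear (D ?x)" using D[OF xS] has_derivative_linear by auto
        show "onorm (\<lambda>h. D ?x (h *\<^sub>R w) - h *\<^sub>R D a w) \<le> \<eta> * norm w"
        proof (rule onorm_bound)
          fix h :: real
          have "D ?x (h *\<^sub>R w) - h *\<^sub>R D a w = h *\<^sub>R (D ?x w - D a w)"
            by (simp add: linear_cmul[OF lx] scaleR_diff_right)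
          moreover have "norm (D ?x w - D a w) \<le> \<eta> * norm w"
            using D\<epsilon>[OF xS wV] \<epsilon>x by (meson mult_right_mono norm_ge_zero order_trans)
          ultimately show "norm (D ?x (h *\<^sub>R w) - h *\<^sub>R D a w) \<le> \<eta> * norm w * norm h"
            by (simp add: mult.commute mult_left_mono)
        qed (use \<eta> in auto)
      qed auto
      then show ?thesis by (simp add: g_def w_def algebra_simps)
    qed
    then show "\<exists>r>0. \<forall>x\<in>V. \<forall>y\<in>V. norm (x - a) < r \<longrightarrow> norm (y - a) < r \<longrightarrow>
           norm (f x - f y - D a (x - y)) \<le> \<eta> * norm (x - y)"
      using S(1) r2(1) by (intro exI[of _ r]) (auto simp: r_def)
  qed
qed

text \<open>
  The averages \<open>integral {0..h} (\<lambda>s. E s v)\<close> have differentiable orbits by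
  the fundamental theorem of calculus, because \<open>E t\<close> merely shifts the interval of
  integration. Divided by \<open>h\<close> they tend to \<open>v\<close>, so the vectors with
  differentiable orbits are dense; they form a subspace, and subspaces of finite-dimensional
  spaces are closed.
\<close>

lemma one_parameter_linear_group_differentiable:
  fixes E :: "real \<Rightarrow> 'a::euclidean_space \<Rightarrow> 'a"
  assumes lin: "\<And>t. linear (E t)"
    and add: "\<And>s t v. E (s + t) v = E s (E t v)"
    and zero: "\<And>v. E 0 v = v"
    and cont: "\<And>v. ((\<lambda>t. E t v) \<longlongrightarrow> v) (at 0)"
  obtains A where "linear A"
    and "\<And>v t. ((\<lambda>t. E t v) has_vector_derivative E t (A v)) (at t)"
proof -
  have bl: "bounded_linear (E t)" for t using lin linear_conv_bounded_linear by blast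
  have isCont: "isCont (\<lambda>t. E t v) t" for t v
  proof -
    have "((\<lambda>h. E t (E h v)) \<longlongrightarrow> E t v) (at 0)"
      by (rule bounded_linear.tendsto[OF bl cont])
    then show ?thesis by (simp add: isCont_def LIM_offset_zero_iff[of t] add)
  qed
  have contE: "continuous_on S (\<lambda>t. E t v)" for S v
    using isCont by (simp add: continuous_at_imp_continuous_on)
  define Y where "Y = {v. \<exists>a. ((\<lambda>t. E t v) has_vector_derivative a) (at 0)}"
  have "subspace Y"
  proof (rule subspaceI)
    show "0 \<in> Y" unfolding Y_def using lin by (auto simp: linear_0 intro!: exI[of _ 0])
    show "x + y \<in> Y" if "x \<in> Y" "y \<in> Y" for x y
      using that lin unfolding Y_def by (auto simp: linear_add intro: has_vector_derivative_add)
    show "c *\<^sub>R x \<in> Y" if "x \<in> Y" for c x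
      using that lin unfolding Y_def
      by (auto simp: linear_cmul intro: bounded_linear.has_vector_derivative[OF bounded_linear_scaleR_right])
  qed
  have avg: "integral {0..h} (\<lambda>s. E s v) \<in> Y" if h: "h > 0" for h v
  proof -
    define w where "w = integral {0..h} (\<lambda>s. E s v)"
    define F where "F u = integral {-1..u} (\<lambda>s. E s v)" for u
    have F: "(F has_vector_derivative E u v) (at u)" if "u > -1" for u
    proof -
      have "(F has_vector_derivative E u v) (at u within {-1..u+1})"
        unfolding F_def using that by (intro integral_has_vector_derivative contE) auto
      moreover have "at u within {-1..u+1} = at u"
        using that by (intro at_within_interior) auto
      ultimately show ?thesis by simp
    qed
    have Ew: "E t w = F (t + h) - F t" if t: "t > -1" for t
    proof -
      have "E t w = integral {0..h} (\<lambda>s. E t (E s v))"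
        unfolding w_def
        using integral_linear[OF integrable_continuous_real[OF contE[of _ v]] bl[of t], of 0 h]
        by (simp add: o_def)
      also have "\<dots> = integral {0..h} (\<lambda>s. E (s + t) v)" by (simp add: add[symmetric] add.commute)
      also have "\<dots> = integral {t..t+h} (\<lambda>s. E s v)"
        using integral_shift_real_ivl[of t t "t + h" "\<lambda>s. E s v"] by simp
      also have "\<dots> = F (t + h) - F t"
        unfolding F_def
        using Henstock_Kurzweil_Integration.integral_combine[of "-1" t "t+h" "\<lambda>s. E s v"] t h
          integrable_continuous_real[OF contE] by (simp add: algebra_simps)
      finally show ?thesis .
    qed
    have "((\<lambda>t. F (t + h) - F t) has_vector_derivative E h v - E 0 v) (at 0)"
    proof (rule has_vector_derivative_diff)
      have "((F \<circ> (\<lambda>t. t + h)) has_vector_derivative 1 *\<^sub>R E h v) (at 0)"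
        by (rule vector_diff_chain_at) (use h in \<open>auto intro!: derivative_eq_intros F\<close>)
      then show "((\<lambda>t. F (t + h)) has_vector_derivative E h v) (at 0)" by (simp add: o_def)
    qed (simp add: F)
    then have "((\<lambda>t. E t w) has_vector_derivative E h v - E 0 v) (at 0)"
      by (rule has_vector_derivative_transform_within_open[where S="{-1<..}"]) (auto simp: Ew)
    then show ?thesis by (auto simp: Y_def w_def)
  qed
  have "v \<in> Y" for v
  proof -
    have "((\<lambda>u. integral {0..u} (\<lambda>s. E s v)) has_vector_derivative E 0 v) (at 0 within {0..1})"
      by (intro integral_has_vector_derivative contE) auto
    then have *: "\<exists>d>0. \<forall>y\<in>{0..1}. norm (y - 0) < d \<longrightarrow>
        norm (integral {0..y} (\<lambda>s. E s v) - y *\<^sub>R v) \<le> e * norm (y - 0)" if "e > 0" for e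
      using that unfolding has_vector_derivative_def has_derivative_within_alt
      by (auto simp: zero)
    have "v \<in> closure Y"
      unfolding closure_approachable
    proof (intro allI impI)
      fix e :: real assume e: "e > 0"
      then obtain d where d: "d > 0" "\<And>y. y \<in> {0..1} \<Longrightarrow> y < d \<Longrightarrow>
          norm (integral {0..y} (\<lambda>s. E s v) - y *\<^sub>R v) \<le> e/2 * y"
        using *[of "e/2"] by auto
      define h where "h = min 1 (d/2)"
      have h: "h > 0" "h \<le> 1" "h < d" using d(1) by (auto simp: h_def)
      let ?y = "(1/h) *\<^sub>R integral {0..h} (\<lambda>s. E s v)"
      have "?y - v = (1/h) *\<^sub>R (integral {0..h} (\<lambda>s. E s v) - h *\<^sub>R v)"
        using h by (simp add: scaleR_diff_right)
      then have "norm (?y - v) = (1/h) * norm (integral {0..h} (\<lambda>s. E s v) - h *\<^sub>R v)"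
        using h by (metis abs_of_nonneg less_imp_le norm_scaleR zero_le_divide_1_iff)
      also have "\<dots> \<le> (1/h) * (e/2 * h)" using d(2)[of h] h by (intro mult_left_mono) auto
      also have "\<dots> < e" using h e by simp
      finally have "dist ?y v < e" by (simp add: dist_norm)
      moreover have "?y \<in> Y" using avg[OF h(1)] \<open>subspace Y\<close> by (simp add: subspace_scale)
      ultimately show "\<exists>y\<in>Y. dist y v < e" by blast
    qed
    then show ?thesis using closed_subspace[OF \<open>subspace Y\<close>] by simp
  qed
  then obtain A where A: "\<And>v. ((\<lambda>t. E t v) has_vector_derivative A v) (at 0)"
    using choice[of "\<lambda>v a. ((\<lambda>t. E t v) has_vector_derivative a) (at 0)"] unfolding Y_def by blast
  show thesis
  proof
    show "linear A"
    proof (rule linearI)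
      fix x y :: 'a and c :: real
      show "A (x + y) = A x + A y"
      proof (rule vector_derivative_unique_at[OF A])
        have "(\<lambda>t. E t (x + y)) = (\<lambda>t. E t x + E t y)" using lin by (simp add: linear_add)
        then show "((\<lambda>t. E t (x + y)) has_vector_derivative A x + A y) (at 0)"
          using has_vector_derivative_add[OF A A, of x y] by simp
      qed
      show "A (c *\<^sub>R x) = c *\<^sub>R A x"
      proof (rule vector_derivative_unique_at[OF A])
        have "(\<lambda>t. E t (c *\<^sub>R x)) = (\<lambda>t. c *\<^sub>R E t x)" using lin by (simp add: linear_cmul)
        then show "((\<lambda>t. E t (c *\<^sub>R x)) has_vector_derivative c *\<^sub>R A x) (at 0)"
          using bounded_linear.has_vector_derivative[OF bounded_linear_scaleR_right A, of c x] by simp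
      qed
    qed
    fix v t
    have "((\<lambda>h. E t (E h v)) has_vector_derivative E t (A v)) (at 0)"
      by (rule bounded_linear.has_vector_derivative[OF bl A])
    then have 0: "((\<lambda>h. E (t + h) v) has_vector_derivative E t (A v)) (at (t - t))" by (simp add: add)
    have "(((\<lambda>h. E (t + h) v) \<circ> (\<lambda>s. s - t)) has_vector_derivative 1 *\<^sub>R E t (A v)) (at t)"
      by (rule vector_diff_chain_at[where f="\<lambda>s. s - t" and g="\<lambda>h. E (t + h) v"])
        (use 0 in \<open>auto intro!: derivative_eq_intros\<close>)
    then show "((\<lambda>t. E t v) has_vector_derivative E t (A v)) (at t)" by (simp add: o_def)
  qed
qed

lemma one_parameter_linear_group_fixed:
  fixes E :: "real \<Rightarrow> 'a::euclidean_space \<Rightarrow> 'a"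
  assumes lin: "\<And>t. linear (E t)" and zero: "E 0 v = v"
    and der: "\<And>t. ((\<lambda>t. E t v) has_vector_derivative E t (A v)) (at t)" and A: "A v = 0"
  shows "E t v = v"
proof -
  have "((\<lambda>t. E t v) has_derivative (\<lambda>h. 0)) (at s within UNIV)" for s
    using der[of s] lin[of s] by (simp add: A linear_0 has_vector_derivative_def)
  then obtain c where "\<And>t. E t v = c"
    using has_derivative_zero_constant[of UNIV "\<lambda>t. E t v"] by auto
  then show ?thesis using zero by metis
qed

section \<open>Charts of a topological group centred at the identity\<close>

text \<open>
  The topological part of a Lie group structure: a topological group with one chart
  \<open>\<kappa>\<close> whose domain \<open>U\<close> contains the identity and which maps the
  identity to the origin of the model space \<open>V\<close>.
\<close>

locale centered_chart = group G for G :: "('p, 'r) monoid_scheme" (structure) +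
  fixes T :: "'p topology" and V :: "'e::euclidean_space set"
    and U :: "'p set" and \<kappa> :: "'p \<Rightarrow> 'e"
  assumes topspace_T: "topspace T = carrier G"
    and continuous_mult: "continuous_map (prod_topology T T) T (\<lambda>(x, y). x \<otimes> y)"
    and continuous_inv: "continuous_map T T (\<lambda>x. inv x)"
    and Hausdorff_T: "Hausdorff_space T"
    and subspace_V: "subspace V"
    and openin_U: "openin T U"
    and one_in_U: "\<one> \<in> U"
    and \<kappa>_one: "\<kappa> \<one> = 0"
    and openin_image: "openin (top_of_set V) (\<kappa> ` U)"
    and homeomorphic_\<kappa>: "homeomorphic_map (subtopology T U) (top_of_set (\<kappa> ` U)) \<kappa>"
begin

text \<open>
  The sets \<open>N r\<close> are a basis of neighbourhoods of the identity.
\<close>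

definition N :: "real \<Rightarrow> 'p set" where "N r = {x \<in> U. norm (\<kappa> x) < r}"

definition \<kappa>inv :: "'e \<Rightarrow> 'p" where "\<kappa>inv = inv_into U \<kappa>"

lemma U_subset: "U \<subseteq> carrier G"
  using openin_U openin_subset topspace_T by metis

lemma N_subset_U: "N r \<subseteq> U" by (auto simp: N_def)

lemma N_carrier: "x \<in> N r \<Longrightarrow> x \<in> carrier G"
  using U_subset by (auto simp: N_def)

lemma N_mono: "r \<le> s \<Longrightarrow> N r \<subseteq> N s" by (auto simp: N_def)

lemma one_in_N: "r > 0 \<Longrightarrow> \<one> \<in> N r" by (simp add: N_def one_in_U \<kappa>_one)

lemma topspace_U: "topspace (subtopology T U) = U"
  using openin_subset[OF openin_U] by auto

lemma inj_\<kappa>: "inj_on \<kappa> U"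
  using homeomorphic_imp_injective_map[OF homeomorphic_\<kappa>] unfolding topspace_U .

lemma \<kappa>_in_V: "x \<in> U \<Longrightarrow> \<kappa> x \<in> V"
  using openin_image openin_imp_subset by blast

lemma \<kappa>inv_\<kappa>: "x \<in> U \<Longrightarrow> \<kappa>inv (\<kappa> x) = x"
  by (simp add: \<kappa>inv_def inj_\<kappa>)

lemma \<kappa>_eq_0: "x \<in> U \<Longrightarrow> \<kappa> x = 0 \<Longrightarrow> x = \<one>"
  using inj_\<kappa> one_in_U \<kappa>_one by (metis inj_onD)

lemma continuous_\<kappa>: "continuous_map (subtopology T U) euclidean \<kappa>"
  using homeomorphic_imp_continuous_map[OF homeomorphic_\<kappa>]
  by (simp add: continuous_map_in_subtopology)

lemma continuous_\<kappa>inv: "continuous_map (top_of_set (\<kappa> ` U)) T \<kappa>inv"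
proof -
  obtain g where g: "homeomorphic_maps (subtopology T U) (top_of_set (\<kappa> ` U)) \<kappa> g"
    using homeomorphic_\<kappa> homeomorphic_map_maps by blast
  have "continuous_map (top_of_set (\<kappa> ` U)) T g"
    using g by (simp add: homeomorphic_maps_def continuous_map_in_subtopology)
  moreover have "g v = \<kappa>inv v" if "v \<in> \<kappa> ` U" for v
    using g that topspace_U by (auto simp: homeomorphic_maps_def \<kappa>inv_\<kappa>)
  ultimately show ?thesis by (rule continuous_map_eq) simp
qed

lemma openin_\<kappa>_preimage:
  assumes "open B"
  shows "openin T {x \<in> U. \<kappa> x \<in> B}"
proof -
  have "openin (subtopology T U) {x \<in> topspace (subtopology T U). \<kappa> x \<in> B}"
    by (rule openin_continuous_map_preimage[OF continuous_\<kappa>]) (use assms in simp)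
  then show ?thesis unfolding topspace_U using openin_U openin_trans_full by metis
qed

lemma openin_N: "openin T (N r)"
  using openin_\<kappa>_preimage[of "ball 0 r"] by (simp add: N_def)

lemma N_small:
  assumes "openin T W" "\<one> \<in> W"
  obtains r where "r > 0" "N r \<subseteq> W"
proof -
  have "openin (subtopology T U) (W \<inter> U)"
    using assms(1) by (auto simp: openin_subtopology)
  then have "openin (top_of_set (\<kappa> ` U)) (\<kappa> ` (W \<inter> U))"
    using homeomorphic_imp_open_map[OF homeomorphic_\<kappa>] by (simp add: open_map_def)
  then have "openin (top_of_set V) (\<kappa> ` (W \<inter> U))"
    using openin_image openin_trans by blast
  moreover have "0 \<in> \<kappa> ` (W \<inter> U)" using assms(2) one_in_U \<kappa>_one by force
  ultimately obtain r where r: "r > 0" "ball 0 r \<inter> V \<subseteq> \<kappa> ` (W \<inter> U)"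
    unfolding openin_contains_ball by blast
  have "N r \<subseteq> W"
  proof
    fix x assume x: "x \<in> N r"
    then have "\<kappa> x \<in> ball 0 r \<inter> V" using \<kappa>_in_V by (auto simp: N_def)
    then obtain w where "w \<in> W" "w \<in> U" "\<kappa> x = \<kappa> w" using r(2) by blast
    then show "x \<in> W" using x inj_\<kappa> by (metis inj_onD N_subset_U subsetD)
  qed
  then show thesis using that r(1) by blast
qed

lemma chart_radius:
  obtains R where "R > 0" "\<And>v. v \<in> V \<Longrightarrow> norm v < R \<Longrightarrow> v \<in> \<kappa> ` U"
proof -
  have "0 \<in> \<kappa> ` U" using one_in_U \<kappa>_one by force
  then obtain r where r: "r > 0" "ball 0 r \<inter> V \<subseteq> \<kappa> ` U"
    using openin_image unfolding openin_contains_ball by blast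
  show thesis by (rule that[OF r(1)]) (use r(2) in \<open>auto simp: subset_eq\<close>)
qed

lemma \<kappa>_\<kappa>inv: "v \<in> \<kappa> ` U \<Longrightarrow> \<kappa> (\<kappa>inv v) = v"
  by (simp add: \<kappa>inv_def f_inv_into_f)

lemma \<kappa>inv_in_U: "v \<in> \<kappa> ` U \<Longrightarrow> \<kappa>inv v \<in> U"
  by (simp add: \<kappa>inv_def inv_into_into)

lemma continuous_mult2:
  "continuous_map X T f \<Longrightarrow> continuous_map X T g \<Longrightarrow> continuous_map X T (\<lambda>x. f x \<otimes> g x)"
  using continuous_map_compose[OF continuous_map_pairedI continuous_mult, of X f g]
  by (simp add: o_def)

lemma continuous_inv2:
  "continuous_map X T f \<Longrightarrow> continuous_map X T (\<lambda>x. inv (f x))"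
  using continuous_map_compose[OF _ continuous_inv, of X f] by (simp add: o_def)

lemma N_small2:
  assumes f: "continuous_map (prod_topology T T) T (\<lambda>(x, y). f x y)"
    and one: "f \<one> \<one> = \<one>" and r: "r > 0"
  obtains s where "s > 0" "\<And>x y. x \<in> N s \<Longrightarrow> y \<in> N s \<Longrightarrow> f x y \<in> N r"
proof -
  define W where "W = {p \<in> topspace (prod_topology T T). (\<lambda>(x, y). f x y) p \<in> N r}"
  have W: "openin (prod_topology T T) W"
    unfolding W_def by (rule openin_continuous_map_preimage[OF f openin_N])
  have "(\<one>, \<one>) \<in> W" using one one_in_N[OF r] by (simp add: W_def topspace_T)
  then obtain A B where AB: "openin T A" "openin T B" "\<one> \<in> A" "\<one> \<in> B" "A \<times> B \<subseteq> W"
    using W openin_prod_topology_alt[of T T W] by meson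
  obtain s where s: "s > 0" "N s \<subseteq> A \<inter> B"
    using N_small[of "A \<inter> B"] AB by auto
  have "f x y \<in> N r" if "x \<in> N s" "y \<in> N s" for x y
  proof -
    have "(x, y) \<in> W" using that s(2) AB(5) by blast
    then show ?thesis by (simp add: W_def)
  qed
  then show thesis using that s(1) by blast
qed

text \<open>
  First-order estimates at the identity give statements about all vectors by homogeneity; this
  supplies the group elements to which the estimates are applied.
\<close>

lemma small_multiple:
  assumes "v \<in> V" "r > 0"
  obtains c x where "c > 0" "x \<in> N r" "\<kappa> x = c *\<^sub>R v"
proof -
  obtain R where R: "R > 0" "\<And>v. v \<in> V \<Longrightarrow> norm v < R \<Longrightarrow> v \<in> \<kappa> ` U"
    using chart_radius by metis
  define m where "m = min r R"
  have m: "m > 0" using assms R by (simp add: m_def)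
  define c where "c = m / (norm v + 1)"
  have pos: "norm v + 1 > 0" by (simp add: add_nonneg_pos)
  have c: "c > 0" using m pos by (simp add: c_def)
  have "m * norm v < m * (norm v + 1)" using m by simp
  then have "norm (c *\<^sub>R v) < m" using pos m by (simp add: c_def field_simps)
  moreover have "c *\<^sub>R v \<in> V" using assms subspace_V by (simp add: subspace_scale)
  ultimately have "c *\<^sub>R v \<in> \<kappa> ` U" "norm (c *\<^sub>R v) < r" using R(2) by (auto simp: m_def)
  then show thesis
    using that[OF c, of "\<kappa>inv (c *\<^sub>R v)"] by (simp add: N_def \<kappa>_\<kappa>inv \<kappa>inv_in_U)
qed

lemma continuous_on_\<kappa>:
  assumes "continuous_map (top_of_set S) T f" "\<And>x. x \<in> S \<Longrightarrow> f x \<in> U"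
  shows "continuous_on S (\<lambda>x. \<kappa> (f x))"
proof -
  have "continuous_map (top_of_set S) (subtopology T U) f"
    using assms by (auto simp: continuous_map_in_subtopology)
  then have "continuous_map (top_of_set S) euclidean (\<kappa> \<circ> f)"
    using continuous_\<kappa> continuous_map_compose by blast
  then show ?thesis by (simp add: o_def)
qed

lemma continuous_\<kappa>inv_on: "S \<subseteq> \<kappa> ` U \<Longrightarrow> continuous_map (top_of_set S) T \<kappa>inv"
  using continuous_\<kappa>inv continuous_map_from_subtopology_mono by blast

text \<open>
  Continuity at the identity of the words in one or two elements that occur below, with a common
  radius.
\<close>

lemma small_words:
  assumes "r > 0"
  obtains s where "s > 0" "s \<le> r" "\<And>x y. x \<in> N s \<Longrightarrow> y \<in> N s \<Longrightarrow> x \<otimes> inv y \<in> N r"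
    "\<And>x y. x \<in> N s \<Longrightarrow> y \<in> N s \<Longrightarrow> x \<otimes> y \<in> N r"
    "\<And>x y. x \<in> N s \<Longrightarrow> y \<in> N s \<Longrightarrow> x \<otimes> y \<otimes> inv x \<in> N r"
    "\<And>x y. x \<in> N s \<Longrightarrow> y \<in> N s \<Longrightarrow> inv x \<otimes> y \<in> N r"
    "\<And>x. x \<in> N s \<Longrightarrow> inv x \<in> N r"
proof -
  let ?P = "prod_topology T T"
  note ci = continuous_mult2 continuous_inv2 continuous_map_fst continuous_map_snd
  have "continuous_map ?P T (\<lambda>p. fst p \<otimes> inv (snd p))" by (intro ci)
  then have c1: "continuous_map ?P T (\<lambda>(x, y). x \<otimes> inv y)" by (simp add: case_prod_unfold)
  obtain s1 where s1: "s1 > 0" "\<And>x y. x \<in> N s1 \<Longrightarrow> y \<in> N s1 \<Longrightarrow> x \<otimes> inv y \<in> N r"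
    using N_small2[OF c1 _ assms] by auto
  obtain s2 where s2: "s2 > 0" "\<And>x y. x \<in> N s2 \<Longrightarrow> y \<in> N s2 \<Longrightarrow> x \<otimes> y \<in> N r"
    using N_small2[OF continuous_mult _ assms] by auto
  have "continuous_map ?P T (\<lambda>p. fst p \<otimes> snd p \<otimes> inv (fst p))" by (intro ci)
  then have c3: "continuous_map ?P T (\<lambda>(x, y). x \<otimes> y \<otimes> inv x)" by (simp add: case_prod_unfold)
  obtain s3 where s3: "s3 > 0" "\<And>x y. x \<in> N s3 \<Longrightarrow> y \<in> N s3 \<Longrightarrow> x \<otimes> y \<otimes> inv x \<in> N r"
    using N_small2[OF c3 _ assms] by auto
  have "continuous_map ?P T (\<lambda>p. inv (fst p) \<otimes> snd p)" by (intro ci)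
  then have c4: "continuous_map ?P T (\<lambda>(x, y). inv x \<otimes> y)" by (simp add: case_prod_unfold)
  obtain s4 where s4: "s4 > 0" "\<And>x y. x \<in> N s4 \<Longrightarrow> y \<in> N s4 \<Longrightarrow> inv x \<otimes> y \<in> N r"
    using N_small2[OF c4 _ assms] by auto
  define s where "s = Min {r, s1, s2, s3, s4}"
  have s: "s > 0" "s \<le> r" "N s \<subseteq> N s1" "N s \<subseteq> N s2" "N s \<subseteq> N s3" "N s \<subseteq> N s4"
    using assms s1(1) s2(1) s3(1) s4(1) N_mono by (auto simp: s_def)
  have "inv x \<in> N r" if "x \<in> N s" for x
    using s4(2)[of x \<one>] that s N_carrier[OF that] one_in_N s4(1) by auto
  then show thesis
    by (intro that[of s]) (use s(1,2) s1(2)[OF subsetD[OF s(3)] subsetD[OF s(3)]]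
        s2(2)[OF subsetD[OF s(4)] subsetD[OF s(4)]] s3(2)[OF subsetD[OF s(5)] subsetD[OF s(5)]]
        s4(2)[OF subsetD[OF s(6)] subsetD[OF s(6)]] in auto)
qed

section \<open>From smoothness to strict differentiability at the identity\<close>

text \<open>
  The derivative of the group law at \<open>(\<one>, \<one>)\<close> is addition, because the
  derivatives along the two factors are those of \<open>x \<mapsto> x \<otimes> \<one>\<close>
  and \<open>y \<mapsto> \<one> \<otimes> y\<close>, which are identities.
\<close>

lemma strictly_additive_mult:
  fixes \<phi> :: "'p \<Rightarrow> 'e"
  assumes \<phi>: "\<And>x. x \<in> U \<Longrightarrow> \<kappa> x = \<phi> x - \<phi> \<one>" and \<phi>1: "\<phi> \<one> \<in> V"
    and smooth: "C_k_on 1 (V \<times> V) (map_prod \<phi> \<phi> ` {p \<in> U \<times> U. (\<lambda>(x, y). x \<otimes> y) p \<in> U})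
        (\<phi> \<circ> (\<lambda>(x, y). x \<otimes> y) \<circ> inv_into (U \<times> U) (map_prod \<phi> \<phi>))"
    and \<eta>: "\<eta> > 0"
  shows "\<exists>r>0. \<forall>x\<in>U. \<forall>y\<in>U. \<forall>x'\<in>U. \<forall>y'\<in>U.
        norm (\<kappa> x) < r \<longrightarrow> norm (\<kappa> y) < r \<longrightarrow> norm (\<kappa> x') < r \<longrightarrow> norm (\<kappa> y') < r \<longrightarrow>
        x \<otimes> y \<in> U \<and>
        norm (\<kappa> (x \<otimes> y) - \<kappa> (x' \<otimes> y') - (\<kappa> x - \<kappa> x') - (\<kappa> y - \<kappa> y'))
          \<le> \<eta> * (norm (\<kappa> x - \<kappa> x') + norm (\<kappa> y - \<kappa> y'))"
proof -
  define S where "S = map_prod \<phi> \<phi> ` {p \<in> U \<times> U. (\<lambda>(x, y). x \<otimes> y) p \<in> U}"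
  define f where "f = \<phi> \<circ> (\<lambda>(x, y). x \<otimes> y) \<circ> inv_into (U \<times> U) (map_prod \<phi> \<phi>)"
  define a where "a = (\<phi> \<one>, \<phi> \<one>)"
  have \<phi>': "\<phi> x = \<kappa> x + \<phi> \<one>" if "x \<in> U" for x using \<phi>[OF that] by simp
  have inj: "inj_on \<phi> U" using inj_\<kappa> by (auto simp: inj_on_def \<phi>)
  have f: "f (\<phi> x, \<phi> y) = \<phi> (x \<otimes> y)" if "x \<in> U" "y \<in> U" for x y
  proof -
    have "inv_into (U \<times> U) (map_prod \<phi> \<phi>) (map_prod \<phi> \<phi> (x, y)) = (x, y)"
      by (rule inv_into_f_f[OF map_prod_inj_on[OF inj inj]]) (use that in simp)
    then show ?thesis by (simp add: f_def)
  qed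
  obtain R where R: "R > 0" "\<And>v. v \<in> V \<Longrightarrow> norm v < R \<Longrightarrow> v \<in> \<kappa> ` U"
    using chart_radius by metis
  obtain s where s: "s > 0" "\<And>x y. x \<in> N s \<Longrightarrow> y \<in> N s \<Longrightarrow> x \<otimes> y \<in> N 1"
    using N_small2[OF continuous_mult _ zero_less_one] by auto
  have near: "\<exists>x\<in>N s. u = \<phi> x" if u: "u \<in> V" "norm (u - \<phi> \<one>) < min s R" for u
  proof -
    have "u - \<phi> \<one> \<in> \<kappa> ` U" using R(2) u \<phi>1 subspace_V by (simp add: subspace_diff)
    then obtain x where x: "x \<in> U" "u - \<phi> \<one> = \<kappa> x" by blast
    then have "x \<in> N s" "u = \<phi> x" using u(2) \<phi>'[OF x(1)] by (auto simp: N_def algebra_simps)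
    then show ?thesis by blast
  qed
  have ball: "ball a (min s R) \<inter> (V \<times> V) \<subseteq> S"
  proof
    fix w assume w: "w \<in> ball a (min s R) \<inter> (V \<times> V)"
    obtain u v where uv: "w = (u, v)" by (cases w)
    have "dist w a < min s R" using w by (simp add: dist_commute)
    then have nw: "norm (u - \<phi> \<one>, v - \<phi> \<one>) < min s R" by (simp add: uv a_def dist_norm)
    have "norm (u - \<phi> \<one>) < min s R" "norm (v - \<phi> \<one>) < min s R"
      using nw norm_fst_le[of "u - \<phi> \<one>" "v - \<phi> \<one>"] norm_snd_le[of "v - \<phi> \<one>" "u - \<phi> \<one>"]
      by linarith+
    then obtain x y where xy: "x \<in> N s" "u = \<phi> x" "y \<in> N s" "v = \<phi> y"
      using near w by (auto simp: uv) metis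
    then have "x \<otimes> y \<in> U" using s(2) N_subset_U by blast
    then have "(x, y) \<in> {p \<in> U \<times> U. (\<lambda>(x, y). x \<otimes> y) p \<in> U}" using xy N_subset_U by auto
    then have "map_prod \<phi> \<phi> (x, y) \<in> S" unfolding S_def by (rule imageI)
    then show "w \<in> S" by (simp add: uv xy)
  qed
  have aS: "a \<in> S" unfolding S_def a_def
    by (rule image_eqI[of _ _ "(\<one>, \<one>)"]) (auto simp: one_in_U)
  have sR: "min s R > 0" using s(1) R(1) by simp
  obtain L where L: "(f has_derivative L) (at a within S)"
    and strict: "\<And>\<eta>. \<eta> > 0 \<Longrightarrow> \<exists>r>0. \<forall>x\<in>V \<times> V. \<forall>y\<in>V \<times> V. norm (x - a) < r \<longrightarrow> norm (y - a) < r \<longrightarrow>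
           norm (f x - f y - L (x - y)) \<le> \<eta> * norm (x - y)"
    using C_1_strictly_differentiable[OF subspace_Times[OF subspace_V subspace_V] sR ball aS
        smooth[folded S_def f_def]] by metis
  have linL: "linear L" using L has_derivative_linear by blast
  have key: "\<exists>r>0. \<forall>x\<in>N r. \<forall>y\<in>N r. \<forall>x'\<in>N r. \<forall>y'\<in>N r.
        norm (\<phi> (x \<otimes> y) - \<phi> (x' \<otimes> y') - L (\<kappa> x - \<kappa> x', \<kappa> y - \<kappa> y'))
          \<le> \<eta> * (norm (\<kappa> x - \<kappa> x') + norm (\<kappa> y - \<kappa> y'))" if \<eta>: "\<eta> > 0" for \<eta>
  proof -
    obtain r where r: "r > 0" "\<And>x y. x \<in> V \<times> V \<Longrightarrow> y \<in> V \<times> V \<Longrightarrow> norm (x - a) < r \<Longrightarrow> norm (y - a) < r \<Longrightarrow>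
           norm (f x - f y - L (x - y)) \<le> \<eta> * norm (x - y)"
      using strict[OF \<eta>] by blast
    have in_range: "(\<phi> x, \<phi> y) \<in> V \<times> V \<and> norm ((\<phi> x, \<phi> y) - a) < r" if "x \<in> N (r/2)" "y \<in> N (r/2)" for x y
    proof -
      have xy: "x \<in> U" "y \<in> U" "norm (\<kappa> x) < r/2" "norm (\<kappa> y) < r/2" using that by (auto simp: N_def)
      have "(\<phi> x, \<phi> y) - a = (\<kappa> x, \<kappa> y)" using xy by (simp add: a_def \<phi>)
      moreover have "norm (\<kappa> x, \<kappa> y) < r" using norm_Pair_le[of "\<kappa> x" "\<kappa> y"] xy by linarith
      ultimately show ?thesis using xy \<kappa>_in_V \<phi>1 subspace_V by (simp add: \<phi>' subspace_add)
    qed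
    show ?thesis
    proof (intro exI[of _ "r/2"] conjI ballI)
      fix x y x' y' assume xy: "x \<in> N (r/2)" "y \<in> N (r/2)" "x' \<in> N (r/2)" "y' \<in> N (r/2)"
      then have U: "x \<in> U" "y \<in> U" "x' \<in> U" "y' \<in> U" using N_subset_U by auto
      have diff: "(\<phi> x, \<phi> y) - (\<phi> x', \<phi> y') = (\<kappa> x - \<kappa> x', \<kappa> y - \<kappa> y')" using U by (simp add: \<phi>)
      have "norm (f (\<phi> x, \<phi> y) - f (\<phi> x', \<phi> y') - L ((\<phi> x, \<phi> y) - (\<phi> x', \<phi> y')))
          \<le> \<eta> * norm ((\<phi> x, \<phi> y) - (\<phi> x', \<phi> y'))"
        using in_range[OF xy(1,2)] in_range[OF xy(3,4)] by (intro r(2)) auto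
      then have "norm (\<phi> (x \<otimes> y) - \<phi> (x' \<otimes> y') - L (\<kappa> x - \<kappa> x', \<kappa> y - \<kappa> y'))
          \<le> \<eta> * norm (\<kappa> x - \<kappa> x', \<kappa> y - \<kappa> y')" unfolding diff f[OF U(1,2)] f[OF U(3,4)] .
      also have "\<dots> \<le> \<eta> * (norm (\<kappa> x - \<kappa> x') + norm (\<kappa> y - \<kappa> y'))"
        using \<eta> norm_Pair_le by (intro mult_left_mono) auto
      finally show "norm (\<phi> (x \<otimes> y) - \<phi> (x' \<otimes> y') - L (\<kappa> x - \<kappa> x', \<kappa> y - \<kappa> y'))
          \<le> \<eta> * (norm (\<kappa> x - \<kappa> x') + norm (\<kappa> y - \<kappa> y'))" .
    qed (use r(1) in simp)
  qed
  have partial: "L (u, 0) = u \<and> L (0, u) = u" if u: "u \<in> V" for u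
  proof -
    have "norm (u - L (u, 0)) \<le> 0 + e \<and> norm (u - L (0, u)) \<le> 0 + e" if e: "e > 0" for e
    proof -
      define \<eta> where "\<eta> = e / (norm u + 1)"
      have pos: "norm u + 1 > 0" by (simp add: add_nonneg_pos)
      have \<eta>: "\<eta> > 0" "\<eta> * norm u \<le> e" using e pos by (auto simp: \<eta>_def field_simps)
      obtain r where r: "r > 0" "\<And>x y x' y'. x \<in> N r \<Longrightarrow> y \<in> N r \<Longrightarrow> x' \<in> N r \<Longrightarrow> y' \<in> N r \<Longrightarrow>
        norm (\<phi> (x \<otimes> y) - \<phi> (x' \<otimes> y') - L (\<kappa> x - \<kappa> x', \<kappa> y - \<kappa> y'))
          \<le> \<eta> * (norm (\<kappa> x - \<kappa> x') + norm (\<kappa> y - \<kappa> y'))"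
        using key[OF \<eta>(1)] by blast
      obtain c x where c: "c > 0" and x: "x \<in> N r" "\<kappa> x = c *\<^sub>R u" using small_multiple[OF u r(1)] by metis
      note o = one_in_N[OF r(1)]
      have xU: "x \<in> U" and xc: "x \<in> carrier G" using x(1) N_subset_U N_carrier by auto
      have L1: "L (c *\<^sub>R u, 0) = c *\<^sub>R L (u, 0)" "L (0, c *\<^sub>R u) = c *\<^sub>R L (0, u)"
        using linear_cmul[OF linL, of c "(u, 0)"] linear_cmul[OF linL, of c "(0, u)"] by auto
      have "norm (c *\<^sub>R (u - L (u, 0))) \<le> \<eta> * norm (c *\<^sub>R u)"
        using r(2)[OF x(1) o o o] xc xU by (simp add: \<phi>' \<kappa>_one x(2) L1 scaleR_diff_right)
      moreover have "norm (c *\<^sub>R (u - L (0, u))) \<le> \<eta> * norm (c *\<^sub>R u)"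
        using r(2)[OF o x(1) o o] xc xU by (simp add: \<phi>' \<kappa>_one x(2) L1 scaleR_diff_right)
      ultimately have "c * norm (u - L (u, 0)) \<le> c * (\<eta> * norm u)" "c * norm (u - L (0, u)) \<le> c * (\<eta> * norm u)"
        using c by (simp_all add: mult_ac)
      then show ?thesis using c \<eta>(2) by simp
    qed
    then have "norm (u - L (u, 0)) \<le> 0" "norm (u - L (0, u)) \<le> 0" by (blast intro: field_le_epsilon)+
    then show ?thesis by simp
  qed
  have Luv: "L (u, v) = u + v" if "u \<in> V" "v \<in> V" for u v
    using linear_add[OF linL, of "(u, 0)" "(0, v)"] partial that by simp
  obtain r where r: "r > 0" "\<And>x y x' y'. x \<in> N r \<Longrightarrow> y \<in> N r \<Longrightarrow> x' \<in> N r \<Longrightarrow> y' \<in> N r \<Longrightarrow>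
        norm (\<phi> (x \<otimes> y) - \<phi> (x' \<otimes> y') - L (\<kappa> x - \<kappa> x', \<kappa> y - \<kappa> y'))
          \<le> \<eta> * (norm (\<kappa> x - \<kappa> x') + norm (\<kappa> y - \<kappa> y'))"
    using key[OF \<eta>] by blast
  have "x \<otimes> y \<in> U \<and> norm (\<kappa> (x \<otimes> y) - \<kappa> (x' \<otimes> y') - (\<kappa> x - \<kappa> x') - (\<kappa> y - \<kappa> y'))
          \<le> \<eta> * (norm (\<kappa> x - \<kappa> x') + norm (\<kappa> y - \<kappa> y'))"
    if xy: "x \<in> N (min r s)" "y \<in> N (min r s)" "x' \<in> N (min r s)" "y' \<in> N (min r s)" for x y x' y'
  proof -
    have U: "x \<in> U" "y \<in> U" "x' \<in> U" "y' \<in> U" using xy N_subset_U by auto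
    have sub: "N (min r s) \<subseteq> N r" "N (min r s) \<subseteq> N s" by (auto simp: N_def)
    have pU: "x \<otimes> y \<in> U" "x' \<otimes> y' \<in> U" using s(2) xy sub N_subset_U by blast+
    have "L (\<kappa> x - \<kappa> x', \<kappa> y - \<kappa> y') = (\<kappa> x - \<kappa> x') + (\<kappa> y - \<kappa> y')"
      using U \<kappa>_in_V subspace_V by (intro Luv subspace_diff) auto
    then have "\<kappa> (x \<otimes> y) - \<kappa> (x' \<otimes> y') - (\<kappa> x - \<kappa> x') - (\<kappa> y - \<kappa> y')
      = \<phi> (x \<otimes> y) - \<phi> (x' \<otimes> y') - L (\<kappa> x - \<kappa> x', \<kappa> y - \<kappa> y')"
      using \<phi>[OF pU(1)] \<phi>[OF pU(2)] by simp
    then show ?thesis using r(2)[of x y x' y'] xy sub pU(1) by (simp add: subset_eq)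
  qed
  then show ?thesis
    using r(1) s(1) by (intro exI[of _ "min r s"]) (auto simp: N_def)
qed

lemma differentiable_at_one:
  fixes \<phi> :: "'p \<Rightarrow> 'e"
  assumes \<phi>: "\<And>x. x \<in> U \<Longrightarrow> \<kappa> x = \<phi> x - \<phi> \<one>" and \<phi>1: "\<phi> \<one> \<in> V"
    and h: "continuous_map T T h" "h \<one> = \<one>"
    and smooth: "C_k_on 1 V (\<phi> ` {p \<in> U. h p \<in> U}) (\<phi> \<circ> h \<circ> inv_into U \<phi>)"
  shows "\<exists>L. linear L \<and> (\<forall>\<eta>>0. \<exists>r>0. \<forall>x\<in>U. norm (\<kappa> x) < r \<longrightarrow>
        h x \<in> U \<and> norm (\<kappa> (h x) - L (\<kappa> x)) \<le> \<eta> * norm (\<kappa> x))"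
proof -
  define S where "S = \<phi> ` {p \<in> U. h p \<in> U}"
  define f where "f = \<phi> \<circ> h \<circ> inv_into U \<phi>"
  have \<phi>': "\<phi> x = \<kappa> x + \<phi> \<one>" if "x \<in> U" for x using \<phi>[OF that] by simp
  have inj: "inj_on \<phi> U" using inj_\<kappa> by (auto simp: inj_on_def \<phi>)
  have f: "f (\<phi> x) = \<phi> (h x)" if "x \<in> U" for x using inj that by (simp add: f_def)
  obtain R where R: "R > 0" "\<And>v. v \<in> V \<Longrightarrow> norm v < R \<Longrightarrow> v \<in> \<kappa> ` U"
    using chart_radius by metis
  have "openin T {x \<in> topspace T. h x \<in> U}" by (rule openin_continuous_map_preimage[OF h(1) openin_U])
  then obtain s where s: "s > 0" "N s \<subseteq> {x \<in> topspace T. h x \<in> U}"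
    by (rule N_small) (use one_in_U h(2) topspace_T in auto)
  have ball: "ball (\<phi> \<one>) (min s R) \<inter> V \<subseteq> S"
  proof
    fix u assume u: "u \<in> ball (\<phi> \<one>) (min s R) \<inter> V"
    then have nu: "norm (u - \<phi> \<one>) < min s R" by (simp add: dist_norm norm_minus_commute)
    then have "u - \<phi> \<one> \<in> \<kappa> ` U" using R(2) u \<phi>1 subspace_V by (simp add: subspace_diff)
    then obtain x where x: "x \<in> U" "u - \<phi> \<one> = \<kappa> x" by blast
    then have "x \<in> N s" "u = \<phi> x" using nu \<phi>'[OF x(1)] by (auto simp: N_def algebra_simps)
    then show "u \<in> S" using s(2) x(1) by (auto simp: S_def)
  qed
  have aS: "\<phi> \<one> \<in> S" unfolding S_def using one_in_U h(2) by auto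
  have sR: "min s R > 0" using s(1) R(1) by simp
  obtain L where L: "(f has_derivative L) (at (\<phi> \<one>) within S)"
    and strict: "\<And>\<eta>. \<eta> > 0 \<Longrightarrow> \<exists>r>0. \<forall>x\<in>V. \<forall>y\<in>V. norm (x - \<phi> \<one>) < r \<longrightarrow> norm (y - \<phi> \<one>) < r \<longrightarrow>
           norm (f x - f y - L (x - y)) \<le> \<eta> * norm (x - y)"
    using C_1_strictly_differentiable[OF subspace_V sR ball aS smooth[folded S_def f_def]] by metis
  show ?thesis
  proof (intro exI[of _ L] conjI allI impI)
    show "linear L" using L has_derivative_linear by blast
    fix \<eta> :: real assume "\<eta> > 0"
    then obtain r where r: "r > 0" "\<And>x y. x \<in> V \<Longrightarrow> y \<in> V \<Longrightarrow> norm (x - \<phi> \<one>) < r \<Longrightarrow> norm (y - \<phi> \<one>) < r \<Longrightarrow>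
           norm (f x - f y - L (x - y)) \<le> \<eta> * norm (x - y)"
      using strict by blast
    have "h x \<in> U \<and> norm (\<kappa> (h x) - L (\<kappa> x)) \<le> \<eta> * norm (\<kappa> x)"
      if x: "x \<in> U" "norm (\<kappa> x) < min r s" for x
    proof -
      have hU: "h x \<in> U" using s(2) x by (auto simp: N_def)
      have "norm (f (\<phi> x) - f (\<phi> \<one>) - L (\<phi> x - \<phi> \<one>)) \<le> \<eta> * norm (\<phi> x - \<phi> \<one>)"
        by (rule r(2)) (use x \<phi>1 \<kappa>_in_V subspace_V r(1) in \<open>auto simp: \<phi>' subspace_add\<close>)
      then show ?thesis
        using hU x by (simp add: f one_in_U h(2) flip: \<phi>)
    qed
    then show "\<exists>r>0. \<forall>x\<in>U. norm (\<kappa> x) < r \<longrightarrow>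
        h x \<in> U \<and> norm (\<kappa> (h x) - L (\<kappa> x)) \<le> \<eta> * norm (\<kappa> x)"
      using r(1) s(1) by (intro exI[of _ "min r s"]) auto
  qed
qed

end

section \<open>The group law is additive to first order\<close>

text \<open>
  The added condition is strict differentiability of the group law at the identity, with
  addition as derivative. It gives Lipschitz estimates for the deviation from addition, which,
  unlike differentiability at the identity alone, can be iterated along long products.
\<close>

locale group_chart = centered_chart G T V U \<kappa>
  for G :: "('p, 'r) monoid_scheme" (structure) and T :: "'p topology"
    and V :: "'e::euclidean_space set" and U :: "'p set" and \<kappa> :: "'p \<Rightarrow> 'e" +
  assumes strict_mult: "\<And>\<eta>. \<eta> > 0 \<Longrightarrow> \<exists>r>0. \<forall>x\<in>U. \<forall>y\<in>U. \<forall>x'\<in>U. \<forall>y'\<in>U.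
        norm (\<kappa> x) < r \<longrightarrow> norm (\<kappa> y) < r \<longrightarrow> norm (\<kappa> x') < r \<longrightarrow> norm (\<kappa> y') < r \<longrightarrow>
        x \<otimes> y \<in> U \<and>
        norm (\<kappa> (x \<otimes> y) - \<kappa> (x' \<otimes> y') - (\<kappa> x - \<kappa> x') - (\<kappa> y - \<kappa> y'))
          \<le> \<eta> * (norm (\<kappa> x - \<kappa> x') + norm (\<kappa> y - \<kappa> y'))"
begin

text \<open>
  On \<open>N r\<close>, multiplication differs from addition of coordinates by a map with
  Lipschitz constant \<open>\<eta>\<close>.
\<close>

definition additive_up_to :: "real \<Rightarrow> real \<Rightarrow> bool" where
  "additive_up_to \<eta> r \<longleftrightarrow> r > 0 \<and> (\<forall>x\<in>N r. \<forall>y\<in>N r. \<forall>x'\<in>N r. \<forall>y'\<in>N r. x \<otimes> y \<in> U \<and>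
     norm (\<kappa> (x \<otimes> y) - \<kappa> (x' \<otimes> y') - (\<kappa> x - \<kappa> x') - (\<kappa> y - \<kappa> y'))
       \<le> \<eta> * (norm (\<kappa> x - \<kappa> x') + norm (\<kappa> y - \<kappa> y')))"

lemma additive_radius:
  assumes "\<eta> > 0"
  obtains r where "additive_up_to \<eta> r"
  using strict_mult[OF assms] unfolding additive_up_to_def N_def by blast

lemma additive_mono: "additive_up_to \<eta> r \<Longrightarrow> 0 < s \<Longrightarrow> s \<le> r \<Longrightarrow> additive_up_to \<eta> s"
  unfolding additive_up_to_def using N_mono[of s r] by blast

lemma additive_weaken: "additive_up_to \<eta> r \<Longrightarrow> \<eta> \<le> \<eta>' \<Longrightarrow> additive_up_to \<eta>' r"
  unfolding additive_up_to_def
  by (meson add_nonneg_nonneg mult_right_mono norm_ge_zero order_trans)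

lemma additive_pos: "additive_up_to \<eta> r \<Longrightarrow> r > 0"
  by (simp add: additive_up_to_def)

lemma additive_in_U: "additive_up_to \<eta> r \<Longrightarrow> x \<in> N r \<Longrightarrow> y \<in> N r \<Longrightarrow> x \<otimes> y \<in> U"
  unfolding additive_up_to_def by blast

lemma additive_right:
  assumes "additive_up_to \<eta> r" "x \<in> N r" "y \<in> N r"
  shows "norm (\<kappa> (x \<otimes> y) - \<kappa> x - \<kappa> y) \<le> \<eta> * norm (\<kappa> y)"
proof -
  have o: "\<one> \<in> N r" using assms(1) one_in_N additive_pos by blast
  have "norm (\<kappa> (x \<otimes> y) - \<kappa> (x \<otimes> \<one>) - (\<kappa> x - \<kappa> x) - (\<kappa> y - \<kappa> \<one>))
       \<le> \<eta> * (norm (\<kappa> x - \<kappa> x) + norm (\<kappa> y - \<kappa> \<one>))"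
    using assms o unfolding additive_up_to_def by blast
  then show ?thesis using N_carrier[OF assms(2)] by (simp add: \<kappa>_one)
qed

lemma additive_left:
  assumes "additive_up_to \<eta> r" "x \<in> N r" "y \<in> N r"
  shows "norm (\<kappa> (x \<otimes> y) - \<kappa> x - \<kappa> y) \<le> \<eta> * norm (\<kappa> x)"
proof -
  have o: "\<one> \<in> N r" using assms(1) one_in_N additive_pos by blast
  have "norm (\<kappa> (x \<otimes> y) - \<kappa> (\<one> \<otimes> y) - (\<kappa> x - \<kappa> \<one>) - (\<kappa> y - \<kappa> y))
       \<le> \<eta> * (norm (\<kappa> x - \<kappa> \<one>) + norm (\<kappa> y - \<kappa> y))"
    using assms o unfolding additive_up_to_def by blast
  then show ?thesis using N_carrier[OF assms(3)] by (simp add: \<kappa>_one algebra_simps)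
qed

lemma quotient_bound:
  assumes "additive_up_to (1/2) r" "a \<in> N r" "inv a \<otimes> b \<in> N r" "b \<in> carrier G"
  shows "norm (\<kappa> (inv a \<otimes> b)) \<le> 2 * norm (\<kappa> b - \<kappa> a)"
proof -
  have ab: "a \<otimes> (inv a \<otimes> b) = b"
    using N_carrier[OF assms(2)] assms(4) by (simp flip: m_assoc)
  have "norm (\<kappa> b - \<kappa> a - \<kappa> (inv a \<otimes> b)) \<le> 1/2 * norm (\<kappa> (inv a \<otimes> b))"
    using additive_right[OF assms(1,2,3)] unfolding ab .
  moreover have "norm (\<kappa> (inv a \<otimes> b)) \<le> norm (\<kappa> b - \<kappa> a) + norm (\<kappa> b - \<kappa> a - \<kappa> (inv a \<otimes> b))"
    using norm_triangle_ineq4[of "\<kappa> b - \<kappa> a" "\<kappa> b - \<kappa> a - \<kappa> (inv a \<otimes> b)"] by simp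
  ultimately show ?thesis by linarith
qed

text \<open>
  Conjugation by an element of a fixed neighbourhood expands small elements by a bounded factor
  only. Here strict differentiability enters: it compares \<open>(g \<otimes> c) \<otimes> inv
  g\<close> with \<open>g \<otimes> inv g\<close>.
\<close>

lemma conjugate_bound:
  assumes add: "additive_up_to (1/2) r" and g: "g \<in> N r" "inv g \<in> N r" and c: "c \<in> N r"
    and gc: "g \<otimes> c \<in> N r"
  shows "norm (\<kappa> (g \<otimes> c \<otimes> inv g)) \<le> 4 * norm (\<kappa> c)"
proof -
  have "norm (\<kappa> (g \<otimes> c \<otimes> inv g) - \<kappa> (g \<otimes> inv g) - (\<kappa> (g \<otimes> c) - \<kappa> g) - (\<kappa> (inv g) - \<kappa> (inv g)))
      \<le> 1/2 * (norm (\<kappa> (g \<otimes> c) - \<kappa> g) + norm (\<kappa> (inv g) - \<kappa> (inv g)))"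
    using add g gc unfolding additive_up_to_def by blast
  then have 1: "norm (\<kappa> (g \<otimes> c \<otimes> inv g) - (\<kappa> (g \<otimes> c) - \<kappa> g)) \<le> 1/2 * norm (\<kappa> (g \<otimes> c) - \<kappa> g)"
    using N_carrier[OF g(1)] by (simp add: \<kappa>_one)
  have 2: "norm (\<kappa> (g \<otimes> c) - \<kappa> g - \<kappa> c) \<le> 1/2 * norm (\<kappa> c)"
    by (rule additive_right[OF add g(1) c])
  have 3: "norm (\<kappa> (g \<otimes> c) - \<kappa> g) \<le> norm (\<kappa> c) + norm (\<kappa> (g \<otimes> c) - \<kappa> g - \<kappa> c)"
    using norm_triangle_ineq[of "\<kappa> c" "\<kappa> (g \<otimes> c) - \<kappa> g - \<kappa> c"] by simp
  have 4: "norm (\<kappa> (g \<otimes> c \<otimes> inv g)) \<le> norm (\<kappa> (g \<otimes> c) - \<kappa> g)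
      + norm (\<kappa> (g \<otimes> c \<otimes> inv g) - (\<kappa> (g \<otimes> c) - \<kappa> g))"
    using norm_triangle_ineq[of "\<kappa> (g \<otimes> c) - \<kappa> g" "\<kappa> (g \<otimes> c \<otimes> inv g) - (\<kappa> (g \<otimes> c) - \<kappa> g)"] by simp
  show ?thesis using 1 2 3 4 norm_ge_zero[of "\<kappa> c"] by linarith
qed

text \<open>
  Only the last factor enters the error of each multiplication, so the errors add up to a
  multiple of \<open>n * norm (\<kappa> x)\<close>. The powers have to stay in \<open>N
  r\<close>; this may be known either from the size of \<open>x\<close> or, as for images under
  automorphisms, from elsewhere.
\<close>

lemma power_approx:
  assumes add: "additive_up_to \<eta> r" and x: "x \<in> N r"
    and pow: "\<And>k. k < n \<Longrightarrow> x [^] k \<in> N r"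
  shows "norm (\<kappa> (x [^] n) - real n *\<^sub>R \<kappa> x) \<le> \<eta> * (real n * norm (\<kappa> x))"
  using pow
proof (induction n)
  case 0
  then show ?case by (simp add: \<kappa>_one)
next
  case (Suc n)
  have IH: "norm (\<kappa> (x [^] n) - real n *\<^sub>R \<kappa> x) \<le> \<eta> * (real n * norm (\<kappa> x))"
    using Suc by simp
  have "norm (\<kappa> (x [^] n \<otimes> x) - \<kappa> (x [^] n) - \<kappa> x) \<le> \<eta> * norm (\<kappa> x)"
    by (rule additive_right[OF add _ x]) (use Suc.prems in auto)
  then have "norm ((\<kappa> (x [^] n \<otimes> x) - \<kappa> (x [^] n) - \<kappa> x) + (\<kappa> (x [^] n) - real n *\<^sub>R \<kappa> x))
      \<le> \<eta> * norm (\<kappa> x) + \<eta> * (real n * norm (\<kappa> x))"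
    using IH by (intro norm_triangle_mono)
  then show ?case by (simp add: algebra_simps)
qed

lemma power_in_N:
  assumes add: "additive_up_to \<eta> r" and x: "x \<in> U" and \<eta>: "\<eta> \<ge> 0"
    and small: "(1 + \<eta>) * (real n * norm (\<kappa> x)) < s" and s: "s \<le> r"
  shows "x [^] n \<in> N s"
  using small
proof (induction n rule: less_induct)
  case (less n)
  have le: "(1 + \<eta>) * (real k * norm (\<kappa> x)) < s" if "k \<le> n" for k
  proof -
    have "(1 + \<eta>) * (real k * norm (\<kappa> x)) \<le> (1 + \<eta>) * (real n * norm (\<kappa> x))"
      using that \<eta> by (intro mult_left_mono mult_right_mono) auto
    then show ?thesis using less.prems by simp
  qed
  have pow: "x [^] k \<in> N s" if "k < n" for k using less.IH[OF that le] that by simp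
  have s0: "0 < s" using le[of 0] by simp
  show ?case
  proof (cases n)
    case 0
    then show ?thesis using one_in_N s0 by simp
  next
    case (Suc m)
    have "1 * norm (\<kappa> x) \<le> (1 + \<eta>) * (real 1 * norm (\<kappa> x))"
      using \<eta> by (intro mult_mono) auto
    then have xs: "x \<in> N s" using le[of 1] Suc x by (simp add: N_def)
    have adds: "additive_up_to \<eta> s" using add s0 s additive_mono by blast
    have "x [^] m \<otimes> x \<in> U" using additive_in_U[OF adds pow xs] Suc by simp
    moreover have "norm (\<kappa> (x [^] n)) \<le> norm (real n *\<^sub>R \<kappa> x) + norm (\<kappa> (x [^] n) - real n *\<^sub>R \<kappa> x)"
      using norm_triangle_ineq[of "real n *\<^sub>R \<kappa> x" "\<kappa> (x [^] n) - real n *\<^sub>R \<kappa> x"] by simp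
    moreover have "norm (\<kappa> (x [^] n) - real n *\<^sub>R \<kappa> x) \<le> \<eta> * (real n * norm (\<kappa> x))"
      by (rule power_approx[OF adds xs pow])
    moreover have "(1 + \<eta>) * (real n * norm (\<kappa> x)) = norm (real n *\<^sub>R \<kappa> x) + \<eta> * (real n * norm (\<kappa> x))"
      by (simp add: algebra_simps)
    ultimately have "norm (\<kappa> (x [^] n)) < s" using less.prems by linarith
    with \<open>x [^] m \<otimes> x \<in> U\<close> show ?thesis using Suc by (simp add: N_def)
  qed
qed

definition list_prod :: "'p list \<Rightarrow> 'p" where "list_prod xs = foldr (\<otimes>) xs \<one>"

lemma list_prod_simps [simp]:
  "list_prod [] = \<one>" "list_prod (x # xs) = x \<otimes> list_prod xs"
  by (simp_all add: list_prod_def)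

lemma list_prod_closed: "set xs \<subseteq> carrier G \<Longrightarrow> list_prod xs \<in> carrier G"
  by (induction xs) auto

lemma continuous_list_prod:
  "(\<And>b. b \<in> set bs \<Longrightarrow> continuous_map X T (F b)) \<Longrightarrow>
    continuous_map X T (\<lambda>v. list_prod (map (\<lambda>b. F b v) bs))"
  by (induction bs) (auto simp: topspace_T intro!: continuous_mult2)

text \<open>
  The smallness condition keeps all partial products in \<open>N r\<close>, where the next
  multiplication is additive up to an error proportional to the factor that is added.
\<close>

lemma list_prod_approx:
  assumes add: "additive_up_to \<eta> r" and \<eta>: "\<eta> \<ge> 0"
    and "set xs \<subseteq> U" "(1 + \<eta>) * (\<Sum>x\<leftarrow>xs. norm (\<kappa> x)) < r"
  shows "list_prod xs \<in> N r \<and>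
    norm (\<kappa> (list_prod xs) - (\<Sum>x\<leftarrow>xs. \<kappa> x)) \<le> \<eta> * (\<Sum>x\<leftarrow>xs. norm (\<kappa> x))"
  using assms(3,4)
proof (induction xs)
  case Nil
  then show ?case using additive_pos[OF add] by (simp add: one_in_N \<kappa>_one)
next
  case (Cons x xs)
  define S where "S = (\<Sum>x\<leftarrow>xs. norm (\<kappa> x))"
  define K where "K = (\<Sum>x\<leftarrow>xs. \<kappa> x)"
  have S0: "S \<ge> 0" unfolding S_def by (intro sum_list_nonneg) auto
  have KS: "norm K \<le> S" unfolding K_def S_def by (induction xs) (auto intro: norm_triangle_mono)
  have small: "(1 + \<eta>) * (norm (\<kappa> x) + S) < r" using Cons.prems(2) by (simp add: S_def)
  have e1: "(1 + \<eta>) * (norm (\<kappa> x) + S) = norm (\<kappa> x) + S + \<eta> * norm (\<kappa> x) + \<eta> * S"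
    by (simp add: algebra_simps)
  have e2: "(1 + \<eta>) * S = S + \<eta> * S" by (simp add: algebra_simps)
  have nn: "\<eta> * norm (\<kappa> x) \<ge> 0" "\<eta> * S \<ge> 0" using \<eta> S0 by auto
  have "list_prod xs \<in> N r \<and> norm (\<kappa> (list_prod xs) - K) \<le> \<eta> * S"
    using Cons.IH Cons.prems(1) small e1 e2 nn norm_ge_zero[of "\<kappa> x"]
    unfolding S_def K_def by simp
  then have IH: "list_prod xs \<in> N r" "norm (\<kappa> (list_prod xs) - K) \<le> \<eta> * S" by auto
  have x: "x \<in> N r" using Cons.prems(1) small e1 nn S0 by (simp add: N_def)
  have m: "norm (\<kappa> (x \<otimes> list_prod xs) - \<kappa> x - \<kappa> (list_prod xs)) \<le> \<eta> * norm (\<kappa> x)"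
    by (rule additive_left[OF add x IH(1)])
  have a: "norm (\<kappa> (x \<otimes> list_prod xs) - (\<kappa> x + K)) \<le> \<eta> * norm (\<kappa> x) + \<eta> * S"
    using norm_triangle_mono[OF m IH(2)] by (simp add: algebra_simps)
  have "norm (\<kappa> (x \<otimes> list_prod xs)) \<le> norm (\<kappa> x + K) + norm (\<kappa> (x \<otimes> list_prod xs) - (\<kappa> x + K))"
    using norm_triangle_ineq[of "\<kappa> x + K" "\<kappa> (x \<otimes> list_prod xs) - (\<kappa> x + K)"] by simp
  then have "norm (\<kappa> (x \<otimes> list_prod xs)) < r"
    using a small e1 KS norm_triangle_ineq[of "\<kappa> x" K] by linarith
  then show ?case
    using a additive_in_U[OF add x IH(1)] by (simp add: N_def S_def K_def algebra_simps)
qed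

end

section \<open>The derivative of a flow of automorphisms at the identity\<close>

text \<open>
  Differentiability at the identity is pointwise in \<open>t\<close> here; its uniformity for
  small \<open>t\<close> is a consequence of the group structure (\<open>D_uniform\<close>).
\<close>

locale automorphism_flow = group_chart G T V U \<kappa>
  for G :: "('p, 'r) monoid_scheme" (structure) and T :: "'p topology"
    and V :: "'e::euclidean_space set" and U :: "'p set" and \<kappa> :: "'p \<Rightarrow> 'e" +
  fixes \<sigma> :: "real \<Rightarrow> 'p \<Rightarrow> 'p"
  assumes \<sigma>_hom: "\<And>t. \<sigma> t \<in> hom G G"
    and \<sigma>_zero: "\<And>x. x \<in> carrier G \<Longrightarrow> \<sigma> 0 x = x"
    and \<sigma>_add: "\<And>s t x. x \<in> carrier G \<Longrightarrow> \<sigma> (s + t) x = \<sigma> s (\<sigma> t x)"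
    and continuous_\<sigma>: "continuous_map (prod_topology euclideanreal T) T (\<lambda>(t, x). \<sigma> t x)"
    and \<sigma>_differentiable: "\<And>t. \<exists>L. linear L \<and> (\<forall>\<eta>>0. \<exists>r>0. \<forall>x\<in>U. norm (\<kappa> x) < r \<longrightarrow>
        \<sigma> t x \<in> U \<and> norm (\<kappa> (\<sigma> t x) - L (\<kappa> x)) \<le> \<eta> * norm (\<kappa> x))"
begin

lemma \<sigma>_closed: "x \<in> carrier G \<Longrightarrow> \<sigma> t x \<in> carrier G"
  using \<sigma>_hom hom_in_carrier by metis

lemma \<sigma>_mult: "x \<in> carrier G \<Longrightarrow> y \<in> carrier G \<Longrightarrow> \<sigma> t (x \<otimes> y) = \<sigma> t x \<otimes> \<sigma> t y"
  using \<sigma>_hom hom_mult by metis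

lemma group_hom_\<sigma>: "group_hom G G (\<sigma> t)"
  using \<sigma>_hom is_group by (simp add: group_hom_def group_hom_axioms_def)

lemma \<sigma>_one: "\<sigma> t \<one> = \<one>"
  using group_hom.hom_one[OF group_hom_\<sigma>] .

lemma \<sigma>_inv: "x \<in> carrier G \<Longrightarrow> \<sigma> t (inv x) = inv (\<sigma> t x)"
  using group_hom.hom_inv[OF group_hom_\<sigma>] .

lemma \<sigma>_pow: "x \<in> carrier G \<Longrightarrow> \<sigma> t (x [^] (n::nat)) = \<sigma> t x [^] n"
  using group_hom.hom_nat_pow[OF group_hom_\<sigma>] .

lemma continuous_\<sigma>2:
  "continuous_map X euclideanreal f \<Longrightarrow> continuous_map X T g \<Longrightarrow> continuous_map X T (\<lambda>x. \<sigma> (f x) (g x))"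
  using continuous_map_compose[OF continuous_map_pairedI continuous_\<sigma>, of X f g]
  by (simp add: o_def)

lemma \<sigma>_small:
  assumes "r > 0"
  obtains \<tau> s where "\<tau> > 0" "s > 0" "\<And>t x. \<bar>t\<bar> < \<tau> \<Longrightarrow> x \<in> N s \<Longrightarrow> \<sigma> t x \<in> N r"
proof -
  define W where "W = {p \<in> topspace (prod_topology euclideanreal T). (\<lambda>(t, x). \<sigma> t x) p \<in> N r}"
  have W: "openin (prod_topology euclideanreal T) W"
    unfolding W_def by (rule openin_continuous_map_preimage[OF continuous_\<sigma> openin_N])
  have "(0, \<one>) \<in> W" using one_in_N[OF assms] by (simp add: W_def topspace_T \<sigma>_one)
  then obtain A B where AB: "openin euclideanreal A" "openin T B" "0 \<in> A" "\<one> \<in> B" "A \<times> B \<subseteq> W"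
    using W openin_prod_topology_alt[of euclideanreal T W] by meson
  obtain \<tau> where \<tau>: "\<tau> > 0" "ball 0 \<tau> \<subseteq> A" using AB(1,3) open_contains_ball[of A] by auto
  obtain s where s: "s > 0" "N s \<subseteq> B" using N_small AB by auto
  have "\<sigma> t x \<in> N r" if "\<bar>t\<bar> < \<tau>" "x \<in> N s" for t x
  proof -
    have "t \<in> A" using that(1) \<tau>(2) by (auto simp: subset_eq)
    then have "(t, x) \<in> W" using that s(2) AB(5) by blast
    then show ?thesis by (simp add: W_def)
  qed
  then show thesis using that \<tau>(1) s(1) by blast
qed

lemma \<sigma>_fixed_small:
  assumes "r > 0"
  obtains s where "s > 0" "\<And>x. x \<in> N s \<Longrightarrow> \<sigma> t x \<in> N r"
proof -
  have "continuous_map (prod_topology T T) T (\<lambda>p. \<sigma> t (fst p))"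
    by (intro continuous_\<sigma>2 continuous_map_fst) auto
  then have "continuous_map (prod_topology T T) T (\<lambda>(x, y). \<sigma> t x)"
    by (simp add: case_prod_unfold)
  from N_small2[OF this \<sigma>_one assms] obtain s where
    "s > 0" "\<And>x y. x \<in> N s \<Longrightarrow> y \<in> N s \<Longrightarrow> \<sigma> t x \<in> N r" by metis
  then show thesis using that by blast
qed

text \<open>
  Automorphisms that map a fixed neighbourhood into another one are uniformly Lipschitz at the
  identity. For small \<open>x\<close> the powers up to an exponent \<open>n\<close>
  proportional to \<open>1 / norm (\<kappa> x)\<close> remain in the first neighbourhood, so the
  powers of \<open>\<sigma> t x\<close> remain in the second one, which forces \<open>norm
  (\<kappa> (\<sigma> t x))\<close> to be of order \<open>1 / n\<close>.
\<close>

lemma \<sigma>_linear_growth: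
  obtains \<tau> r C where "\<tau> > 0" "r > 0" "C > 0"
    "\<And>t x. \<bar>t\<bar> < \<tau> \<Longrightarrow> x \<in> N r \<Longrightarrow> \<sigma> t x \<in> U \<and> norm (\<kappa> (\<sigma> t x)) \<le> C * norm (\<kappa> x)"
proof -
  obtain r0 where r0: "additive_up_to (1/2) r0" using additive_radius[of "1/2"] by auto
  have r0_pos: "r0 > 0" using r0 additive_pos by blast
  obtain \<tau> s where \<tau>: "\<tau> > 0" and s: "s > 0"
    and \<sigma>s: "\<And>t x. \<bar>t\<bar> < \<tau> \<Longrightarrow> x \<in> N s \<Longrightarrow> \<sigma> t x \<in> N r0"
    using \<sigma>_small[OF r0_pos] by metis
  define \<rho> where "\<rho> = min s r0"
  have \<rho>: "\<rho> > 0" "\<rho> \<le> r0" "N \<rho> \<subseteq> N s" using s r0_pos N_mono by (auto simp: \<rho>_def)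
  have main: "\<sigma> t x \<in> U \<and> norm (\<kappa> (\<sigma> t x)) \<le> (12 * r0 / \<rho>) * norm (\<kappa> x)"
    if t: "\<bar>t\<bar> < \<tau>" and x: "x \<in> N (\<rho>/3)" for t x
  proof (cases "\<kappa> x = 0")
    case True
    then have "x = \<one>" using x N_subset_U \<kappa>_eq_0 by blast
    then show ?thesis by (simp add: \<sigma>_one one_in_U \<kappa>_one)
  next
    case False
    define a where "a = \<rho> / (3 * norm (\<kappa> x))"
    \<comment> \<open>The largest exponent for which the powers of \<open>x\<close> are known to stay in \<open>N \<rho>\<close>, up to a constant factor.\<close>
    define n where "n = nat \<lfloor>a\<rfloor>"
    have x': "norm (\<kappa> x) > 0" "norm (\<kappa> x) < \<rho>/3" "x \<in> U" using False x by (auto simp: N_def)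
    have a1: "a > 1" using x' by (simp add: a_def field_simps)
    have n: "real n \<le> a" "real n \<ge> a / 2" "real n \<ge> 1"
    proof -
      show "real n \<le> a" using a1 by (simp add: n_def)
      have "real n \<ge> real_of_int \<lfloor>a\<rfloor>" by (simp add: n_def)
      then have "real n > a - 1" by linarith
      moreover have "\<lfloor>a\<rfloor> \<ge> 1" using a1 by simp
      then show "real n \<ge> 1" by (simp add: n_def)
      ultimately show "real n \<ge> a / 2" using a1 by linarith
    qed
    have an: "a * norm (\<kappa> x) = \<rho> / 3" using x' by (simp add: a_def)
    have nu: "real n * norm (\<kappa> x) \<le> \<rho> / 3"
      using mult_right_mono[OF n(1), of "norm (\<kappa> x)"] an by simp
    have nl: "real n * norm (\<kappa> x) \<ge> \<rho> / 6"
      using mult_right_mono[OF n(2), of "norm (\<kappa> x)"] an by simp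
    have q: "\<sigma> t x [^] k \<in> N r0" if k: "k \<le> n" for k
    proof -
      have "real k * norm (\<kappa> x) \<le> real n * norm (\<kappa> x)" using k by (intro mult_right_mono) auto
      then have "(1 + 1/2) * (real k * norm (\<kappa> x)) < \<rho>" using nu \<rho>(1) by simp
      then have "x [^] k \<in> N \<rho>" by (rule power_in_N[OF r0 x'(3) _ _ \<rho>(2), rotated]) simp
      then have "\<sigma> t (x [^] k) \<in> N r0" using \<sigma>s t \<rho>(3) by blast
      then show ?thesis using \<sigma>_pow[of x] x N_carrier by simp
    qed
    have "\<sigma> t x [^] (1::nat) \<in> N r0" using q[of 1] n(3) by linarith
    then have q1: "\<sigma> t x \<in> N r0" using \<sigma>_closed N_carrier[OF x] by simp
    have "norm (\<kappa> (\<sigma> t x [^] n) - real n *\<^sub>R \<kappa> (\<sigma> t x)) \<le> 1/2 * (real n * norm (\<kappa> (\<sigma> t x)))"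
      by (rule power_approx[OF r0 q1]) (use q in auto)
    moreover have "norm (real n *\<^sub>R \<kappa> (\<sigma> t x)) \<le> norm (\<kappa> (\<sigma> t x [^] n)) +
        norm (\<kappa> (\<sigma> t x [^] n) - real n *\<^sub>R \<kappa> (\<sigma> t x))"
      using norm_triangle_ineq4[of "\<kappa> (\<sigma> t x [^] n)" "\<kappa> (\<sigma> t x [^] n) - real n *\<^sub>R \<kappa> (\<sigma> t x)"] by simp
    moreover have "norm (\<kappa> (\<sigma> t x [^] n)) < r0" using q[of n] by (simp add: N_def)
    ultimately have "real n * norm (\<kappa> (\<sigma> t x)) < 2 * r0" by simp
    then have "(a / 2) * norm (\<kappa> (\<sigma> t x)) < 2 * r0"
      using mult_right_mono[OF n(2), of "norm (\<kappa> (\<sigma> t x))"] by simp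
    then have "\<rho> * norm (\<kappa> (\<sigma> t x)) < 12 * r0 * norm (\<kappa> x)"
      using x' by (simp add: a_def field_simps)
    then show ?thesis using q1 \<rho>(1) by (simp add: N_def field_simps)
  qed
  show thesis
    by (rule that[of \<tau> "\<rho>/3" "12 * r0 / \<rho>"]) (use \<tau> \<rho> r0_pos main in auto)
qed

text \<open>
  The previous estimate, applied to the quotient of the two points.
\<close>

lemma \<sigma>_Lipschitz:
  obtains \<tau> r C where "\<tau> > 0" "r > 0" "C > 0"
    "\<And>t x. \<bar>t\<bar> < \<tau> \<Longrightarrow> x \<in> N r \<Longrightarrow> \<sigma> t x \<in> U \<and> norm (\<kappa> (\<sigma> t x)) \<le> C * norm (\<kappa> x)"
    "\<And>t x y. \<bar>t\<bar> < \<tau> \<Longrightarrow> x \<in> N r \<Longrightarrow> y \<in> N r \<Longrightarrow>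
       norm (\<kappa> (\<sigma> t x) - \<kappa> (\<sigma> t y)) \<le> C * norm (\<kappa> x - \<kappa> y)"
proof -
  obtain \<tau>1 r1 C where \<tau>1: "\<tau>1 > 0" and r1: "r1 > 0" and C: "C > 0"
    and gr: "\<And>t x. \<bar>t\<bar> < \<tau>1 \<Longrightarrow> x \<in> N r1 \<Longrightarrow> \<sigma> t x \<in> U \<and> norm (\<kappa> (\<sigma> t x)) \<le> C * norm (\<kappa> x)"
    using \<sigma>_linear_growth by metis
  obtain r0 where r0: "additive_up_to (1/2) r0" using additive_radius[of "1/2"] by auto
  have r0_pos: "r0 > 0" using r0 additive_pos by blast
  obtain \<tau>2 r2 where \<tau>2: "\<tau>2 > 0" and r2: "r2 > 0"
    and sm: "\<And>t x. \<bar>t\<bar> < \<tau>2 \<Longrightarrow> x \<in> N r2 \<Longrightarrow> \<sigma> t x \<in> N r0"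
    using \<sigma>_small[OF r0_pos] by metis
  have "continuous_map (prod_topology T T) T (\<lambda>p. inv (fst p) \<otimes> snd p)"
    by (intro continuous_mult2 continuous_inv2 continuous_map_fst continuous_map_snd)
  then have "continuous_map (prod_topology T T) T (\<lambda>(x, y). inv x \<otimes> y)"
    by (simp add: case_prod_unfold)
  moreover have "min r1 (min r0 r2) > 0" using r1 r0_pos r2 by simp
  ultimately obtain r3 where r3: "r3 > 0"
    and quot: "\<And>x y. x \<in> N r3 \<Longrightarrow> y \<in> N r3 \<Longrightarrow> inv x \<otimes> y \<in> N (min r1 (min r0 r2))"
    using N_small2[of "\<lambda>x y. inv x \<otimes> y"] by (metis inv_one l_one one_closed)
  define r where "r = Min {r0, r1, r2, r3}"
  have r: "r > 0" "N r \<subseteq> N r0" "N r \<subseteq> N r1" "N r \<subseteq> N r2" "N r \<subseteq> N r3"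
    using r0_pos r1 r2 r3 N_mono by (auto simp: r_def)
  have lip: "norm (\<kappa> (\<sigma> t x) - \<kappa> (\<sigma> t y)) \<le> (3 * C) * norm (\<kappa> x - \<kappa> y)"
    if t: "\<bar>t\<bar> < min \<tau>1 \<tau>2" and x: "x \<in> N r" and y: "y \<in> N r" for t x y
  proof -
    define c where "c = inv y \<otimes> x"
    have car: "x \<in> carrier G" "y \<in> carrier G" using x y N_carrier by auto
    have "c \<in> N (min r1 (min r0 r2))" unfolding c_def by (rule quot) (use x y r in auto)
    then have c: "c \<in> N r0" "c \<in> N r1" "c \<in> N r2"
      using N_mono[of "min r1 (min r0 r2)"] by (auto simp: subset_eq)
    have cx: "norm (\<kappa> c) \<le> 2 * norm (\<kappa> x - \<kappa> y)"
      unfolding c_def by (rule quotient_bound[OF r0]) (use x y r c car in \<open>auto simp: c_def\<close>)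
    have "y \<otimes> c = x" using car by (simp add: c_def flip: m_assoc)
    then have eq: "\<sigma> t x = \<sigma> t y \<otimes> \<sigma> t c" using \<sigma>_mult[of y c t] car c_def by auto
    have "norm (\<kappa> (\<sigma> t y \<otimes> \<sigma> t c) - \<kappa> (\<sigma> t y) - \<kappa> (\<sigma> t c)) \<le> 1/2 * norm (\<kappa> (\<sigma> t c))"
      by (rule additive_right[OF r0]) (use sm t y c r in auto)
    moreover have "norm (\<kappa> (\<sigma> t y \<otimes> \<sigma> t c) - \<kappa> (\<sigma> t y)) \<le> norm (\<kappa> (\<sigma> t c)) +
        norm (\<kappa> (\<sigma> t y \<otimes> \<sigma> t c) - \<kappa> (\<sigma> t y) - \<kappa> (\<sigma> t c))"
      using norm_triangle_ineq[of "\<kappa> (\<sigma> t c)" "\<kappa> (\<sigma> t y \<otimes> \<sigma> t c) - \<kappa> (\<sigma> t y) - \<kappa> (\<sigma> t c)"] by simp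
    moreover have "norm (\<kappa> (\<sigma> t c)) \<le> C * norm (\<kappa> c)" using gr t c by simp
    moreover have "C * norm (\<kappa> c) \<le> C * (2 * norm (\<kappa> x - \<kappa> y))" using cx C by simp
    ultimately show ?thesis unfolding eq by simp
  qed
  show thesis
  proof (rule that[of "min \<tau>1 \<tau>2" r "3 * C"])
    fix t x assume t: "\<bar>t\<bar> < min \<tau>1 \<tau>2" and x: "x \<in> N r"
    have "C * norm (\<kappa> x) \<le> 3 * C * norm (\<kappa> x)" using C by (intro mult_right_mono) auto
    then show "\<sigma> t x \<in> U \<and> norm (\<kappa> (\<sigma> t x)) \<le> 3 * C * norm (\<kappa> x)"
      using gr[of t x] t x r by fastforce
  qed (use \<tau>1 \<tau>2 r C lip in auto)
qed

text \<open>
  The derivative of \<open>\<sigma> t\<close> at the identity, in coordinates. It is determined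
  only on \<open>V\<close>.
\<close>

definition D :: "real \<Rightarrow> 'e \<Rightarrow> 'e" where
  "D t = (SOME L. linear L \<and> (\<forall>\<eta>>0. \<exists>r>0. \<forall>x\<in>U. norm (\<kappa> x) < r \<longrightarrow>
        \<sigma> t x \<in> U \<and> norm (\<kappa> (\<sigma> t x) - L (\<kappa> x)) \<le> \<eta> * norm (\<kappa> x)))"

lemma linear_D: "linear (D t)"
  and D_approx_ex: "\<And>\<eta>. \<eta> > 0 \<Longrightarrow> \<exists>r>0. \<forall>x\<in>U. norm (\<kappa> x) < r \<longrightarrow>
        \<sigma> t x \<in> U \<and> norm (\<kappa> (\<sigma> t x) - D t (\<kappa> x)) \<le> \<eta> * norm (\<kappa> x)"
  using someI_ex[OF \<sigma>_differentiable[of t]] unfolding D_def[symmetric] by blast+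

lemma D_approx:
  assumes "\<eta> > 0"
  obtains r where "r > 0" "\<And>x. x \<in> N r \<Longrightarrow> \<sigma> t x \<in> U"
    "\<And>x. x \<in> N r \<Longrightarrow> norm (\<kappa> (\<sigma> t x) - D t (\<kappa> x)) \<le> \<eta> * norm (\<kappa> x)"
  using D_approx_ex[OF assms, of t] unfolding N_def by blast

text \<open>
  An automorphism is as close to linear at scale \<open>norm (\<kappa> x)\<close> as it is
  infinitesimally: \<open>x\<close> is nearly \<open>y [^] n\<close> for the point
  \<open>y\<close> with coordinate \<open>\<kappa> x / n\<close>, so \<open>\<sigma> t x\<close>
  is nearly \<open>\<sigma> t y [^] n\<close>, whose coordinate is nearly \<open>n\<close> times
  that of \<open>\<sigma> t y\<close>; as \<open>n\<close> grows this tends to \<open>D t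
  (\<kappa> x)\<close>. The errors depend on \<open>t\<close> only through the uniform Lipschitz
  constant.
\<close>

lemma D_uniform:
  obtains \<tau> where "\<tau> > 0"
    "\<And>\<eta>. \<eta> > 0 \<Longrightarrow> \<exists>r>0. \<forall>t x. \<bar>t\<bar> < \<tau> \<longrightarrow> x \<in> N r \<longrightarrow>
       norm (\<kappa> (\<sigma> t x) - D t (\<kappa> x)) \<le> \<eta> * norm (\<kappa> x)"
proof -
  obtain \<tau> r1 C where \<tau>: "\<tau> > 0" and r1: "r1 > 0" and C: "C > 0"
    and gr: "\<And>t x. \<bar>t\<bar> < \<tau> \<Longrightarrow> x \<in> N r1 \<Longrightarrow> \<sigma> t x \<in> U \<and> norm (\<kappa> (\<sigma> t x)) \<le> C * norm (\<kappa> x)"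
    and lip: "\<And>t x y. \<bar>t\<bar> < \<tau> \<Longrightarrow> x \<in> N r1 \<Longrightarrow> y \<in> N r1 \<Longrightarrow>
       norm (\<kappa> (\<sigma> t x) - \<kappa> (\<sigma> t y)) \<le> C * norm (\<kappa> x - \<kappa> y)"
    using \<sigma>_Lipschitz by metis
  obtain R where R: "R > 0" "\<And>v. v \<in> V \<Longrightarrow> norm v < R \<Longrightarrow> v \<in> \<kappa> ` U"
    using chart_radius by metis
  show thesis
  proof (rule that[OF \<tau>])
    fix \<eta> :: real assume \<eta>: "\<eta> > 0"
    define \<eta>' where "\<eta>' = min 1 (\<eta> / (2 * C))"
    have \<eta>': "\<eta>' > 0" "\<eta>' \<le> 1" "2 * C * \<eta>' \<le> \<eta>"
    proof -
      have "2 * C * \<eta>' \<le> 2 * C * (\<eta> / (2 * C))" unfolding \<eta>'_def using C by (intro mult_left_mono) auto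
      then show "2 * C * \<eta>' \<le> \<eta>" using C by simp
    qed (use \<eta> C in \<open>auto simp: \<eta>'_def\<close>)
    obtain r2 where r2: "additive_up_to \<eta>' r2" using additive_radius[OF \<eta>'(1)] by metis
    have r2_pos: "r2 > 0" using r2 additive_pos by blast
    define r where "r = Min {r1/2, r2/2, R, r2 / (2 * C)}"
    have r: "r > 0" "r \<le> r1/2" "r \<le> r2/2" "r \<le> R" "r \<le> r2/(2*C)"
      using r1 r2_pos R(1) C by (auto simp: r_def)
    have "norm (\<kappa> (\<sigma> t x) - D t (\<kappa> x)) \<le> \<eta> * norm (\<kappa> x)"
      if t: "\<bar>t\<bar> < \<tau>" and x: "x \<in> N r" for t x
    proof -
      define v where "v = \<kappa> x"
      have v: "v \<in> V" "norm v < r" using x \<kappa>_in_V by (auto simp: v_def N_def)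
      have xr1: "x \<in> N r1" using x N_mono[of r r1] r by auto
      have eps: "norm (\<kappa> (\<sigma> t x) - D t v) \<le> \<eta> * norm v + \<epsilon> * norm v" if \<epsilon>: "\<epsilon> > 0" for \<epsilon>
      proof -
        obtain r3 where r3: "r3 > 0" "\<And>x. x \<in> N r3 \<Longrightarrow> norm (\<kappa> (\<sigma> t x) - D t (\<kappa> x)) \<le> \<epsilon> * norm (\<kappa> x)"
          using D_approx[OF \<epsilon>, of t] by metis
        obtain n where n: "real n > norm v / r3" using reals_Archimedean2 by blast
        have "0 \<le> norm v / r3" using r3(1) by simp
        then have n0: "real n > 0" using n by linarith
        define y where "y = \<kappa>inv ((1 / real n) *\<^sub>R v)"
        have nw: "norm ((1 / real n) *\<^sub>R v) \<le> norm v"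
          using n0 mult_right_mono[of 1 "real n" "norm v"] by (simp add: field_simps)
        have "(1 / real n) *\<^sub>R v \<in> V" using v(1) subspace_V by (simp add: subspace_scale)
        then have wU: "(1 / real n) *\<^sub>R v \<in> \<kappa> ` U" using R(2) nw v(2) r(4) by auto
        have y: "y \<in> U" "\<kappa> y = (1 / real n) *\<^sub>R v"
          using wU by (auto simp: y_def \<kappa>_\<kappa>inv \<kappa>inv_in_U)
        have ny: "norm (\<kappa> y) = norm v / real n" using n0 by (simp add: y(2))
        have "norm v / real n < r3" using n n0 r3(1) by (simp add: field_simps)
        then have y3: "y \<in> N r3" using y(1) by (simp only: N_def ny mem_Collect_eq)
        have yc: "y \<in> carrier G" using y(1) U_subset by auto
        have kv: "real k * norm (\<kappa> y) \<le> norm v" if "k \<le> n" for k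
          using that n0 mult_right_mono[of "real k" "real n" "norm v"] by (simp add: ny field_simps)
        have pw: "y [^] k \<in> N (min r1 r2)" if k: "k \<le> n" for k
        proof (rule power_in_N[OF r2 y(1)])
          have "(1 + \<eta>') * (real k * norm (\<kappa> y)) \<le> 2 * norm v"
            using \<eta>' kv[OF k] by (intro mult_mono) auto
          also have "\<dots> < min r1 r2" using v(2) r by auto
          finally show "(1 + \<eta>') * (real k * norm (\<kappa> y)) < min r1 r2" .
        qed (use \<eta>' in auto)
        have pw1: "y [^] k \<in> N r1" and pw2: "y [^] k \<in> N r2" if "k \<le> n" for k
          using pw[OF that] N_mono[of "min r1 r2"] by (auto simp: subset_eq)
        have n1: "1 \<le> n" using n0 by simp
        have yr2: "y \<in> N r2" and yr1: "y \<in> N r1" using pw1[OF n1] pw2[OF n1] yc by auto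
        have pa: "norm (\<kappa> (y [^] k) - real k *\<^sub>R \<kappa> y) \<le> \<eta>' * norm v" if k: "k \<le> n" for k
        proof -
          have "norm (\<kappa> (y [^] k) - real k *\<^sub>R \<kappa> y) \<le> \<eta>' * (real k * norm (\<kappa> y))"
            by (rule power_approx[OF r2 yr2]) (use pw2 k in auto)
          also have "\<dots> \<le> \<eta>' * norm v" using \<eta>' kv[OF k] by (intro mult_left_mono) auto
          finally show ?thesis .
        qed
        define q where "q = \<sigma> t y"
        have qk: "q [^] k = \<sigma> t (y [^] k)" for k :: nat using \<sigma>_pow[OF yc] by (simp add: q_def)
        have qN: "q [^] k \<in> N r2" if k: "k \<le> n" for k
        proof -
          have "norm (\<kappa> (y [^] k)) \<le> norm (real k *\<^sub>R \<kappa> y) + norm (\<kappa> (y [^] k) - real k *\<^sub>R \<kappa> y)"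
            using norm_triangle_ineq[of "real k *\<^sub>R \<kappa> y" "\<kappa> (y [^] k) - real k *\<^sub>R \<kappa> y"] by simp
          also have "\<dots> \<le> norm v + 1 * norm v"
          proof (rule add_mono)
            show "norm (real k *\<^sub>R \<kappa> y) \<le> norm v" using kv[OF k] by simp
            show "norm (\<kappa> (y [^] k) - real k *\<^sub>R \<kappa> y) \<le> 1 * norm v"
              using pa[OF k] mult_right_mono[OF \<eta>'(2) norm_ge_zero[of v]] by linarith
          qed
          finally have "C * norm (\<kappa> (y [^] k)) \<le> C * (2 * norm v)" using C by simp
          also have "\<dots> < r2"
          proof -
            have "norm v < r2 / (2 * C)" using v(2) r(5) by linarith
            then show ?thesis using C by (simp add: field_simps)
          qed
          finally show ?thesis using gr[OF t pw1[OF k]] by (simp add: qk N_def)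
        qed
        have q2: "q \<in> N r2" using qN[OF n1] \<sigma>_closed[OF yc] by (simp add: q_def)
        have 1: "norm (\<kappa> (q [^] n) - real n *\<^sub>R \<kappa> q) \<le> C * (\<eta>' * norm v)"
        proof -
          have "norm (\<kappa> (q [^] n) - real n *\<^sub>R \<kappa> q) \<le> \<eta>' * (real n * norm (\<kappa> q))"
            by (rule power_approx[OF r2 q2]) (use qN in auto)
          also have "\<dots> \<le> \<eta>' * (real n * (C * norm (\<kappa> y)))"
            using gr[OF t yr1] \<eta>' by (intro mult_left_mono) (auto simp: q_def)
          also have "\<dots> = C * (\<eta>' * norm v)" using n0 by (simp add: ny)
          finally show ?thesis .
        qed
        have 2: "norm (\<kappa> (\<sigma> t x) - \<kappa> (q [^] n)) \<le> C * (\<eta>' * norm v)"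
        proof -
          have "norm (\<kappa> (\<sigma> t x) - \<kappa> (q [^] n)) \<le> C * norm (\<kappa> x - \<kappa> (y [^] n))"
            unfolding qk by (rule lip[OF t xr1 pw1]) simp
          also have "\<dots> \<le> C * (\<eta>' * norm v)"
            using pa[of n] C n0 by (simp add: y(2) v_def[symmetric] norm_minus_commute)
          finally show ?thesis .
        qed
        have 3: "norm (real n *\<^sub>R \<kappa> q - D t v) \<le> \<epsilon> * norm v"
        proof -
          have "D t v = D t (real n *\<^sub>R \<kappa> y)" using n0 by (simp add: y(2))
          then have "real n *\<^sub>R \<kappa> q - D t v = real n *\<^sub>R (\<kappa> (\<sigma> t y) - D t (\<kappa> y))"
            by (simp add: linear_cmul[OF linear_D] q_def scaleR_diff_right)
          then have "norm (real n *\<^sub>R \<kappa> q - D t v) = real n * norm (\<kappa> (\<sigma> t y) - D t (\<kappa> y))"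
            by simp
          also have "\<dots> \<le> real n * (\<epsilon> * norm (\<kappa> y))" using r3(2)[OF y3] by (intro mult_left_mono) auto
          also have "\<dots> = \<epsilon> * norm v" using n0 by (simp add: ny)
          finally show ?thesis .
        qed
        have "norm (\<kappa> (\<sigma> t x) - D t v) \<le> norm (\<kappa> (\<sigma> t x) - \<kappa> (q [^] n))
            + norm (\<kappa> (q [^] n) - real n *\<^sub>R \<kappa> q) + norm (real n *\<^sub>R \<kappa> q - D t v)"
          using norm_triangle_ineq[of "\<kappa> (\<sigma> t x) - \<kappa> (q [^] n)" "\<kappa> (q [^] n) - real n *\<^sub>R \<kappa> q"]
            norm_triangle_ineq[of "\<kappa> (\<sigma> t x) - real n *\<^sub>R \<kappa> q" "real n *\<^sub>R \<kappa> q - D t v"] by simp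
        also have "\<dots> \<le> (2 * C * \<eta>') * norm v + \<epsilon> * norm v" using 1 2 3 by (simp add: algebra_simps)
        also have "\<dots> \<le> \<eta> * norm v + \<epsilon> * norm v" using \<eta>'(3) by (intro add_right_mono mult_right_mono) auto
        finally show ?thesis .
      qed
      have "norm (\<kappa> (\<sigma> t x) - D t v) \<le> \<eta> * norm v"
      proof (rule field_le_epsilon)
        fix e :: real assume e: "e > 0"
        have pos: "norm v + 1 > 0" by (simp add: add_nonneg_pos)
        have "e / (norm v + 1) * norm v \<le> e" using e pos by (simp add: field_simps)
        then show "norm (\<kappa> (\<sigma> t x) - D t v) \<le> \<eta> * norm v + e"
          using eps[of "e / (norm v + 1)"] e pos by simp
      qed
      then show ?thesis by (simp add: v_def)
    qed
    then show "\<exists>r>0. \<forall>t x. \<bar>t\<bar> < \<tau> \<longrightarrow> x \<in> N r \<longrightarrow>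
       norm (\<kappa> (\<sigma> t x) - D t (\<kappa> x)) \<le> \<eta> * norm (\<kappa> x)" using r(1) by blast
  qed
qed

lemma D_unique:
  assumes L: "linear L" and v: "v \<in> V"
    and approx: "\<And>\<eta>. \<eta> > 0 \<Longrightarrow> \<exists>r>0. \<forall>x\<in>N r. norm (\<kappa> (\<sigma> t x) - L (\<kappa> x)) \<le> \<eta> * norm (\<kappa> x)"
  shows "D t v = L v"
proof -
  have "norm (D t v - L v) \<le> 0 + e" if e: "e > 0" for e
  proof -
    define \<eta> where "\<eta> = e / (2 * (norm v + 1))"
    have pos: "norm v + 1 > 0" by (simp add: add_nonneg_pos)
    have \<eta>: "\<eta> > 0" "2 * \<eta> * norm v \<le> e" using e pos by (auto simp: \<eta>_def field_simps)
    obtain r1 where r1: "r1 > 0" "\<And>x. x \<in> N r1 \<Longrightarrow> norm (\<kappa> (\<sigma> t x) - L (\<kappa> x)) \<le> \<eta> * norm (\<kappa> x)"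
      using approx[OF \<eta>(1)] by blast
    obtain r2 where r2: "r2 > 0" "\<And>x. x \<in> N r2 \<Longrightarrow> norm (\<kappa> (\<sigma> t x) - D t (\<kappa> x)) \<le> \<eta> * norm (\<kappa> x)"
      using D_approx[OF \<eta>(1), of t] by metis
    have "min r1 r2 > 0" using r1 r2 by simp
    then obtain c x where c: "c > 0" and x: "x \<in> N (min r1 r2)" "\<kappa> x = c *\<^sub>R v"
      using small_multiple[OF v] by metis
    have x12: "x \<in> N r1" "x \<in> N r2" using x(1) by (auto simp: N_def)
    have "norm (D t (\<kappa> x) - L (\<kappa> x)) \<le> 2 * \<eta> * norm (\<kappa> x)"
      using r1(2)[OF x12(1)] r2(2)[OF x12(2)]
        norm_triangle_ineq4[of "\<kappa> (\<sigma> t x) - L (\<kappa> x)" "\<kappa> (\<sigma> t x) - D t (\<kappa> x)"] by simp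
    moreover have "D t (\<kappa> x) - L (\<kappa> x) = c *\<^sub>R (D t v - L v)"
      by (simp add: x(2) linear_cmul[OF L] linear_cmul[OF linear_D] scaleR_diff_right)
    ultimately have "c * norm (D t v - L v) \<le> c * (2 * \<eta> * norm v)" using c by (simp add: x(2))
    then show ?thesis using c \<eta>(2) by simp
  qed
  then have "norm (D t v - L v) \<le> 0" by (rule field_le_epsilon)
  then show ?thesis by simp
qed

lemma D_in_V:
  assumes v: "v \<in> V"
  shows "D t v \<in> V"
proof -
  have "D t v \<in> closure V"
    unfolding closure_approachable
  proof (intro allI impI)
    fix e :: real assume e: "e > 0"
    define \<eta> where "\<eta> = e / (norm v + 1)"
    have pos: "norm v + 1 > 0" by (simp add: add_nonneg_pos)
    have \<eta>: "\<eta> > 0" "\<eta> * norm v < e" using e pos by (auto simp: \<eta>_def field_simps)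
    obtain r where r: "r > 0" "\<And>x. x \<in> N r \<Longrightarrow> \<sigma> t x \<in> U"
      "\<And>x. x \<in> N r \<Longrightarrow> norm (\<kappa> (\<sigma> t x) - D t (\<kappa> x)) \<le> \<eta> * norm (\<kappa> x)"
      using D_approx[OF \<eta>(1), of t] by metis
    obtain c x where c: "c > 0" and x: "x \<in> N r" "\<kappa> x = c *\<^sub>R v"
      using small_multiple[OF v r(1)] by metis
    let ?y = "(1/c) *\<^sub>R \<kappa> (\<sigma> t x)"
    have y: "?y \<in> V" using \<kappa>_in_V[OF r(2)[OF x(1)]] subspace_V by (simp add: subspace_scale)
    have "?y - D t v = (1/c) *\<^sub>R (\<kappa> (\<sigma> t x) - D t (\<kappa> x))"
      using c by (simp add: x(2) linear_cmul[OF linear_D] scaleR_diff_right)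
    then have eq: "norm (?y - D t v) = norm (\<kappa> (\<sigma> t x) - D t (\<kappa> x)) / c" using c by simp
    have "norm (\<kappa> (\<sigma> t x) - D t (\<kappa> x)) \<le> \<eta> * norm v * c"
      using r(3)[OF x(1)] c by (simp add: x(2) mult_ac)
    then have "norm (?y - D t v) \<le> \<eta> * norm v"
      unfolding eq using c by (simp only: pos_divide_le_eq)
    then have "dist ?y (D t v) < e" using \<eta>(2) by (simp only: dist_norm)
    with y show "\<exists>y\<in>V. dist y (D t v) < e" by blast
  qed
  then show ?thesis using closed_subspace[OF subspace_V] by simp
qed

lemma D_zero: "v \<in> V \<Longrightarrow> D 0 v = v"
proof (rule D_unique[of "\<lambda>v. v"])
  fix \<eta> :: real assume "\<eta> > 0"
  then show "\<exists>r>0. \<forall>x\<in>N r. norm (\<kappa> (\<sigma> 0 x) - \<kappa> x) \<le> \<eta> * norm (\<kappa> x)"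
    by (intro exI[of _ 1]) (auto simp: \<sigma>_zero N_carrier)
qed (simp_all add: linear_iff)

lemma D_add:
  assumes v: "v \<in> V"
  shows "D (s + t) v = D s (D t v)"
proof -
  have "D (s + t) v = (D s \<circ> D t) v"
  proof (rule D_unique[OF _ v])
    show "linear (D s \<circ> D t)" using linear_D linear_compose by blast
    fix \<eta> :: real assume \<eta>: "\<eta> > 0"
    obtain Bs where Bs: "Bs > 0" "\<And>w. norm (D s w) \<le> Bs * norm w"
      using linear_bounded_pos[OF linear_D] by metis
    obtain Bt where Bt: "Bt > 0" "\<And>w. norm (D t w) \<le> Bt * norm w"
      using linear_bounded_pos[OF linear_D] by metis
    define \<eta>1 where "\<eta>1 = min 1 (\<eta> / (2 * Bs))"
    define \<eta>2 where "\<eta>2 = \<eta> / (2 * (Bt + 1))"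
    have \<eta>1: "\<eta>1 > 0" "\<eta>1 \<le> 1" "Bs * \<eta>1 \<le> \<eta> / 2"
      using \<eta> Bs by (auto simp: \<eta>1_def min_def field_simps)
    have \<eta>2: "\<eta>2 > 0" "\<eta>2 * (Bt + 1) = \<eta> / 2" using \<eta> Bt by (auto simp: \<eta>2_def field_simps)
    obtain r1 where r1: "r1 > 0" "\<And>x. x \<in> N r1 \<Longrightarrow> norm (\<kappa> (\<sigma> t x) - D t (\<kappa> x)) \<le> \<eta>1 * norm (\<kappa> x)"
      using D_approx[OF \<eta>1(1), of t] by metis
    obtain r2 where r2: "r2 > 0" "\<And>x. x \<in> N r2 \<Longrightarrow> norm (\<kappa> (\<sigma> s x) - D s (\<kappa> x)) \<le> \<eta>2 * norm (\<kappa> x)"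
      using D_approx[OF \<eta>2(1), of s] by metis
    obtain r3 where r3: "r3 > 0" "\<And>x. x \<in> N r3 \<Longrightarrow> \<sigma> t x \<in> N r2"
      using \<sigma>_fixed_small[OF r2(1)] by metis
    have "norm (\<kappa> (\<sigma> (s + t) x) - (D s \<circ> D t) (\<kappa> x)) \<le> \<eta> * norm (\<kappa> x)" if x: "x \<in> N (min r1 r3)" for x
    proof -
      have x1: "x \<in> N r1" and x3: "x \<in> N r3" using x by (auto simp: N_def)
      define z where "z = \<sigma> t x"
      have zx: "norm (\<kappa> z - D t (\<kappa> x)) \<le> \<eta>1 * norm (\<kappa> x)" using r1(2)[OF x1] by (simp add: z_def)
      have "norm (\<kappa> z) \<le> norm (D t (\<kappa> x)) + norm (\<kappa> z - D t (\<kappa> x))"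
        using norm_triangle_ineq[of "D t (\<kappa> x)" "\<kappa> z - D t (\<kappa> x)"] by simp
      also have "\<dots> \<le> Bt * norm (\<kappa> x) + 1 * norm (\<kappa> x)"
        using zx mult_right_mono[OF \<eta>1(2) norm_ge_zero[of "\<kappa> x"]] Bt(2)[of "\<kappa> x"] by linarith
      finally have nz: "norm (\<kappa> z) \<le> (Bt + 1) * norm (\<kappa> x)" by (simp add: algebra_simps)
      have "norm (\<kappa> (\<sigma> s z) - D s (\<kappa> z)) \<le> \<eta>2 * norm (\<kappa> z)" using r2(2) r3(2)[OF x3] by (simp add: z_def)
      also have "\<dots> \<le> \<eta>2 * ((Bt + 1) * norm (\<kappa> x))" using nz \<eta>2 by (intro mult_left_mono) auto
      also have "\<dots> = \<eta> / 2 * norm (\<kappa> x)" by (simp only: mult.assoc[symmetric] \<eta>2(2))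
      finally have 1: "norm (\<kappa> (\<sigma> s z) - D s (\<kappa> z)) \<le> \<eta> / 2 * norm (\<kappa> x)" .
      have "D s (\<kappa> z) - D s (D t (\<kappa> x)) = D s (\<kappa> z - D t (\<kappa> x))" by (simp add: linear_diff[OF linear_D])
      then have "norm (D s (\<kappa> z) - D s (D t (\<kappa> x))) \<le> Bs * norm (\<kappa> z - D t (\<kappa> x))" using Bs(2) by simp
      also have "\<dots> \<le> Bs * (\<eta>1 * norm (\<kappa> x))" using zx Bs(1) by simp
      also have "\<dots> \<le> \<eta> / 2 * norm (\<kappa> x)" using mult_right_mono[OF \<eta>1(3) norm_ge_zero[of "\<kappa> x"]] by simp
      finally have 2: "norm (D s (\<kappa> z) - D s (D t (\<kappa> x))) \<le> \<eta> / 2 * norm (\<kappa> x)" .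
      have "\<sigma> (s + t) x = \<sigma> s z" using \<sigma>_add N_carrier[OF x] by (simp add: z_def)
      then show ?thesis
        using norm_triangle_mono[OF 1 2] by simp
    qed
    then show "\<exists>r>0. \<forall>x\<in>N r. norm (\<kappa> (\<sigma> (s + t) x) - (D s \<circ> D t) (\<kappa> x)) \<le> \<eta> * norm (\<kappa> x)"
      using r1(1) r3(1) by (intro exI[of _ "min r1 r3"]) auto
  qed
  then show ?thesis by simp
qed

text \<open>
  By uniformity in \<open>t\<close>, the map \<open>t \<mapsto> D t v\<close> is a uniform limit
  of multiples of the continuous maps \<open>t \<mapsto> \<kappa> (\<sigma> t x)\<close>.
\<close>

lemma D_continuous:
  assumes v: "v \<in> V"
  shows "((\<lambda>t. D t v) \<longlongrightarrow> v) (at 0)"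
proof (rule LIM_I)
  fix e :: real assume e: "e > 0"
  obtain \<tau> where \<tau>: "\<tau> > 0" and unif: "\<And>\<eta>. \<eta> > 0 \<Longrightarrow> \<exists>r>0. \<forall>t x. \<bar>t\<bar> < \<tau> \<longrightarrow> x \<in> N r \<longrightarrow>
       norm (\<kappa> (\<sigma> t x) - D t (\<kappa> x)) \<le> \<eta> * norm (\<kappa> x)"
    using D_uniform by metis
  define \<eta> where "\<eta> = e / (2 * (norm v + 1))"
  have pos: "norm v + 1 > 0" by (simp add: add_nonneg_pos)
  have \<eta>: "\<eta> > 0" "\<eta> * norm v \<le> e / 2" using e pos by (auto simp: \<eta>_def field_simps)
  obtain r where r: "r > 0" "\<And>t x. \<bar>t\<bar> < \<tau> \<Longrightarrow> x \<in> N r \<Longrightarrow>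
       norm (\<kappa> (\<sigma> t x) - D t (\<kappa> x)) \<le> \<eta> * norm (\<kappa> x)"
    using unif[OF \<eta>(1)] by blast
  obtain c x where c: "c > 0" and x: "x \<in> N r" "\<kappa> x = c *\<^sub>R v"
    using small_multiple[OF v r(1)] by metis
  define W where "W = {y \<in> U. \<kappa> y \<in> ball (\<kappa> x) (c * e / 2)}"
  have "openin T W" unfolding W_def by (rule openin_\<kappa>_preimage) simp
  moreover have "continuous_map euclideanreal T (\<lambda>t. \<sigma> t x)"
    by (intro continuous_\<sigma>2) (auto simp: topspace_T N_carrier[OF x(1)])
  ultimately have "openin euclideanreal {t \<in> topspace euclideanreal. \<sigma> t x \<in> W}"
    by (rule openin_continuous_map_preimage[rotated])
  then have "open {t. \<sigma> t x \<in> W}" by simp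
  moreover have "0 \<in> {t. \<sigma> t x \<in> W}"
    using x(1) c e by (simp add: W_def \<sigma>_zero N_carrier N_subset_U[THEN subsetD])
  ultimately obtain \<tau>2 where \<tau>2: "\<tau>2 > 0" "ball 0 \<tau>2 \<subseteq> {t. \<sigma> t x \<in> W}"
    using open_contains_ball by metis
  have "norm (D t v - v) < e" if t: "norm t < min \<tau> \<tau>2" for t
  proof -
    have "t \<in> ball 0 \<tau>2" using t by simp
    then have "\<sigma> t x \<in> W" using \<tau>2(2) by blast
    then have 1: "norm (\<kappa> (\<sigma> t x) - \<kappa> x) < c * e / 2" by (simp add: W_def dist_norm norm_minus_commute)
    have 2: "norm (\<kappa> (\<sigma> t x) - D t (\<kappa> x)) \<le> \<eta> * norm (\<kappa> x)" using r(2) t x(1) by simp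
    have "\<eta> * norm (\<kappa> x) \<le> c * e / 2" using \<eta>(2) c by (simp add: x(2) field_simps)
    then have "norm (D t (\<kappa> x) - \<kappa> x) < c * e"
      using 1 2 norm_triangle_ineq4[of "\<kappa> (\<sigma> t x) - \<kappa> x" "\<kappa> (\<sigma> t x) - D t (\<kappa> x)"] by simp
    moreover have "D t (\<kappa> x) - \<kappa> x = c *\<^sub>R (D t v - v)"
      by (simp add: x(2) linear_cmul[OF linear_D] scaleR_diff_right)
    ultimately show ?thesis using c by simp
  qed
  then show "\<exists>s>0. \<forall>t. t \<noteq> 0 \<and> norm (t - 0) < s \<longrightarrow> norm (D t v - v) < e"
    using \<tau> \<tau>2(1) by (intro exI[of _ "min \<tau> \<tau>2"]) auto
qed

text \<open>
  The maps \<open>D t\<close> are a one-parameter group only on \<open>V\<close>. Extending them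
  by the identity on the orthogonal complement gives a one-parameter group on the whole space,
  to which the differentiability theorem applies.
\<close>

lemma D_generator:
  obtains A where "linear A" "\<And>v. v \<in> V \<Longrightarrow> A v \<in> V"
    "\<And>v. v \<in> V \<Longrightarrow> ((\<lambda>t. D t v) has_vector_derivative A v) (at 0)"
    "\<And>v t. v \<in> V \<Longrightarrow> A v = 0 \<Longrightarrow> D t v = v"
proof -
  obtain B where B: "B \<subseteq> V" "pairwise orthogonal B" "\<And>b. b \<in> B \<Longrightarrow> norm b = 1"
      "independent B" "span B = V"
    using orthonormal_basis_subspace[OF subspace_V] by metis
  have finB: "finite B" using B(4) by (simp add: independent_imp_finite)
  define P where "P v = (\<Sum>b\<in>B. (v \<bullet> b) *\<^sub>R b)" for v
  have linP: "linear P"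
    by (rule linearI) (simp_all add: P_def inner_add_left scaleR_add_left sum.distrib scaleR_sum_right)
  have PV: "P v \<in> V" for v
    unfolding P_def using subspace_V B(1) by (auto intro!: subspace_sum subspace_scale)
  have Pid: "P v = v" if "v \<in> V" for v
    unfolding P_def by (rule orthonormal_basis_expand[OF B(2,3) _ finB]) (use that B(5) in auto)
  \<comment> \<open>\<open>P\<close> is the orthogonal projection onto \<open>V\<close>.\<close>
  define E where "E t v = D t (P v) + (v - P v)" for t v
  have linE: "linear (E t)" for t
    unfolding E_def
    by (intro linear_compose_add linear_compose_sub linear_compose[OF linP linear_D, unfolded o_def]
        linP linear_ident)
  have EV: "E t v = D t v" if "v \<in> V" for t v using that by (simp add: E_def Pid)
  have "E (s + t) v = E s (E t v)" for s t v
  proof -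
    have "P (E t v) = D t (P v)"
      by (simp add: E_def linear_add[OF linP] linear_diff[OF linP] Pid PV D_in_V)
    then show ?thesis by (simp add: E_def D_add[OF PV])
  qed
  moreover have "E 0 v = v" for v by (simp add: E_def D_zero PV)
  moreover have "((\<lambda>t. E t v) \<longlongrightarrow> v) (at 0)" for v
  proof -
    have "((\<lambda>t. E t v) \<longlongrightarrow> P v + (v - P v)) (at 0)"
      unfolding E_def by (intro tendsto_intros D_continuous PV)
    then show ?thesis by simp
  qed
  ultimately obtain A where A: "linear A" "\<And>v t. ((\<lambda>t. E t v) has_vector_derivative E t (A v)) (at t)"
    using one_parameter_linear_group_differentiable[of E] linE by metis
  have E0: "E 0 v = v" for v by fact
  have der: "((\<lambda>t. D t v) has_vector_derivative A v) (at 0)" if "v \<in> V" for v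
    using A(2)[of v 0] by (simp add: E0 EV that)
  show thesis
  proof (rule that[OF A(1)])
    show "A v \<in> V" if v: "v \<in> V" for v
    proof -
      have "((\<lambda>t. P (D t v)) has_vector_derivative P (A v)) (at 0)"
        by (rule bounded_linear.has_vector_derivative[OF _ der[OF v]]) (simp add: linP linear_conv_bounded_linear[symmetric])
      then have "((\<lambda>t. D t v) has_vector_derivative P (A v)) (at 0)" by (simp add: Pid D_in_V v)
      then have "P (A v) = A v" using der[OF v] vector_derivative_unique_at by blast
      then show ?thesis using PV by metis
    qed
    show "D t v = v" if "v \<in> V" "A v = 0" for v t
      using one_parameter_linear_group_fixed[of E v A t] linE E0 A(2) that EV by metis
  qed (rule der)
qed

section \<open>Fixed vectors and fixed points\<close>

text \<open>
  Let \<open>p\<close> have coordinate \<open>w / n\<close>, where \<open>w\<close> is a small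
  nonzero multiple of \<open>v\<close>, and put \<open>q = \<sigma> t p\<close>. Then \<open>p
  [^] n\<close> lies in a compact set \<open>K\<close> around \<open>w\<close>, while \<open>q =
  p \<otimes> c\<close> with \<open>c\<close> of order \<open>o(1/n)\<close> because
  \<open>w\<close> is fixed. Moving the factors \<open>c\<close> to the left gives \<open>q [^]
  n = u n \<otimes> p [^] n\<close>, where \<open>u n\<close> is a product of \<open>n\<close>
  conjugates of \<open>c\<close> and hence tends to the identity. So \<open>\<sigma> t\<close>
  moves points of \<open>K\<close> arbitrarily little; by compactness it has a fixed point in
  \<open>K\<close>, which is not the identity.
\<close>

lemma D_fixed_vector_zero:
  assumes nofix: "\<And>x. x \<in> carrier G \<Longrightarrow> \<sigma> t x = x \<Longrightarrow> x = \<one>"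
    and v: "v \<in> V" and Dv: "D t v = v"
  shows "v = 0"
proof (rule ccontr)
  assume v0: "v \<noteq> 0"
  obtain R where R: "R > 0" "\<And>v. v \<in> V \<Longrightarrow> norm v < R \<Longrightarrow> v \<in> \<kappa> ` U"
    using chart_radius by metis
  obtain r0 where r0: "additive_up_to (1/2) r0" using additive_radius[of "1/2"] by auto
  have r0_pos: "r0 > 0" using r0 additive_pos by blast
  obtain r4 where r4: "r4 > 0" "r4 \<le> r0"
    and xinv: "\<And>x y. x \<in> N r4 \<Longrightarrow> y \<in> N r4 \<Longrightarrow> x \<otimes> inv y \<in> N r0"
    and xy: "\<And>x y. x \<in> N r4 \<Longrightarrow> y \<in> N r4 \<Longrightarrow> x \<otimes> y \<in> N r0"
    and conj: "\<And>x y. x \<in> N r4 \<Longrightarrow> y \<in> N r4 \<Longrightarrow> x \<otimes> y \<otimes> inv x \<in> N r0"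
    and invN: "\<And>x. x \<in> N r4 \<Longrightarrow> inv x \<in> N r0"
    using small_words[OF r0_pos] by metis
  obtain r5 where r5: "r5 > 0" "r5 \<le> r4"
    and quot: "\<And>x y. x \<in> N r5 \<Longrightarrow> y \<in> N r5 \<Longrightarrow> inv x \<otimes> y \<in> N r4"
    using small_words[OF r4(1)] by metis
  obtain r6' where r6': "r6' > 0" "\<And>x. x \<in> N r6' \<Longrightarrow> \<sigma> t x \<in> N r5"
    using \<sigma>_fixed_small[OF r5(1)] by metis
  define r6 where "r6 = Min {r6', r5, R}"
  have r6: "r6 > 0" "r6 \<le> r5" "r6 \<le> R" "r6 \<le> r0" "\<And>x. x \<in> N r6 \<Longrightarrow> \<sigma> t x \<in> N r5"
    using r6' r5 r4 R(1) N_mono[of r6 r6'] by (auto simp: r6_def)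
  have sub: "N r6 \<subseteq> N r5" "N r5 \<subseteq> N r4" "N r4 \<subseteq> N r0" using r6 r5 r4 N_mono by auto
  obtain a z where a: "a > 0" and z: "z \<in> N (r6/2)" "\<kappa> z = a *\<^sub>R v"
    using small_multiple[OF v, of "r6/2"] r6(1) by auto
  define w where "w = a *\<^sub>R v"
  have w: "w \<in> V" "w \<noteq> 0" "norm w < r6 / 2" "D t w = w"
    using v v0 a z subspace_V by (auto simp: w_def N_def subspace_scale linear_cmul[OF linear_D] Dv)
  define K where "K = cball w (norm w / 2) \<inter> V"
  have "compact K" unfolding K_def
    using closed_subspace[OF subspace_V] by (intro compact_Int_closed) auto
  have K: "x \<in> V" "norm x < r6" "x \<noteq> 0" "x \<in> \<kappa> ` U" "\<kappa>inv x \<in> N r6" if "x \<in> K" for x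
  proof -
    have 1: "norm (w - x) \<le> norm w / 2" and xV: "x \<in> V" using that by (auto simp: K_def dist_norm)
    have "norm x \<le> norm w + norm (w - x)" using norm_triangle_ineq4[of w "w - x"] by simp
    then show 2: "norm x < r6" using 1 w(3) norm_ge_zero[of w] by linarith
    show "x \<noteq> 0" using 1 w(2) by auto
    show "x \<in> V" by (fact xV)
    then show 3: "x \<in> \<kappa> ` U" using R(2) 2 r6(3) by simp
    show "\<kappa>inv x \<in> N r6" using 2 3 by (simp add: N_def \<kappa>_\<kappa>inv \<kappa>inv_in_U)
  qed
  have contK: "continuous_on K (\<lambda>x. \<kappa> (\<sigma> t (\<kappa>inv x)) - x)"
  proof (intro continuous_on_diff continuous_on_\<kappa> continuous_on_id continuous_\<sigma>2)
    show "continuous_map (top_of_set K) T \<kappa>inv" using continuous_\<kappa>inv_on K(4) by blast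
    show "\<sigma> t (\<kappa>inv x) \<in> U" if "x \<in> K" for x using r6(5) K(5)[OF that] N_subset_U by blast
  qed simp
  have nz: "\<not> (\<exists>x\<in>K. \<kappa> (\<sigma> t (\<kappa>inv x)) - x = 0)"
  proof
    assume "\<exists>x\<in>K. \<kappa> (\<sigma> t (\<kappa>inv x)) - x = 0"
    then obtain x where x: "x \<in> K" "\<kappa> (\<sigma> t (\<kappa>inv x)) = \<kappa> (\<kappa>inv x)"
      using K(4) by (auto simp: \<kappa>_\<kappa>inv)
    have "\<sigma> t (\<kappa>inv x) \<in> U" "\<kappa>inv x \<in> U" using r6(5) K(5)[OF x(1)] N_subset_U by blast+
    then have "\<sigma> t (\<kappa>inv x) = \<kappa>inv x" using inj_\<kappa> x(2) by (simp add: inj_on_def)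
    then have "\<kappa>inv x = \<one>" using nofix \<open>\<kappa>inv x \<in> U\<close> U_subset by blast
    then show False using K(3,4)[OF x(1)] \<kappa>_one \<kappa>_\<kappa>inv by metis
  qed
  obtain m where m: "m > 0" "\<And>x. x \<in> K \<Longrightarrow> m \<le> norm (\<kappa> (\<sigma> t (\<kappa>inv x)) - x)"
  proof -
    obtain d where d: "0 < d" "\<forall>x\<in>K. d \<le> norm (\<kappa> (\<sigma> t (\<kappa>inv x)) - x)"
      by (rule brouwer_compactness_lemma[OF \<open>compact K\<close> contK nz])
    show thesis by (rule that[of d]) (use d in simp_all)
  qed
  \<comment> \<open>The constants below give \<open>norm (\<kappa> (q [^] n) - \<kappa> (p [^] n)) \<le> 18 * (\<epsilon> * norm w)\<close>, which has to be less than \<open>m\<close>.\<close>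
  define \<epsilon> where "\<epsilon> = m / (64 * norm w)"
  have \<epsilon>: "\<epsilon> > 0" "64 * (\<epsilon> * norm w) = m" using m(1) w(2) by (auto simp: \<epsilon>_def)
  obtain r7 where r7: "r7 > 0" "\<And>x. x \<in> N r7 \<Longrightarrow> norm (\<kappa> (\<sigma> t x) - D t (\<kappa> x)) \<le> \<epsilon> * norm (\<kappa> x)"
    using D_approx[OF \<epsilon>(1), of t] by metis
  obtain n where n: "real n > norm w / r7" using reals_Archimedean2 by blast
  have "0 \<le> norm w / r7" using r7(1) by simp
  then have n0: "real n > 0" using n by linarith
  define p where "p = \<kappa>inv ((1 / real n) *\<^sub>R w)"
  have nw: "norm ((1 / real n) *\<^sub>R w) \<le> norm w"
    using n0 mult_right_mono[of 1 "real n" "norm w"] by (simp add: field_simps)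
  have wV: "(1 / real n) *\<^sub>R w \<in> V" using w(1) subspace_V by (simp add: subspace_scale)
  then have wU: "(1 / real n) *\<^sub>R w \<in> \<kappa> ` U"
    by (rule R(2)) (use nw w(3) r6(1,3) in linarith)
  have p: "p \<in> U" "\<kappa> p = (1 / real n) *\<^sub>R w"
    using wU by (auto simp: p_def \<kappa>_\<kappa>inv \<kappa>inv_in_U)
  have np: "norm (\<kappa> p) = norm w / real n" using n0 by (simp add: p(2))
  have "norm w / real n < r7" using n n0 r7(1) by (simp add: field_simps)
  then have p7: "p \<in> N r7" using p(1) by (simp only: N_def np mem_Collect_eq)
  have pc: "p \<in> carrier G" using p(1) U_subset by auto
  have kp: "real k * norm (\<kappa> p) \<le> norm w" if "k \<le> n" for k
    using that n0 mult_right_mono[of "real k" "real n" "norm w"] by (simp add: np field_simps)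
  have pw: "p [^] k \<in> N r6" if k: "k \<le> n" for k
  proof (rule power_in_N[OF r0 p(1)])
    show "(1 + 1/2) * (real k * norm (\<kappa> p)) < r6"
    proof -
      have "(1 + 1/2) * a < r6" if a: "a \<le> norm w" for a :: real
      proof -
        have "(1 + 1/2) * a = 3/2 * a" by simp
        then show ?thesis using a w(3) norm_ge_zero[of w] by linarith
      qed
      then show ?thesis using kp[OF k] .
    qed
  qed (use r6(4) in auto)
  have n1: "1 \<le> n" using n0 by simp
  have p6: "p \<in> N r6" using pw[OF n1] pc by simp
  have p0: "p \<in> N r0" using p6 sub by blast
  have pw0: "p [^] k \<in> N r0" if "k \<le> n" for k using pw[OF that] sub by blast
  have "norm (\<kappa> (p [^] n) - real n *\<^sub>R \<kappa> p) \<le> 1/2 * (real n * norm (\<kappa> p))"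
    by (rule power_approx[OF r0 p0 pw0]) simp
  then have "norm (\<kappa> (p [^] n) - w) \<le> norm w / 2" using n0 kp[of n] by (simp add: p(2))
  moreover have "\<kappa> (p [^] n) \<in> V" using pw[of n] N_subset_U \<kappa>_in_V by blast
  ultimately have pK: "\<kappa> (p [^] n) \<in> K" by (simp add: K_def dist_norm norm_minus_commute)
  define q where "q = \<sigma> t p"
  have qc: "q \<in> carrier G" using pc \<sigma>_closed by (simp add: q_def)
  have qk: "q [^] k = \<sigma> t (p [^] k)" for k :: nat using \<sigma>_pow[OF pc] by (simp add: q_def)
  have qN: "q [^] k \<in> N r5" if "k \<le> n" for k unfolding qk using r6(5) pw[OF that] by blast
  have q5: "q \<in> N r5" using qN[OF n1] qc by simp
  define c where "c = inv p \<otimes> q"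
  have c4: "c \<in> N r4" unfolding c_def using quot p6 q5 sub by blast
  define \<delta> where "\<delta> = norm (\<kappa> q - \<kappa> p)"
  have c\<delta>: "norm (\<kappa> c) \<le> 2 * \<delta>"
    unfolding c_def \<delta>_def by (rule quotient_bound[OF r0]) (use p6 c4 qc sub in \<open>auto simp: c_def\<close>)
  \<comment> \<open>Each step multiplies \<open>u k\<close> by the conjugate of \<open>c\<close> by \<open>p [^] Suc k\<close>, so the lengths only add up.\<close>
  define u where "u k = q [^] k \<otimes> inv (p [^] k)" for k :: nat
  have uN: "u k \<in> N r0" if "k \<le> n" for k
    unfolding u_def using xinv qN[OF that] pw[OF that] sub by blast
  have u_bound: "norm (\<kappa> (u k)) \<le> 12 * (real k * \<delta>)" if "k \<le> n" for k
    using that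
  proof (induction k)
    case 0
    then show ?case by (simp add: u_def \<kappa>_one)
  next
    case (Suc k)
    define g where "g = p [^] Suc k"
    define h where "h = g \<otimes> c \<otimes> inv g"
    have g4: "g \<in> N r4" using pw[OF Suc.prems] sub by (auto simp: g_def)
    have h0: "h \<in> N r0" unfolding h_def using conj g4 c4 by blast
    have "norm (\<kappa> h) \<le> 4 * norm (\<kappa> c)" unfolding h_def
      by (rule conjugate_bound[OF r0]) (use g4 c4 sub invN xy in auto)
    then have h\<delta>: "norm (\<kappa> h) \<le> 8 * \<delta>" using c\<delta> by linarith
    have "u (Suc k) = u k \<otimes> h"
    proof -
      define Q where "Q = q [^] k"
      define P where "P = p [^] k"
      have car: "Q \<in> carrier G" "P \<in> carrier G" "p \<in> carrier G" "q \<in> carrier G"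
        using pc qc by (auto simp: Q_def P_def)
      have "u k \<otimes> h = Q \<otimes> (inv P \<otimes> (P \<otimes> (p \<otimes> (inv p \<otimes> (q \<otimes> inv (P \<otimes> p))))))"
        using car by (simp add: u_def h_def g_def c_def m_assoc flip: Q_def P_def)
      also have "\<dots> = Q \<otimes> q \<otimes> inv (P \<otimes> p)"
        using car by (simp add: m_assoc flip: m_assoc[of "inv P" P] m_assoc[of p "inv p"])
      finally show ?thesis by (simp add: u_def Q_def P_def)
    qed
    moreover have "norm (\<kappa> (u k \<otimes> h) - \<kappa> (u k) - \<kappa> h) \<le> 1/2 * norm (\<kappa> h)"
      by (rule additive_right[OF r0]) (use uN Suc.prems h0 in auto)
    moreover have "norm (\<kappa> (u k \<otimes> h)) \<le> norm (\<kappa> (u k)) + norm (\<kappa> h) + norm (\<kappa> (u k \<otimes> h) - \<kappa> (u k) - \<kappa> h)"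
      using norm_triangle_ineq[of "\<kappa> (u k) + \<kappa> h" "\<kappa> (u k \<otimes> h) - \<kappa> (u k) - \<kappa> h"]
        norm_triangle_ineq[of "\<kappa> (u k)" "\<kappa> h"] by simp
    ultimately show ?case using Suc.IH Suc.prems h\<delta> by (simp add: algebra_simps)
  qed
  have "real n * \<delta> \<le> real n * (\<epsilon> * norm (\<kappa> p))"
  proof (rule mult_left_mono)
    have "D t (\<kappa> p) = \<kappa> p" by (simp add: p(2) linear_cmul[OF linear_D] w(4))
    then show "\<delta> \<le> \<epsilon> * norm (\<kappa> p)" using r7(2)[OF p7] by (simp add: \<delta>_def q_def)
  qed simp
  also have "\<dots> = \<epsilon> * norm w" using n0 by (simp add: np)
  finally have un: "norm (\<kappa> (u n)) \<le> 12 * (\<epsilon> * norm w)" using u_bound[of n] by simp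
  have pn: "p [^] n \<in> N r6" using pw by simp
  have upn: "u n \<otimes> p [^] n = q [^] n" using pc qc by (simp add: u_def m_assoc)
  have "norm (\<kappa> (u n \<otimes> p [^] n) - \<kappa> (u n) - \<kappa> (p [^] n)) \<le> 1/2 * norm (\<kappa> (u n))"
    by (rule additive_left[OF r0]) (use uN pn sub in auto)
  moreover have "norm (\<kappa> (q [^] n) - \<kappa> (p [^] n)) \<le> norm (\<kappa> (u n)) +
      norm (\<kappa> (u n \<otimes> p [^] n) - \<kappa> (u n) - \<kappa> (p [^] n))"
    using norm_triangle_ineq[of "\<kappa> (u n)" "\<kappa> (q [^] n) - \<kappa> (u n) - \<kappa> (p [^] n)"] by (simp add: upn)
  moreover have "m \<le> norm (\<kappa> (q [^] n) - \<kappa> (p [^] n))"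
    using m(2)[OF pK] pn N_subset_U by (simp add: qk \<kappa>inv_\<kappa> subset_eq)
  ultimately show False using un \<epsilon>(2) m(1) by linarith
qed

lemma D_generator_onto:
  assumes nofix: "\<And>x. x \<in> carrier G \<Longrightarrow> \<sigma> t x = x \<Longrightarrow> x = \<one>"
  obtains A where "linear A"
    "\<And>v. v \<in> V \<Longrightarrow> ((\<lambda>t. D t v) has_vector_derivative A v) (at 0)"
    "A ` V = V"
proof -
  obtain A where A: "linear A" "\<And>v. v \<in> V \<Longrightarrow> A v \<in> V"
    "\<And>v. v \<in> V \<Longrightarrow> ((\<lambda>t. D t v) has_vector_derivative A v) (at 0)"
    "\<And>v t. v \<in> V \<Longrightarrow> A v = 0 \<Longrightarrow> D t v = v"
    using D_generator by metis
  have inj: "inj_on A (span V)"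
  proof (rule inj_onI)
    fix x y assume xy: "x \<in> span V" "y \<in> span V" "A x = A y"
    have "x - y \<in> V" using xy span_eq_iff subspace_V subspace_diff by metis
    moreover have "A (x - y) = 0" using xy by (simp add: linear_diff[OF A(1)])
    ultimately have "x - y = 0" using A(4) D_fixed_vector_zero[OF nofix] by blast
    then show "x = y" by simp
  qed
  have "dim (A ` V) = dim V" by (rule dim_image_eq[OF A(1) inj])
  moreover have "A ` V \<subseteq> V" using A(2) by blast
  ultimately have "A ` V = V"
    using subspace_dim_equal[OF linear_subspace_image[OF A(1) subspace_V] subspace_V] by simp
  then show thesis using that A by blast
qed

section \<open>Products of displacements fill a neighbourhood of the identity\<close>

text \<open>
  Multiplying \<open>x\<close> by its displacement gives \<open>\<sigma> t x\<close>, and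
  multiplication is addition up to an error proportional to the displacement. The displacement
  itself is of order \<open>norm (\<kappa> x)\<close>, uniformly in \<open>t\<close>, by
  \<open>\<sigma>_linear_growth\<close>.
\<close>

lemma displacement:
  obtains \<tau> where "\<tau> > 0"
    "\<And>\<eta>. \<eta> > 0 \<Longrightarrow> \<exists>r>0. \<forall>t x. \<bar>t\<bar> < \<tau> \<longrightarrow> x \<in> N r \<longrightarrow>
       inv x \<otimes> \<sigma> t x \<in> U \<and>
       norm (\<kappa> (inv x \<otimes> \<sigma> t x) - (D t (\<kappa> x) - \<kappa> x)) \<le> \<eta> * norm (\<kappa> x)"
proof -
  obtain \<tau>1 where \<tau>1: "\<tau>1 > 0" and unif: "\<And>\<eta>. \<eta> > 0 \<Longrightarrow> \<exists>r>0. \<forall>t x. \<bar>t\<bar> < \<tau>1 \<longrightarrow> x \<in> N r \<longrightarrow>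
       norm (\<kappa> (\<sigma> t x) - D t (\<kappa> x)) \<le> \<eta> * norm (\<kappa> x)"
    using D_uniform by metis
  obtain \<tau>2 r2 C where \<tau>2: "\<tau>2 > 0" and r2: "r2 > 0" and C: "C > 0"
    and gr: "\<And>t x. \<bar>t\<bar> < \<tau>2 \<Longrightarrow> x \<in> N r2 \<Longrightarrow> \<sigma> t x \<in> U \<and> norm (\<kappa> (\<sigma> t x)) \<le> C * norm (\<kappa> x)"
    using \<sigma>_linear_growth by metis
  show thesis
  proof (rule that[of "min \<tau>1 \<tau>2"])
    fix \<eta> :: real assume \<eta>: "\<eta> > 0"
    define \<eta>' where "\<eta>' = min (1/2) (\<eta> / (4 * (C + 1)))"
    have \<eta>': "\<eta>' > 0" "\<eta>' \<le> 1/2" "\<eta>' * (2 * (C + 1)) \<le> \<eta> / 2"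
    proof -
      have "\<eta>' * (2 * (C + 1)) \<le> (\<eta> / (4 * (C + 1))) * (2 * (C + 1))"
        unfolding \<eta>'_def using C by (intro mult_right_mono) auto
      also have "\<dots> = \<eta> / 2" using C by (simp add: field_simps)
      finally show "\<eta>' * (2 * (C + 1)) \<le> \<eta> / 2" .
      show "\<eta>' \<le> 1/2" unfolding \<eta>'_def by (rule min.cobounded1)
    qed (use \<eta> C in \<open>auto simp: \<eta>'_def\<close>)
    obtain r0 where r0: "additive_up_to \<eta>' r0" using additive_radius[OF \<eta>'(1)] by metis
    have r0_pos: "r0 > 0" using r0 additive_pos by blast
    have r0_half: "additive_up_to (1/2) r0" by (rule additive_weaken[OF r0 \<eta>'(2)])
    obtain r4 where r4: "r4 > 0" "r4 \<le> r0"
      and quot: "\<And>x y. x \<in> N r4 \<Longrightarrow> y \<in> N r4 \<Longrightarrow> inv x \<otimes> y \<in> N r0"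
      using small_words[OF r0_pos] by metis
    obtain r1 where r1: "r1 > 0" "\<And>t x. \<bar>t\<bar> < \<tau>1 \<Longrightarrow> x \<in> N r1 \<Longrightarrow>
       norm (\<kappa> (\<sigma> t x) - D t (\<kappa> x)) \<le> \<eta> / 2 * norm (\<kappa> x)"
      using unif[of "\<eta>/2"] \<eta> by (metis half_gt_zero)
    define r where "r = Min {r1, r2, r4, r4 / C}"
    have r: "r > 0" "r \<le> r4 / C" "N r \<subseteq> N r1" "N r \<subseteq> N r2" "N r \<subseteq> N r4"
      using r1(1) r2 r4(1) C N_mono by (auto simp: r_def)
    have "inv x \<otimes> \<sigma> t x \<in> U \<and>
       norm (\<kappa> (inv x \<otimes> \<sigma> t x) - (D t (\<kappa> x) - \<kappa> x)) \<le> \<eta> * norm (\<kappa> x)"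
      if t: "\<bar>t\<bar> < min \<tau>1 \<tau>2" and x: "x \<in> N r" for t x
    proof -
      have xc: "x \<in> carrier G" using x N_carrier by blast
      define g where "g = inv x \<otimes> \<sigma> t x"
      have gx: "norm (\<kappa> (\<sigma> t x)) \<le> C * norm (\<kappa> x)" "\<sigma> t x \<in> U" using gr t x r by auto
      have "norm (\<kappa> x) < r4 / C" using x r(2) by (auto simp: N_def)
      then have "C * norm (\<kappa> x) < r4" using C by (simp add: field_simps)
      then have \<sigma>4: "\<sigma> t x \<in> N r4" using gx by (simp add: N_def)
      have x4: "x \<in> N r4" using x r by blast
      have g0: "g \<in> N r0" unfolding g_def using quot x4 \<sigma>4 by blast
      have x0: "x \<in> N r0" using x4 r4 N_mono by blast
      have "norm (\<kappa> g) \<le> 2 * norm (\<kappa> (\<sigma> t x) - \<kappa> x)"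
        unfolding g_def by (rule quotient_bound[OF r0_half x0]) (use g0 \<sigma>_closed xc in \<open>auto simp: g_def\<close>)
      also have "\<dots> \<le> 2 * (norm (\<kappa> (\<sigma> t x)) + norm (\<kappa> x))"
        using norm_triangle_ineq4[of "\<kappa> (\<sigma> t x)" "\<kappa> x"] by simp
      also have "\<dots> \<le> 2 * (C + 1) * norm (\<kappa> x)" using gx(1) by (simp add: algebra_simps)
      finally have "\<eta>' * norm (\<kappa> g) \<le> \<eta>' * (2 * (C + 1) * norm (\<kappa> x))"
        using \<eta>'(1) by (intro mult_left_mono) auto
      also have "\<dots> \<le> \<eta> / 2 * norm (\<kappa> x)"
        using mult_right_mono[OF \<eta>'(3) norm_ge_zero[of "\<kappa> x"]] by (simp add: mult_ac)
      finally have 1: "\<eta>' * norm (\<kappa> g) \<le> \<eta> / 2 * norm (\<kappa> x)" .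
      have "x \<otimes> g = \<sigma> t x" using xc \<sigma>_closed by (simp add: g_def flip: m_assoc)
      then have 2: "norm (\<kappa> (\<sigma> t x) - \<kappa> x - \<kappa> g) \<le> \<eta>' * norm (\<kappa> g)"
        using additive_right[OF r0 x0 g0] by simp
      have 3: "norm (\<kappa> (\<sigma> t x) - D t (\<kappa> x)) \<le> \<eta> / 2 * norm (\<kappa> x)" using r1(2) t x r by auto
      have "norm (\<kappa> g - (D t (\<kappa> x) - \<kappa> x)) \<le> \<eta> / 2 * norm (\<kappa> x) + \<eta> / 2 * norm (\<kappa> x)"
        using norm_triangle_ineq4[of "\<kappa> (\<sigma> t x) - D t (\<kappa> x)" "\<kappa> (\<sigma> t x) - \<kappa> x - \<kappa> g"] 1 2 3
        by (simp add: algebra_simps)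
      then show ?thesis using g0 N_subset_U by (auto simp: g_def)
    qed
    then show "\<exists>r>0. \<forall>t x. \<bar>t\<bar> < min \<tau>1 \<tau>2 \<longrightarrow> x \<in> N r \<longrightarrow>
       inv x \<otimes> \<sigma> t x \<in> U \<and>
       norm (\<kappa> (inv x \<otimes> \<sigma> t x) - (D t (\<kappa> x) - \<kappa> x)) \<le> \<eta> * norm (\<kappa> x)"
      using r(1) by blast
  qed (use \<tau>1 \<tau>2 in auto)
qed

text \<open>
  Let \<open>b\<close> range over an orthonormal basis of \<open>V\<close>, let the generator
  map \<open>X b\<close> to \<open>b\<close>, and let \<open>x b\<close> have coordinate
  \<open>\<epsilon> X b\<close>. The displacement of \<open>x b\<close> by time \<open>t\<close>
  has coordinate \<open>\<epsilon> (D t (X b) - X b)\<close> up to first order in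
  \<open>\<epsilon>\<close>, which is \<open>\<epsilon> t b\<close> up to first order in
  \<open>t\<close>. With the coefficients of \<open>v\<close> as times, the product
  \<open>\<Phi> v\<close> therefore has coordinate close to \<open>\<epsilon> v\<close>. The
  constants are chosen so that the error on the ball of radius \<open>\<rho>\<close> is at most
  \<open>\<epsilon> \<rho> / 2\<close>; Brouwer's theorem then gives all values in the ball of
  radius \<open>\<epsilon> \<rho> / 2\<close>. First \<open>\<rho>\<close> is fixed, according
  to the differentiability of \<open>D\<close> in \<open>t\<close>, and only then
  \<open>\<epsilon>\<close>, depending on \<open>\<rho>\<close>.
\<close>

lemma displacement_products_cover:
  assumes nofix: "\<And>x. x \<in> carrier G \<Longrightarrow> \<sigma> t0 x = x \<Longrightarrow> x = \<one>"
  obtains xs r where "set xs \<subseteq> carrier G" "r > 0"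
    "\<And>y. y \<in> N r \<Longrightarrow> \<exists>ts. length ts = length xs \<and> (\<forall>t\<in>set ts. \<bar>t\<bar> \<le> 1) \<and>
        y = list_prod (map2 (\<lambda>x t. inv x \<otimes> \<sigma> t x) xs ts)"
proof -
  obtain A where A: "linear A"
    "\<And>v. v \<in> V \<Longrightarrow> ((\<lambda>t. D t v) has_vector_derivative A v) (at 0)"
    "A ` V = V"
    using D_generator_onto[OF nofix] by metis
  obtain B where B: "B \<subseteq> V" "pairwise orthogonal B" "\<And>b. b \<in> B \<Longrightarrow> norm b = 1"
      "independent B" "span B = V"
    using orthonormal_basis_subspace[OF subspace_V] by metis
  have finB: "finite B" using B(4) by (simp add: independent_imp_finite)
  obtain bs where bs: "set bs = B" "distinct bs" using finite_distinct_list[OF finB] by metis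
  define n where "n = real (card B)"
  have n: "n \<ge> 0" by (simp add: n_def)
  have "\<exists>X. X \<in> V \<and> A X = b" if "b \<in> B" for b
  proof -
    have "b \<in> A ` V" unfolding A(3) using that B(1) by (rule subsetD[rotated])
    then show ?thesis by (elim imageE) auto
  qed
  then obtain X where X: "\<And>b. b \<in> B \<Longrightarrow> X b \<in> V \<and> A (X b) = b" by metis
  define K where "K = (\<Sum>b\<in>B. norm (X b))"
  have K: "K \<ge> 0" "\<And>b. b \<in> B \<Longrightarrow> norm (X b) \<le> K"
    using finB by (auto simp: K_def intro: sum_nonneg member_le_sum)
  obtain \<tau> where \<tau>: "\<tau> > 0" and disp: "\<And>\<eta>. \<eta> > 0 \<Longrightarrow> \<exists>r>0. \<forall>t x. \<bar>t\<bar> < \<tau> \<longrightarrow> x \<in> N r \<longrightarrow>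
       inv x \<otimes> \<sigma> t x \<in> U \<and>
       norm (\<kappa> (inv x \<otimes> \<sigma> t x) - (D t (\<kappa> x) - \<kappa> x)) \<le> \<eta> * norm (\<kappa> x)"
    using displacement by metis
  obtain R where R: "R > 0" "\<And>v. v \<in> V \<Longrightarrow> norm v < R \<Longrightarrow> v \<in> \<kappa> ` U"
    using chart_radius by metis
  define \<eta>2 where "\<eta>2 = 1 / (4 * (n + 1))"
  have \<eta>2: "\<eta>2 > 0" "n * \<eta>2 \<le> 1/4" using n by (auto simp: \<eta>2_def field_simps)
  have "\<exists>s>0. \<forall>t. \<bar>t\<bar> < s \<longrightarrow> norm (D t (X b) - X b - t *\<^sub>R b) \<le> \<eta>2 * \<bar>t\<bar>" if b: "b \<in> B" for b
  proof -
    have "((\<lambda>t. D t (X b)) has_derivative (\<lambda>t. t *\<^sub>R b)) (at 0)"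
      using A(2)[of "X b"] X[OF b] by (simp add: has_vector_derivative_def)
    then obtain s where "s > 0" "\<And>t. norm (t - 0) < s \<Longrightarrow>
        norm (D t (X b) - D 0 (X b) - (t - 0) *\<^sub>R b) \<le> \<eta>2 * norm (t - 0)"
      unfolding has_derivative_at_alt using \<eta>2(1) by blast
    then show ?thesis using X[OF b] by (auto simp: D_zero)
  qed
  then obtain s where s: "\<And>b. b \<in> B \<Longrightarrow> s b > 0"
    "\<And>b t. b \<in> B \<Longrightarrow> \<bar>t\<bar> < s b \<Longrightarrow> norm (D t (X b) - X b - t *\<^sub>R b) \<le> \<eta>2 * \<bar>t\<bar>"
    by metis
  define \<mu> where "\<mu> = Min (insert \<tau> (insert 1 (s ` B)))"
  have "\<mu> > 0" unfolding \<mu>_def using finB \<tau> s(1) by (subst Min_gr_iff) auto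
  have "\<mu> \<le> z" if "z \<in> insert \<tau> (insert 1 (s ` B))" for z
    unfolding \<mu>_def using finB that by (intro Min_le) auto
  then have "\<mu> \<le> \<tau>" "\<mu> \<le> 1" "\<And>b. b \<in> B \<Longrightarrow> \<mu> \<le> s b" by simp_all
  define \<rho> where "\<rho> = \<mu> / 2"
  have \<rho>: "\<rho> > 0" "\<rho> < \<tau>" "\<rho> < 1" using \<open>\<mu> > 0\<close> \<open>\<mu> \<le> \<tau>\<close> \<open>\<mu> \<le> 1\<close> by (simp_all add: \<rho>_def)
  have \<rho>s: "\<rho> < s b" if "b \<in> B" for b
    using \<open>\<mu> > 0\<close> \<open>\<And>b. b \<in> B \<Longrightarrow> \<mu> \<le> s b\<close>[OF that] by (simp add: \<rho>_def)
  define \<eta> where "\<eta> = \<rho> / (8 * (K + 1))"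
  have \<eta>: "\<eta> > 0" "\<eta> * K \<le> \<rho> / 8" using \<rho>(1) K(1) by (auto simp: \<eta>_def field_simps)
  define \<eta>3 where "\<eta>3 = 1 / (8 * (n + 1))"
  have \<eta>3: "\<eta>3 > 0" "\<eta>3 \<le> 1" "\<eta>3 * (n + 1) = 1/8" using n by (auto simp: \<eta>3_def field_simps)
  obtain r3 where r3: "additive_up_to \<eta>3 r3" using additive_radius[OF \<eta>3(1)] by metis
  have r3_pos: "r3 > 0" using r3 additive_pos by blast
  obtain r1 where r1: "r1 > 0"
    and disp1: "\<And>t x. \<bar>t\<bar> < \<tau> \<Longrightarrow> x \<in> N r1 \<Longrightarrow> inv x \<otimes> \<sigma> t x \<in> U \<and>
       norm (\<kappa> (inv x \<otimes> \<sigma> t x) - (D t (\<kappa> x) - \<kappa> x)) \<le> \<eta> * norm (\<kappa> x)"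
    using disp[OF \<eta>(1)] by blast
  define \<epsilon> where "\<epsilon> = min (min r1 R / (2 * (K + 1))) (r3 / (4 * (\<rho> * (n + 1))))"
  have \<epsilon>0: "\<epsilon> > 0" using r1 R(1) K(1) r3_pos \<rho>(1) n by (simp add: \<epsilon>_def)
  have \<epsilon>1: "\<epsilon> * K < min r1 R"
  proof -
    have "\<epsilon> * K \<le> \<epsilon> * (K + 1)" using \<epsilon>0 by simp
    also have "\<dots> \<le> min r1 R / (2 * (K + 1)) * (K + 1)"
      unfolding \<epsilon>_def using K(1) by (intro mult_right_mono) auto
    also have "\<dots> = min r1 R / 2" using K(1) by (simp add: field_simps)
    also have "\<dots> < min r1 R" using r1 R(1) by linarith
    finally show ?thesis .
  qed
  have \<epsilon>2: "2 * (\<epsilon> * \<rho> * (n + 1)) < r3"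
  proof -
    have pos: "\<rho> * (n + 1) > 0" using \<rho>(1) n by simp
    have "\<epsilon> * (\<rho> * (n + 1)) \<le> r3 / (4 * (\<rho> * (n + 1))) * (\<rho> * (n + 1))"
      unfolding \<epsilon>_def using pos by (intro mult_right_mono) auto
    also have "\<dots> = r3 / 4"
    proof -
      have "r3 / (4 * q) * q = r3 / 4" if "q > 0" for q :: real using that by simp
      from this[OF pos] show ?thesis .
    qed
    finally show ?thesis using r3_pos mult.assoc[of \<epsilon> \<rho> "n + 1"] by linarith
  qed
  define x where "x b = \<kappa>inv (\<epsilon> *\<^sub>R X b)" for b
  have x: "x b \<in> N r1" "\<kappa> (x b) = \<epsilon> *\<^sub>R X b" if b: "b \<in> B" for b
  proof -
    have "\<epsilon> * norm (X b) \<le> \<epsilon> * K" using K(2)[OF b] \<epsilon>0 by simp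
    then have "\<epsilon> * norm (X b) < min r1 R" using \<epsilon>1 by linarith
    then have nx: "norm (\<epsilon> *\<^sub>R X b) < min r1 R" using \<epsilon>0 by simp
    moreover have "\<epsilon> *\<^sub>R X b \<in> V" using X[OF b] subspace_V by (simp add: subspace_scale)
    ultimately have "\<epsilon> *\<^sub>R X b \<in> \<kappa> ` U" using R(2) by simp
    then show "x b \<in> N r1" "\<kappa> (x b) = \<epsilon> *\<^sub>R X b"
      using nx by (auto simp: x_def N_def \<kappa>_\<kappa>inv \<kappa>inv_in_U)
  qed
  have xc: "x b \<in> carrier G" if "b \<in> B" for b using x(1)[OF that] N_carrier by blast
  define g where "g b t = inv (x b) \<otimes> \<sigma> t (x b)" for b t
  have g: "g b t \<in> U" "norm (\<kappa> (g b t) - (\<epsilon> * t) *\<^sub>R b) \<le> \<epsilon> * (\<eta> * norm (X b) + \<eta>2 * \<rho>)"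
    if b: "b \<in> B" and t: "\<bar>t\<bar> \<le> \<rho>" for b t
  proof -
    have t': "\<bar>t\<bar> < \<tau>" "\<bar>t\<bar> < s b" using t \<rho>(2) \<rho>s[OF b] by auto
    show "g b t \<in> U" unfolding g_def using disp1[OF t'(1) x(1)[OF b]] by simp
    have "norm (\<kappa> (g b t) - (D t (\<epsilon> *\<^sub>R X b) - \<epsilon> *\<^sub>R X b)) \<le> \<eta> * norm (\<epsilon> *\<^sub>R X b)"
      using disp1[OF t'(1) x(1)[OF b]] by (simp add: g_def x(2)[OF b])
    then have 1: "norm (\<kappa> (g b t) - \<epsilon> *\<^sub>R (D t (X b) - X b)) \<le> \<epsilon> * (\<eta> * norm (X b))"
      using \<epsilon>0 by (simp add: linear_cmul[OF linear_D] scaleR_diff_right mult_ac)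
    have "norm (D t (X b) - X b - t *\<^sub>R b) \<le> \<eta>2 * \<rho>"
      using s(2)[OF b t'(2)] mult_left_mono[OF t, of \<eta>2] \<eta>2(1) by linarith
    then have "norm (\<epsilon> *\<^sub>R (D t (X b) - X b - t *\<^sub>R b)) \<le> \<epsilon> * (\<eta>2 * \<rho>)" using \<epsilon>0 by simp
    then have 2: "norm (\<epsilon> *\<^sub>R (D t (X b) - X b) - (\<epsilon> * t) *\<^sub>R b) \<le> \<epsilon> * (\<eta>2 * \<rho>)"
      by (simp add: scaleR_diff_right)
    show "norm (\<kappa> (g b t) - (\<epsilon> * t) *\<^sub>R b) \<le> \<epsilon> * (\<eta> * norm (X b) + \<eta>2 * \<rho>)"
      using norm_triangle_mono[OF 1 2] by (simp add: distrib_left)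
  qed
  define \<Phi> where "\<Phi> v = list_prod (map (\<lambda>b. g b (v \<bullet> b)) bs)" for v
  define S where "S = V \<inter> cball 0 \<rho>"
  have coord: "\<bar>v \<bullet> b\<bar> \<le> \<rho>" if "v \<in> S" "b \<in> B" for v b
    using Cauchy_Schwarz_ineq2[of v b] that B(3) by (simp add: S_def)
  have \<Phi>: "\<Phi> v \<in> N r3" "norm (\<kappa> (\<Phi> v) - \<epsilon> *\<^sub>R v) \<le> \<epsilon> * \<rho> / 2" if v: "v \<in> S" for v
  proof -
    let ?xs = "map (\<lambda>b. g b (v \<bullet> b)) bs"
    define E where "E b = \<epsilon> * (\<eta> * norm (X b) + \<eta>2 * \<rho>)" for b
    have "(\<Sum>b\<in>B. E b) = \<epsilon> * (\<eta> * K + n * \<eta>2 * \<rho>)"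
      by (simp add: E_def K_def n_def sum.distrib flip: sum_distrib_left)
    moreover have "n * \<eta>2 * \<rho> \<le> 1/4 * \<rho>" using \<eta>2(2) \<rho>(1) by (intro mult_right_mono) auto
    then have "\<epsilon> * (\<eta> * K + n * \<eta>2 * \<rho>) \<le> \<epsilon> * (\<rho> / 8 + 1/4 * \<rho>)"
      using \<eta>(2) \<epsilon>0 by (intro mult_left_mono add_mono) auto
    ultimately have sumE: "(\<Sum>b\<in>B. E b) \<le> 3/8 * (\<epsilon> * \<rho>)" by (simp add: algebra_simps)
    have gE: "norm (\<kappa> (g b (v \<bullet> b)) - (\<epsilon> * (v \<bullet> b)) *\<^sub>R b) \<le> E b" if "b \<in> B" for b
      using g(2)[OF that coord[OF v that]] by (simp add: E_def)
    have gn: "norm (\<kappa> (g b (v \<bullet> b))) \<le> \<epsilon> * \<rho> + E b" if b: "b \<in> B" for b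
    proof -
      have "norm ((\<epsilon> * (v \<bullet> b)) *\<^sub>R b) = \<epsilon> * \<bar>v \<bullet> b\<bar>" using B(3)[OF b] \<epsilon>0 by (simp add: abs_mult)
      also have "\<dots> \<le> \<epsilon> * \<rho>" using coord[OF v b] \<epsilon>0 by simp
      finally show ?thesis
        using gE[OF b] norm_triangle_ineq[of "(\<epsilon> * (v \<bullet> b)) *\<^sub>R b" "\<kappa> (g b (v \<bullet> b)) - (\<epsilon> * (v \<bullet> b)) *\<^sub>R b"]
        by simp
    qed
    have sl: "(\<Sum>y\<leftarrow>?xs. f (\<kappa> y)) = (\<Sum>b\<in>B. f (\<kappa> (g b (v \<bullet> b))))" for f :: "'e \<Rightarrow> 'z::comm_monoid_add"
      using sum_list_distinct_conv_sum_set[OF bs(2), of "\<lambda>b. f (\<kappa> (g b (v \<bullet> b)))"]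
      by (simp add: bs(1) o_def)
    have "(\<Sum>y\<leftarrow>?xs. norm (\<kappa> y)) \<le> (\<Sum>b\<in>B. \<epsilon> * \<rho> + E b)"
      unfolding sl by (rule sum_mono) (rule gn)
    also have "\<dots> = n * (\<epsilon> * \<rho>) + (\<Sum>b\<in>B. E b)" by (simp add: sum.distrib n_def)
    also have "\<dots> \<le> n * (\<epsilon> * \<rho>) + 1 * (\<epsilon> * \<rho>)" using sumE \<epsilon>0 \<rho>(1) mult_pos_pos[OF \<epsilon>0 \<rho>(1)] by linarith
    also have "\<dots> = \<epsilon> * \<rho> * (n + 1)" by (simp add: algebra_simps)
    finally have total: "(\<Sum>y\<leftarrow>?xs. norm (\<kappa> y)) \<le> \<epsilon> * \<rho> * (n + 1)" .
    have tot0: "0 \<le> (\<Sum>y\<leftarrow>?xs. norm (\<kappa> y))" unfolding sl by (simp add: sum_nonneg)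
    have "list_prod ?xs \<in> N r3 \<and>
        norm (\<kappa> (list_prod ?xs) - (\<Sum>y\<leftarrow>?xs. \<kappa> y)) \<le> \<eta>3 * (\<Sum>y\<leftarrow>?xs. norm (\<kappa> y))"
    proof (rule list_prod_approx[OF r3])
      show "set ?xs \<subseteq> U" using g(1) coord[OF v] bs(1) by auto
      have "(1 + \<eta>3) * (\<Sum>y\<leftarrow>?xs. norm (\<kappa> y)) \<le> 2 * (\<epsilon> * \<rho> * (n + 1))"
        using total \<eta>3 tot0 by (intro mult_mono) auto
      then show "(1 + \<eta>3) * (\<Sum>y\<leftarrow>?xs. norm (\<kappa> y)) < r3" using \<epsilon>2 by linarith
    qed (use \<eta>3 in simp)
    then have lp: "\<Phi> v \<in> N r3"
        "norm (\<kappa> (\<Phi> v) - (\<Sum>y\<leftarrow>?xs. \<kappa> y)) \<le> \<eta>3 * (\<Sum>y\<leftarrow>?xs. norm (\<kappa> y))"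
      by (simp_all only: \<Phi>_def)
    show "\<Phi> v \<in> N r3" by (fact lp(1))
    have "\<eta>3 * (\<Sum>y\<leftarrow>?xs. norm (\<kappa> y)) \<le> \<eta>3 * (\<epsilon> * \<rho> * (n + 1))"
      using total \<eta>3 by (intro mult_left_mono) auto
    also have "\<dots> = (\<eta>3 * (n + 1)) * (\<epsilon> * \<rho>)" by (simp add: mult_ac)
    also have "\<dots> = 1/8 * (\<epsilon> * \<rho>)" by (simp only: \<eta>3(3))
    finally have 1: "norm (\<kappa> (\<Phi> v) - (\<Sum>y\<leftarrow>?xs. \<kappa> y)) \<le> 1/8 * (\<epsilon> * \<rho>)" using lp(2) by linarith
    have "v \<in> span B" using v B(5) by (simp add: S_def)
    then have "(\<Sum>b\<in>B. (\<epsilon> * (v \<bullet> b)) *\<^sub>R b) = \<epsilon> *\<^sub>R v"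
      using orthonormal_basis_expand[OF B(2,3) _ finB, of v]
      by (simp flip: scaleR_scaleR scaleR_sum_right)
    then have "(\<Sum>y\<leftarrow>?xs. \<kappa> y) - \<epsilon> *\<^sub>R v = (\<Sum>b\<in>B. \<kappa> (g b (v \<bullet> b)) - (\<epsilon> * (v \<bullet> b)) *\<^sub>R b)"
      using sl[of "\<lambda>z. z"] by (simp add: sum_subtractf)
    also have "norm \<dots> \<le> (\<Sum>b\<in>B. E b)" by (rule sum_norm_le) (rule gE)
    finally have 2: "norm ((\<Sum>y\<leftarrow>?xs. \<kappa> y) - \<epsilon> *\<^sub>R v) \<le> 3/8 * (\<epsilon> * \<rho>)" using sumE by linarith
    show "norm (\<kappa> (\<Phi> v) - \<epsilon> *\<^sub>R v) \<le> \<epsilon> * \<rho> / 2"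
      using norm_triangle_mono[OF 1 2] by simp
  qed
  have cont: "continuous_on S (\<lambda>v. \<kappa> (\<Phi> v))"
  proof (rule continuous_on_\<kappa>)
    show "continuous_map (top_of_set S) T \<Phi>"
      unfolding \<Phi>_def
    proof (rule continuous_list_prod)
      fix b assume "b \<in> set bs"
      then have "x b \<in> carrier G" using xc bs(1) by blast
      moreover have "continuous_map (top_of_set S) euclideanreal (\<lambda>v. v \<bullet> b)"
        by (simp add: continuous_on_inner)
      ultimately show "continuous_map (top_of_set S) T (\<lambda>v. g b (v \<bullet> b))"
        unfolding g_def
        by (intro continuous_mult2 continuous_\<sigma>2) (auto simp: topspace_T)
    qed
    show "\<Phi> v \<in> U" if "v \<in> S" for v using \<Phi>(1)[OF that] N_subset_U by blast
  qed
  have cover: "\<exists>v\<in>S. \<Phi> v = y" if y: "y \<in> N (\<epsilon> * \<rho> / 2)" for y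
  proof -
    \<comment> \<open>A fixed point of \<open>h\<close> is a solution of \<open>\<Phi> v = y\<close>.\<close>
    define h where "h v = v - (1/\<epsilon>) *\<^sub>R (\<kappa> (\<Phi> v) - \<kappa> y)" for v
    have yV: "\<kappa> y \<in> V" "y \<in> U" "norm (\<kappa> y) < \<epsilon> * \<rho> / 2" using y \<kappa>_in_V by (auto simp: N_def)
    obtain v where v: "v \<in> S" "h v = v"
    proof (rule brouwer[of S h])
      show "compact S" unfolding S_def
        using compact_Int_closed[OF compact_cball closed_subspace[OF subspace_V]] by (simp add: Int_commute)
      show "convex S" unfolding S_def
        using subspace_imp_convex[OF subspace_V] by (intro convex_Int) auto
      show "S \<noteq> {}" using subspace_0[OF subspace_V] \<rho>(1) by (auto simp: S_def intro!: exI[of _ 0])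
      show "continuous_on S h" unfolding h_def by (intro continuous_intros cont)
      show "h \<in> S \<rightarrow> S"
      proof
        fix v assume v: "v \<in> S"
        have "\<kappa> (\<Phi> v) \<in> V" using \<Phi>(1)[OF v] N_subset_U \<kappa>_in_V by blast
        then have hV: "h v \<in> V" unfolding h_def using v yV(1) subspace_V
          by (intro subspace_diff subspace_scale) (auto simp: S_def)
        have "norm (\<epsilon> *\<^sub>R h v) \<le> \<epsilon> * \<rho>"
        proof -
          have "\<epsilon> *\<^sub>R h v = \<kappa> y - (\<kappa> (\<Phi> v) - \<epsilon> *\<^sub>R v)"
            using \<epsilon>0 by (simp add: h_def scaleR_diff_right)
          then show ?thesis
            using norm_triangle_ineq4[of "\<kappa> y" "\<kappa> (\<Phi> v) - \<epsilon> *\<^sub>R v"] \<Phi>(2)[OF v] yV(3) by simp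
        qed
        then have "norm (h v) \<le> \<rho>" using \<epsilon>0 by simp
        then show "h v \<in> S" using hV by (simp add: S_def)
      qed
    qed
    have "\<kappa> (\<Phi> v) = \<kappa> y" using v(2) \<epsilon>0 by (simp add: h_def)
    then have "\<Phi> v = y" using \<Phi>(1)[OF v(1)] N_subset_U yV(2) inj_\<kappa> by (metis inj_onD subsetD)
    then show ?thesis using v(1) by blast
  qed
  show thesis
  proof (rule that[of "map x bs" "\<epsilon> * \<rho> / 2"])
    show "set (map x bs) \<subseteq> carrier G" using xc bs(1) by auto
    show "\<epsilon> * \<rho> / 2 > 0" using \<epsilon>0 \<rho>(1) by simp
    fix y assume "y \<in> N (\<epsilon> * \<rho> / 2)"
    then obtain v where v: "v \<in> S" "\<Phi> v = y" using cover by blast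
    have "y = list_prod (map2 (\<lambda>x t. inv x \<otimes> \<sigma> t x) (map x bs) (map ((\<bullet>) v) bs))"
      unfolding map2_map_map v(2)[symmetric] \<Phi>_def g_def ..
    moreover have "\<forall>t\<in>set (map ((\<bullet>) v) bs). \<bar>t\<bar> \<le> 1" using coord[OF v(1)] \<rho>(3) bs(1) by fastforce
    ultimately show "\<exists>ts. length ts = length (map x bs) \<and> (\<forall>t\<in>set ts. \<bar>t\<bar> \<le> 1) \<and>
        y = list_prod (map2 (\<lambda>x t. inv x \<otimes> \<sigma> t x) (map x bs) ts)"
      by (intro exI[of _ "map ((\<bullet>) v) bs"]) simp
  qed
qed

end

section \<open>Homogeneous distances\<close>

locale homogeneous_flow = automorphism_flow G T V U \<kappa> \<sigma>
  for G :: "('p, 'r) monoid_scheme" (structure) and T :: "'p topology"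
    and V :: "'e::euclidean_space set" and U :: "'p set" and \<kappa> :: "'p \<Rightarrow> 'e"
    and \<sigma> :: "real \<Rightarrow> 'p \<Rightarrow> 'p" +
  fixes d :: "'p \<Rightarrow> 'p \<Rightarrow> real"
  assumes metric: "Metric_space (carrier G) d"
    and left_invariant: "\<And>g x y. g \<in> carrier G \<Longrightarrow> x \<in> carrier G \<Longrightarrow> y \<in> carrier G \<Longrightarrow>
          d (g \<otimes> x) (g \<otimes> y) = d x y"
    and homogeneous: "\<And>t x y. x \<in> carrier G \<Longrightarrow> y \<in> carrier G \<Longrightarrow>
          d (\<sigma> t x) (\<sigma> t y) = exp t * d x y"
begin

interpretation met: Metric_space "carrier G" d by (rule metric)

definition len :: "'p \<Rightarrow> real" where "len x = d \<one> x"

lemma len_nonneg: "len x \<ge> 0" by (simp add: len_def)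

lemma len_one: "len \<one> = 0" by (simp add: len_def)

lemma len_eq_0: "x \<in> carrier G \<Longrightarrow> len x = 0 \<Longrightarrow> x = \<one>"
  unfolding len_def using met.zero[of \<one> x] by simp

lemma d_len: "x \<in> carrier G \<Longrightarrow> y \<in> carrier G \<Longrightarrow> d x y = len (inv x \<otimes> y)"
  using left_invariant[of "inv x" x y] by (simp add: len_def)

lemma len_mult:
  assumes "x \<in> carrier G" "y \<in> carrier G"
  shows "len (x \<otimes> y) \<le> len x + len y"
proof -
  have "d \<one> (x \<otimes> y) \<le> d \<one> x + d x (x \<otimes> y)" using assms by (intro met.triangle) auto
  moreover have "d x (x \<otimes> y) = d \<one> y" using left_invariant[of x \<one> y] assms by simp
  ultimately show ?thesis by (simp add: len_def)
qed

lemma len_inv: "x \<in> carrier G \<Longrightarrow> len (inv x) = len x"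
  using left_invariant[of x \<one> "inv x"] met.commute by (simp add: len_def)

lemma len_\<sigma>: "x \<in> carrier G \<Longrightarrow> len (\<sigma> t x) = exp t * len x"
  using homogeneous[of \<one> x t] by (simp add: len_def \<sigma>_one)

text \<open>
  A fixed point of \<open>\<sigma> t\<close> satisfies \<open>len x = exp t * len x\<close>.
\<close>

lemma \<sigma>_fixed_point: "x \<in> carrier G \<Longrightarrow> t \<noteq> 0 \<Longrightarrow> \<sigma> t x = x \<Longrightarrow> x = \<one>"
  using len_\<sigma>[of x t] len_eq_0 by force

lemma len_displacement_product:
  assumes "length ts = length xs" "set xs \<subseteq> carrier G" "\<forall>t\<in>set ts. \<bar>t\<bar> \<le> 1"
  shows "len (list_prod (map2 (\<lambda>x t. inv x \<otimes> \<sigma> t x) xs ts)) \<le> (\<Sum>x\<leftarrow>xs. (1 + exp 1) * len x)"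
  using assms
proof (induction ts xs rule: list_induct2)
  case (Cons t ts x xs)
  let ?f = "\<lambda>x t. inv x \<otimes> \<sigma> t x"
  have x: "x \<in> carrier G" using Cons by simp
  have "set (map2 ?f xs ts) \<subseteq> carrier G"
    using Cons.prems(1) \<sigma>_closed by (force dest: set_zip_leftD)
  then have P: "list_prod (map2 ?f xs ts) \<in> carrier G" by (rule list_prod_closed)
  have "len (?f x t) \<le> len x + exp t * len x"
    using len_mult[of "inv x" "\<sigma> t x"] x \<sigma>_closed by (simp add: len_inv len_\<sigma>)
  also have "\<dots> \<le> len x + exp 1 * len x"
    using Cons.prems(2) len_nonneg by (intro add_left_mono mult_right_mono) auto
  finally have "len (?f x t) \<le> (1 + exp 1) * len x" by (simp add: algebra_simps)
  moreover have "len (?f x t \<otimes> list_prod (map2 ?f xs ts)) \<le> len (?f x t) + len (list_prod (map2 ?f xs ts))"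
    using x P \<sigma>_closed by (intro len_mult) auto
  ultimately show ?case using Cons by simp
qed (simp add: len_one)

lemma len_bounded:
  obtains r C where "r > 0" "\<And>y. y \<in> N r \<Longrightarrow> len y \<le> C"
proof -
  have nofix: "x = \<one>" if "x \<in> carrier G" "\<sigma> 1 x = x" for x
    using \<sigma>_fixed_point[of x 1] that by simp
  show thesis
  proof (rule displacement_products_cover[OF nofix])
    fix xs :: "'p list" and r :: real
    assume xs: "set xs \<subseteq> carrier G" and r: "r > 0"
      and cover: "\<And>y. y \<in> N r \<Longrightarrow> \<exists>ts. length ts = length xs \<and> (\<forall>t\<in>set ts. \<bar>t\<bar> \<le> 1) \<and>
        y = list_prod (map2 (\<lambda>x t. inv x \<otimes> \<sigma> t x) xs ts)"
    have "len y \<le> (\<Sum>x\<leftarrow>xs. (1 + exp 1) * len x)" if y: "y \<in> N r" for y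
    proof -
      obtain ts where "length ts = length xs" "\<forall>t\<in>set ts. \<bar>t\<bar> \<le> 1"
        and eq: "y = list_prod (map2 (\<lambda>x t. inv x \<otimes> \<sigma> t x) xs ts)"
        using cover[OF y] by (elim exE conjE) rule
      then show ?thesis unfolding eq using xs by (intro len_displacement_product)
    qed
    then show thesis using that r by blast
  qed
qed

text \<open>
  The flow scales the neighbourhood on which \<open>len\<close> is bounded to one on which it is
  small.
\<close>

lemma len_small:
  assumes "e > 0"
  obtains r where "r > 0" "\<And>y. y \<in> N r \<Longrightarrow> len y < e"
proof -
  obtain r C where r: "r > 0" "\<And>y. y \<in> N r \<Longrightarrow> len y \<le> C" using len_bounded by metis
  have C: "C \<ge> 0" using r(2)[OF one_in_N[OF r(1)]] len_one by simp
  define t where "t = ln (e / (C + 1))"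
  have t: "exp t = e / (C + 1)" using assms C by (simp add: t_def)
  obtain s where s: "s > 0" "\<And>x. x \<in> N s \<Longrightarrow> \<sigma> (- t) x \<in> N r"
    using \<sigma>_fixed_small[OF r(1)] by metis
  have "len y < e" if y: "y \<in> N s" for y
  proof -
    have yc: "y \<in> carrier G" using y N_carrier by blast
    have "y = \<sigma> t (\<sigma> (- t) y)" using \<sigma>_add[OF yc, of t "- t"] \<sigma>_zero[OF yc] by simp
    then have "len y = exp t * len (\<sigma> (- t) y)" using len_\<sigma> \<sigma>_closed[OF yc] by metis
    also have "\<dots> \<le> exp t * C" using r(2) s(2)[OF y] by simp
    also have "\<dots> < e" using assms C by (simp add: t field_simps)
    finally show ?thesis .
  qed
  then show thesis using that s(1) by blast
qed

lemma openin_translate: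
  assumes "x \<in> carrier G" "openin T W"
  shows "openin T {y \<in> carrier G. x \<otimes> y \<in> W}"
proof -
  have "continuous_map T T (\<lambda>y. x \<otimes> y)"
    using assms(1) by (intro continuous_mult2) (auto simp: topspace_T)
  then have "openin T {y \<in> topspace T. x \<otimes> y \<in> W}"
    using assms(2) by (rule openin_continuous_map_preimage)
  then show ?thesis by (simp add: topspace_T)
qed

lemma coset_nbhd:
  assumes x: "x \<in> carrier G" and r: "r > 0"
  shows "openin T {y \<in> carrier G. inv x \<otimes> y \<in> N r}" "x \<in> {y \<in> carrier G. inv x \<otimes> y \<in> N r}"
  using openin_translate[OF _ openin_N, of "inv x" r] x one_in_N[OF r] by auto

text \<open>
  By left invariance, \<open>len\<close> varies near any point by at most its values near the
  identity.
\<close>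

lemma continuous_len: "continuous_map T euclideanreal len"
  unfolding continuous_map_def
proof (intro conjI allI impI)
  fix W :: "real set" assume "openin euclideanreal W"
  then have W: "open W" by simp
  show "openin T {x \<in> topspace T. len x \<in> W}"
  proof (subst openin_subopen, intro ballI)
    fix x assume "x \<in> {x \<in> topspace T. len x \<in> W}"
    then have x: "x \<in> carrier G" "len x \<in> W" by (auto simp: topspace_T)
    then obtain e where e: "e > 0" "ball (len x) e \<subseteq> W" using W open_contains_ball by metis
    obtain r where r: "r > 0" "\<And>y. y \<in> N r \<Longrightarrow> len y < e" using len_small[OF e(1)] by metis
    have "len y \<in> W" if y: "y \<in> carrier G" "inv x \<otimes> y \<in> N r" for y
    proof -
      have 1: "len (inv x \<otimes> y) < e" using r(2) y by blast
      have "len y \<le> len x + len (inv x \<otimes> y)"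
        using len_mult[of x "inv x \<otimes> y"] x y by (simp flip: m_assoc)
      moreover have "len x \<le> len y + len (inv x \<otimes> y)"
      proof -
        have "len (inv y \<otimes> x) = len (inv x \<otimes> y)"
          using len_inv[of "inv x \<otimes> y"] x y by (simp add: inv_mult_group)
        then show ?thesis using len_mult[of y "inv y \<otimes> x"] x y by (simp flip: m_assoc)
      qed
      ultimately have "len y \<in> ball (len x) e" using 1 by (simp add: dist_real_def abs_less_iff)
      then show ?thesis using e(2) by blast
    qed
    then show "\<exists>S. openin T S \<and> x \<in> S \<and> S \<subseteq> {x \<in> topspace T. len x \<in> W}"
      using coset_nbhd[OF x(1) r(1)]
      by (intro exI[of _ "{y \<in> carrier G. inv x \<otimes> y \<in> N r}"]) (auto simp: topspace_T)
  qed
qed auto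

lemma len_bounded_below:
  assumes C: "compactin T C" "\<one> \<notin> C"
  obtains m where "m > 0" "\<And>x. x \<in> C \<Longrightarrow> m \<le> len x"
proof (cases "C = {}")
  case True
  then show thesis using that[of 1] by simp
next
  case False
  have "compact (len ` C)" using image_compactin[OF C(1) continuous_len] by simp
  then obtain x where x: "x \<in> C" "\<And>y. y \<in> C \<Longrightarrow> len x \<le> len y"
    using compact_attains_inf[of "len ` C"] False by auto
  have "x \<in> carrier G" using compactin_subset_topspace[OF C(1)] x(1) topspace_T by blast
  then have "len x \<noteq> 0" using len_eq_0 x(1) C(2) by blast
  then show thesis using that[of "len x"] x(2) len_nonneg[of x] by auto
qed

lemma compactin_shell:
  assumes R: "\<And>v. v \<in> V \<Longrightarrow> norm v < R \<Longrightarrow> v \<in> \<kappa> ` U" and s: "s < R"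
  shows "compactin T {x \<in> U. r \<le> norm (\<kappa> x) \<and> norm (\<kappa> x) \<le> s}"
proof -
  define S where "S = V \<inter> (cball 0 s - ball 0 r)"
  have "compact S" unfolding S_def
    using compact_diff[OF compact_cball open_ball] closed_subspace[OF subspace_V]
    by (intro closed_Int_compact) auto
  have SU: "S \<subseteq> \<kappa> ` U" using R s by (auto simp: S_def)
  have "compactin (top_of_set S) S" using \<open>compact S\<close> by (simp add: compactin_subtopology)
  then have "compactin T (\<kappa>inv ` S)" by (rule image_compactin[OF _ continuous_\<kappa>inv_on[OF SU]])
  moreover have "\<kappa>inv ` S = {x \<in> U. r \<le> norm (\<kappa> x) \<and> norm (\<kappa> x) \<le> s}" (is "_ = ?K")
  proof
    show "\<kappa>inv ` S \<subseteq> ?K"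
    proof (rule image_subsetI)
      fix v assume v: "v \<in> S"
      then have "v \<in> \<kappa> ` U" using SU by blast
      then show "\<kappa>inv v \<in> ?K" using v by (simp add: \<kappa>_\<kappa>inv \<kappa>inv_in_U S_def)
    qed
    show "?K \<subseteq> \<kappa>inv ` S"
    proof
      fix x assume x: "x \<in> ?K"
      then have "\<kappa> x \<in> S" using \<kappa>_in_V by (auto simp: S_def)
      moreover have "x = \<kappa>inv (\<kappa> x)" using x \<kappa>inv_\<kappa> by auto
      ultimately show "x \<in> \<kappa>inv ` S" by blast
    qed
  qed
  ultimately show ?thesis by simp
qed

lemma connectedin_orbit:
  assumes "x \<in> carrier G" "connected I"
  shows "connectedin T ((\<lambda>t. \<sigma> t x) ` I)"
proof (rule connectedin_continuous_map_image)
  show "continuous_map euclideanreal T (\<lambda>t. \<sigma> t x)"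
    using assms(1) by (intro continuous_\<sigma>2) (auto simp: topspace_T)
  show "connectedin euclideanreal I" using assms(2) by simp
qed

text \<open>
  Along a backward orbit \<open>len\<close> decreases, so an orbit that starts below the minimum
  of \<open>len\<close> on the coordinate sphere of radius \<open>r\<close> never meets this
  sphere, and by connectedness it stays on one side.
\<close>

lemma orbit_trapped:
  assumes R: "\<And>v. v \<in> V \<Longrightarrow> norm v < R \<Longrightarrow> v \<in> \<kappa> ` U" and r: "0 < r" "r < R"
  obtains m where "m > 0"
    "\<And>x s t. x \<in> carrier G \<Longrightarrow> len x < m \<Longrightarrow> s \<le> 0 \<Longrightarrow> \<sigma> s x \<in> N r \<Longrightarrow> t \<le> 0 \<Longrightarrow> \<sigma> t x \<in> N r"
proof -
  define C where "C = {x \<in> U. r \<le> norm (\<kappa> x) \<and> norm (\<kappa> x) \<le> r}"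
  define K where "K = {x \<in> U. 0 \<le> norm (\<kappa> x) \<and> norm (\<kappa> x) \<le> r}"
  have "compactin T C" unfolding C_def by (rule compactin_shell[OF R r(2)])
  moreover have "\<one> \<notin> C" using r(1) by (simp add: C_def \<kappa>_one)
  ultimately obtain m where m: "m > 0" "\<And>x. x \<in> C \<Longrightarrow> m \<le> len x" using len_bounded_below by metis
  have "compactin T K" unfolding K_def by (rule compactin_shell[OF R r(2)])
  then have "closedin T K" by (rule compactin_imp_closedin[OF Hausdorff_T])
  then have oK: "openin T (carrier G - K)" unfolding topspace_T[symmetric] by (rule openin_diff[OF openin_topspace])
  show thesis
  proof (rule that[OF m(1)])
    fix x :: 'p and s t :: real assume x: "x \<in> carrier G" "len x < m" and s: "s \<le> 0" "\<sigma> s x \<in> N r" and t: "t \<le> 0"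
    define P where "P = (\<lambda>t. \<sigma> t x) ` {..0}"
    have "connectedin T P" unfolding P_def by (rule connectedin_orbit[OF x(1)]) simp
    moreover have "P \<subseteq> N r \<union> (carrier G - K)"
    proof
      fix y assume "y \<in> P"
      then obtain u where u: "u \<le> 0" "y = \<sigma> u x" by (auto simp: P_def)
      have yc: "y \<in> carrier G" using u x \<sigma>_closed by simp
      have "len y \<le> 1 * len x" unfolding u(2) len_\<sigma>[OF x(1)]
        using u(1) len_nonneg by (intro mult_right_mono) auto
      then have "y \<notin> C" using m(2)[of y] x(2) by linarith
      then show "y \<in> N r \<union> (carrier G - K)" using yc by (auto simp: C_def K_def N_def)
    qed
    moreover have "N r \<inter> (carrier G - K) \<inter> P = {}" by (auto simp: N_def K_def)
    ultimately have "N r \<inter> P = {} \<or> (carrier G - K) \<inter> P = {}"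
      using connectedinD[OF _ openin_N oK] by blast
    moreover have "\<sigma> s x \<in> N r \<inter> P" using s by (simp add: P_def)
    ultimately have "(carrier G - K) \<inter> P = {}" by blast
    moreover have "\<sigma> t x \<in> P" using t by (simp add: P_def)
    ultimately show "\<sigma> t x \<in> N r" using \<open>P \<subseteq> N r \<union> (carrier G - K)\<close> by blast
  qed
qed

definition contracted :: "'p set" where
  "contracted = {x \<in> carrier G. \<forall>r>0. \<exists>t0\<le>0. \<forall>t\<le>t0. \<sigma> t x \<in> N r}"

lemma contracted_mult:
  assumes "x \<in> contracted" "y \<in> contracted"
  shows "x \<otimes> y \<in> contracted"
proof -
  have c: "x \<in> carrier G" "y \<in> carrier G" using assms by (auto simp: contracted_def)
  have "\<exists>t0\<le>0. \<forall>t\<le>t0. \<sigma> t (x \<otimes> y) \<in> N r" if r: "r > 0" for r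
  proof -
    obtain s where s: "s > 0" "\<And>x y. x \<in> N s \<Longrightarrow> y \<in> N s \<Longrightarrow> x \<otimes> y \<in> N r"
      using small_words[OF r] by metis
    obtain t1 where t1: "t1 \<le> 0" "\<And>t. t \<le> t1 \<Longrightarrow> \<sigma> t x \<in> N s"
      using assms(1) s(1) unfolding contracted_def by blast
    obtain t2 where t2: "t2 \<le> 0" "\<And>t. t \<le> t2 \<Longrightarrow> \<sigma> t y \<in> N s"
      using assms(2) s(1) unfolding contracted_def by blast
    show ?thesis
      using t1 t2 s(2) c by (intro exI[of _ "min t1 t2"]) (auto simp: \<sigma>_mult)
  qed
  then show ?thesis using c by (auto simp: contracted_def)
qed

lemma contracted_inv:
  assumes "x \<in> contracted"
  shows "inv x \<in> contracted"
proof -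
  have c: "x \<in> carrier G" using assms by (auto simp: contracted_def)
  have "\<exists>t0\<le>0. \<forall>t\<le>t0. \<sigma> t (inv x) \<in> N r" if r: "r > 0" for r
  proof -
    obtain s where s: "s > 0" "\<And>x. x \<in> N s \<Longrightarrow> inv x \<in> N r"
      using small_words[OF r] by metis
    obtain t1 where t1: "t1 \<le> 0" "\<And>t. t \<le> t1 \<Longrightarrow> \<sigma> t x \<in> N s"
      using assms s(1) unfolding contracted_def by blast
    show ?thesis using t1 s(2) c by (intro exI[of _ t1]) (auto simp: \<sigma>_inv)
  qed
  then show ?thesis using c by (auto simp: contracted_def)
qed

lemma len_scaled_small:
  assumes "e > 0"
  obtains t0 where "t0 \<le> 0" "\<And>t. t \<le> t0 \<Longrightarrow> exp t * len x < e"
proof -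
  define t0 where "t0 = min 0 (ln (e / (len x + 1)))"
  have pos: "len x + 1 > 0" using len_nonneg[of x] by simp
  have "exp t * len x < e" if "t \<le> t0" for t
  proof -
    have "exp t \<le> exp (ln (e / (len x + 1)))" using that by (simp add: t0_def)
    also have "\<dots> = e / (len x + 1)" using assms pos by simp
    finally have "exp t * len x \<le> e / (len x + 1) * len x" using len_nonneg by (intro mult_right_mono) auto
    also have "\<dots> < e" using assms pos by (simp add: field_simps)
    finally show ?thesis .
  qed
  then show thesis using that[of t0] by (simp add: t0_def)
qed

text \<open>
  A point near the identity has its backward orbit trapped in \<open>N r\<close>, whose closure
  is compact. Outside a smaller neighbourhood \<open>N r'\<close>, the lengths in this compact
  set are bounded below, whereas they tend to zero along the orbit.
\<close>

lemma contracted_nbhd: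
  obtains r where "r > 0" "N r \<subseteq> contracted"
proof -
  obtain R where R: "R > 0" "\<And>v. v \<in> V \<Longrightarrow> norm v < R \<Longrightarrow> v \<in> \<kappa> ` U"
    using chart_radius by metis
  define r where "r = R / 2"
  have r: "0 < r" "r < R" using R(1) by (auto simp: r_def)
  obtain m where m: "m > 0" "\<And>x s t. x \<in> carrier G \<Longrightarrow> len x < m \<Longrightarrow> s \<le> 0 \<Longrightarrow> \<sigma> s x \<in> N r \<Longrightarrow> t \<le> 0 \<Longrightarrow> \<sigma> t x \<in> N r"
    using orbit_trapped[OF R(2) r] by metis
  obtain r2 where r2: "r2 > 0" "\<And>y. y \<in> N r2 \<Longrightarrow> len y < m" using len_small[OF m(1)] by metis
  have "x \<in> contracted" if x: "x \<in> N (min r r2)" for x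
  proof -
    have xr: "x \<in> N r" "x \<in> N r2" and xc: "x \<in> carrier G" using x N_carrier by (auto simp: N_def)
    have trapped: "\<sigma> t x \<in> N r" if "t \<le> 0" for t
      using m(2)[of x 0 t] xc r2(2)[OF xr(2)] xr(1) that by (simp add: \<sigma>_zero)
    have "\<exists>t0\<le>0. \<forall>t\<le>t0. \<sigma> t x \<in> N r'" if r': "r' > 0" for r'
    proof -
      define C where "C = {x \<in> U. r' \<le> norm (\<kappa> x) \<and> norm (\<kappa> x) \<le> r}"
      have "compactin T C" unfolding C_def by (rule compactin_shell[OF R(2) r(2)])
      moreover have "\<one> \<notin> C" using r' by (simp add: C_def \<kappa>_one)
      ultimately obtain m' where m': "m' > 0" "\<And>x. x \<in> C \<Longrightarrow> m' \<le> len x" using len_bounded_below by metis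
      obtain t0 where t0: "t0 \<le> 0" "\<And>t. t \<le> t0 \<Longrightarrow> exp t * len x < m'" using len_scaled_small[OF m'(1)] by metis
      have "\<sigma> t x \<in> N r'" if t: "t \<le> t0" for t
      proof -
        have "\<sigma> t x \<notin> C" using m'(2)[of "\<sigma> t x"] t0(2)[OF t] by (auto simp: len_\<sigma>[OF xc])
        moreover have "\<sigma> t x \<in> N r" using trapped t t0(1) by simp
        ultimately show ?thesis by (auto simp: C_def N_def)
      qed
      then show ?thesis using t0(1) by blast
    qed
    then show ?thesis using xc by (simp add: contracted_def)
  qed
  then show thesis using that[of "min r r2"] r(1) r2(1) by auto
qed

lemma clopen_contracted: "openin T contracted" "closedin T contracted"
proof -
  obtain r where r: "r > 0" "N r \<subseteq> contracted" using contracted_nbhd by metis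
  have sub: "contracted \<subseteq> carrier G" by (auto simp: contracted_def)
  show "openin T contracted"
  proof (subst openin_subopen, intro ballI)
    fix x assume x: "x \<in> contracted"
    then have xc: "x \<in> carrier G" using sub by blast
    have "y \<in> contracted" if y: "y \<in> carrier G" "inv x \<otimes> y \<in> N r" for y
    proof -
      have "x \<otimes> (inv x \<otimes> y) \<in> contracted" using contracted_mult x y r(2) by blast
      then show ?thesis using xc y by (simp flip: m_assoc)
    qed
    then show "\<exists>S. openin T S \<and> x \<in> S \<and> S \<subseteq> contracted"
      using coset_nbhd[OF xc r(1)] by blast
  qed
  have "openin T (carrier G - contracted)"
  proof (subst openin_subopen, intro ballI)
    fix x assume x: "x \<in> carrier G - contracted"
    then have xc: "x \<in> carrier G" by blast
    have "y \<notin> contracted" if y: "y \<in> carrier G" "inv x \<otimes> y \<in> N r" for y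
    proof
      assume "y \<in> contracted"
      then have "y \<otimes> inv (inv x \<otimes> y) \<in> contracted" using contracted_mult contracted_inv y r(2) by blast
      moreover have "y \<otimes> inv (inv x \<otimes> y) = x" using xc y by (simp add: inv_mult_group flip: m_assoc)
      ultimately show False using x by simp
    qed
    then have "{y \<in> carrier G. inv x \<otimes> y \<in> N r} \<subseteq> carrier G - contracted" by blast
    then show "\<exists>S. openin T S \<and> x \<in> S \<and> S \<subseteq> carrier G - contracted"
      using coset_nbhd[OF xc r(1)] by blast
  qed
  then show "closedin T contracted" using sub by (simp add: closedin_def topspace_T)
qed

text \<open>
  The backward orbit of \<open>x\<close> eventually enters \<open>N r\<close>; if
  \<open>x\<close> is short, it cannot have crossed the sphere, so \<open>x\<close> was already
  inside. Without the hypothesis that \<open>x\<close> is contracted, short elements far away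
  from the identity are not excluded at this stage.
\<close>

lemma contracted_len_small:
  assumes r: "r > 0"
  obtains m where "m > 0" "\<And>x. x \<in> contracted \<Longrightarrow> len x < m \<Longrightarrow> x \<in> N r"
proof -
  obtain R where R: "R > 0" "\<And>v. v \<in> V \<Longrightarrow> norm v < R \<Longrightarrow> v \<in> \<kappa> ` U"
    using chart_radius by metis
  define r' where "r' = min r (R / 2)"
  have r': "0 < r'" "r' < R" "r' \<le> r" using R(1) r by (auto simp: r'_def min_def)
  obtain m where m: "m > 0" "\<And>x s t. x \<in> carrier G \<Longrightarrow> len x < m \<Longrightarrow> s \<le> 0 \<Longrightarrow> \<sigma> s x \<in> N r' \<Longrightarrow> t \<le> 0 \<Longrightarrow> \<sigma> t x \<in> N r'"
    using orbit_trapped[OF R(2) r'(1,2)] by metis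
  have "x \<in> N r" if x: "x \<in> contracted" "len x < m" for x
  proof -
    have xc: "x \<in> carrier G" using x by (simp add: contracted_def)
    obtain s where s: "s \<le> 0" "\<sigma> s x \<in> N r'" using x(1) r'(1) unfolding contracted_def by blast
    have "\<sigma> 0 x \<in> N r'" by (rule m(2)[OF xc x(2) s]) simp
    then show ?thesis using N_mono[OF r'(3)] xc by (auto simp: \<sigma>_zero)
  qed
  then show thesis using that m(1) by blast
qed

text \<open>
  An open subgroup is also closed, so the path \<open>inv g \<otimes> \<sigma> t g\<close>,
  which passes through the identity, cannot leave it.
\<close>

lemma orbit_in_coset:
  assumes g: "g \<in> carrier G"
  shows "inv g \<otimes> \<sigma> t g \<in> contracted"
proof -
  define P where "P = (\<lambda>t. inv g \<otimes> \<sigma> t g) ` UNIV"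
  have "connectedin T P" unfolding P_def
  proof (rule connectedin_continuous_map_image)
    show "continuous_map euclideanreal T (\<lambda>t. inv g \<otimes> \<sigma> t g)"
      using g by (intro continuous_mult2 continuous_\<sigma>2) (auto simp: topspace_T)
  qed simp
  then have "P \<subseteq> contracted \<or> disjnt P contracted"
    using connectedin_clopen_cases clopen_contracted by blast
  moreover have "\<one> \<in> P" unfolding P_def
    by (rule image_eqI[of _ _ 0]) (use g in \<open>auto simp: \<sigma>_zero\<close>)
  moreover obtain r where "r > 0" "N r \<subseteq> contracted" using contracted_nbhd by metis
  then have "\<one> \<in> contracted" using one_in_N by blast
  ultimately have "P \<subseteq> contracted" by (auto simp: disjnt_def)
  then show ?thesis by (auto simp: P_def)
qed

text \<open>
  Take a point \<open>y\<close> far back on the orbit of \<open>g\<close>, so that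
  \<open>y\<close> is short. The orbit beyond \<open>y\<close> stays in the coset of
  \<open>y\<close> and within small distance of \<open>y\<close>, hence in the compact set
  \<open>y \<otimes> K\<close>. Lengths along the orbit tend to zero, so by compactness the
  identity belongs to \<open>y \<otimes> K\<close>, hence to the coset of \<open>g\<close>.
\<close>

lemma contracted_all: "contracted = carrier G"
proof
  show "contracted \<subseteq> carrier G" by (auto simp: contracted_def)
  show "carrier G \<subseteq> contracted"
  proof
    fix g assume g: "g \<in> carrier G"
    obtain R where R: "R > 0" "\<And>v. v \<in> V \<Longrightarrow> norm v < R \<Longrightarrow> v \<in> \<kappa> ` U"
      using chart_radius by metis
    obtain r where r: "r > 0" "N r \<subseteq> contracted" using contracted_nbhd by metis
    define r2 where "r2 = min r R / 2"
    have r2: "0 < r2" "r2 < R" "r2 < r" using r(1) R(1) by (auto simp: r2_def min_def)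
    define K where "K = {x \<in> U. 0 \<le> norm (\<kappa> x) \<and> norm (\<kappa> x) \<le> r2}"
    have Kc: "compactin T K" unfolding K_def by (rule compactin_shell[OF R(2) r2(2)])
    have KH: "K \<subseteq> contracted" using r2(3) r(2) by (force simp: K_def N_def)
    obtain m where m: "m > 0" "\<And>x. x \<in> contracted \<Longrightarrow> len x < m \<Longrightarrow> x \<in> N r2"
      using contracted_len_small[OF r2(1)] by metis
    have "m / 2 > 0" using m(1) by simp
    then obtain s where s: "\<And>t. t \<le> s \<Longrightarrow> exp t * len g < m / 2" using len_scaled_small by metis
    define y where "y = \<sigma> s g"
    have yc: "y \<in> carrier G" using g \<sigma>_closed by (simp add: y_def)
    have near: "inv y \<otimes> \<sigma> t g \<in> K" if t: "t \<le> s" for t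
    proof -
      have tc: "\<sigma> t g \<in> carrier G" using g \<sigma>_closed by simp
      have "inv (inv g \<otimes> y) \<otimes> (inv g \<otimes> \<sigma> t g) \<in> contracted"
        unfolding y_def by (intro contracted_mult contracted_inv orbit_in_coset g)
      moreover have "g \<otimes> (inv g \<otimes> \<sigma> t g) = \<sigma> t g" using g tc by (simp flip: m_assoc)
      then have "inv (inv g \<otimes> y) \<otimes> (inv g \<otimes> \<sigma> t g) = inv y \<otimes> \<sigma> t g"
        using g yc tc by (simp add: inv_mult_group m_assoc)
      ultimately have "inv y \<otimes> \<sigma> t g \<in> contracted" by simp
      moreover have "len (inv y \<otimes> \<sigma> t g) < m"
        using len_mult[of "inv y" "\<sigma> t g"] yc tc s[OF t] s[of s] by (simp add: len_inv len_\<sigma> g y_def)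
      ultimately have "inv y \<otimes> \<sigma> t g \<in> N r2" by (rule m(2))
      then show ?thesis by (auto simp: K_def N_def)
    qed
    have "continuous_map T T (\<lambda>z. y \<otimes> z)" using yc by (intro continuous_mult2) (auto simp: topspace_T)
    then have yK: "compactin T ((\<lambda>z. y \<otimes> z) ` K)" by (rule image_compactin[OF Kc])
    have "\<one> \<in> (\<lambda>z. y \<otimes> z) ` K"
    proof (rule ccontr)
      assume "\<one> \<notin> (\<lambda>z. y \<otimes> z) ` K"
      then obtain m' where m': "m' > 0" "\<And>x. x \<in> (\<lambda>z. y \<otimes> z) ` K \<Longrightarrow> m' \<le> len x"
        using len_bounded_below[OF yK] by metis
      obtain t0 where t0: "\<And>t. t \<le> t0 \<Longrightarrow> exp t * len g < m'" using len_scaled_small[OF m'(1)] by metis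
      define t where "t = min s t0"
      have "y \<otimes> (inv y \<otimes> \<sigma> t g) = \<sigma> t g" using yc g \<sigma>_closed by (simp flip: m_assoc)
      then have "\<sigma> t g \<in> (\<lambda>z. y \<otimes> z) ` K" using near[of t] by (force simp: t_def)
      then have "m' \<le> exp t * len g" using m'(2) len_\<sigma>[OF g] by metis
      then show False using t0[of t] by (simp add: t_def)
    qed
    then obtain z where z: "z \<in> K" "\<one> = y \<otimes> z" by blast
    have zc: "z \<in> carrier G" using z(1) U_subset by (auto simp: K_def)
    have "y = inv z" using z(2) yc zc by (metis inv_equality)
    then have "y \<in> contracted" using contracted_inv z(1) KH by blast
    then have "y \<otimes> inv (inv g \<otimes> y) \<in> contracted"
      using contracted_mult contracted_inv orbit_in_coset[OF g] y_def by blast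
    then show "g \<in> contracted" using g yc by (simp add: inv_mult_group flip: m_assoc)
  qed
qed

lemma metric_topology: "met.mtopology = T"
proof (rule topology_eq[THEN iffD2], intro allI iffI)
  fix W assume W: "openin T W"
  show "openin met.mtopology W"
    unfolding met.openin_mtopology
  proof (intro conjI allI impI)
    show WG: "W \<subseteq> carrier G" using openin_subset[OF W] topspace_T by simp
    fix x assume x: "x \<in> W"
    then have xc: "x \<in> carrier G" using WG by blast
    obtain r where r: "r > 0" "N r \<subseteq> {y \<in> carrier G. x \<otimes> y \<in> W}"
      by (rule N_small[OF openin_translate[OF xc W]]) (use x xc in auto)
    obtain m where m: "m > 0" "\<And>x. x \<in> contracted \<Longrightarrow> len x < m \<Longrightarrow> x \<in> N r"
      using contracted_len_small[OF r(1)] by metis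
    have "met.mball x m \<subseteq> W"
    proof
      fix y assume "y \<in> met.mball x m"
      then have y: "y \<in> carrier G" "d x y < m" by auto
      have "inv x \<otimes> y \<in> N r"
        by (rule m(2)) (use xc y in \<open>auto simp: contracted_all d_len\<close>)
      then have "x \<otimes> (inv x \<otimes> y) \<in> W" using r(2) by blast
      then show "y \<in> W" using xc y by (simp flip: m_assoc)
    qed
    then show "\<exists>r>0. met.mball x r \<subseteq> W" using m(1) by blast
  qed
next
  fix W assume "openin met.mtopology W"
  then have W: "W \<subseteq> carrier G" "\<And>x. x \<in> W \<Longrightarrow> \<exists>e>0. met.mball x e \<subseteq> W"
    unfolding met.openin_mtopology by auto
  show "openin T W"
  proof (subst openin_subopen, intro ballI)
    fix x assume x: "x \<in> W"
    then have xc: "x \<in> carrier G" using W(1) by blast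
    obtain e where e: "e > 0" "met.mball x e \<subseteq> W" using W(2)[OF x] by blast
    obtain r where r: "r > 0" "\<And>y. y \<in> N r \<Longrightarrow> len y < e" using len_small[OF e(1)] by metis
    have "{y \<in> carrier G. inv x \<otimes> y \<in> N r} \<subseteq> met.mball x e" using r(2) xc by (auto simp: d_len)
    then show "\<exists>S. openin T S \<and> x \<in> S \<and> S \<subseteq> W"
      using coset_nbhd[OF xc r(1)] e(2) by blast
  qed
qed

lemma connected_T: "connected_space T"
  unfolding connected_space_clopen_in
proof (intro allI impI)
  fix S assume S: "openin T S \<and> closedin T S"
  have all: "S = carrier G" if S: "openin T S" "closedin T S" "\<one> \<in> S" for S
  proof
    show "S \<subseteq> carrier G" using openin_subset[OF S(1)] topspace_T by simp
    show "carrier G \<subseteq> S"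
    proof
      fix x assume x: "x \<in> carrier G"
      define P where "P = (\<lambda>t. \<sigma> t x) ` UNIV"
      have "connectedin T P" unfolding P_def by (rule connectedin_orbit[OF x]) simp
      then have cases: "P \<subseteq> S \<or> disjnt P S" using connectedin_clopen_cases S by blast
      obtain r where r: "r > 0" "N r \<subseteq> S" using N_small[OF S(1,3)] by metis
      obtain t where "\<sigma> t x \<in> N r" using x r(1) contracted_all unfolding contracted_def by blast
      then have "\<not> disjnt P S" using r(2) by (auto simp: P_def disjnt_def)
      then have "P \<subseteq> S" using cases by blast
      moreover have "x \<in> P" unfolding P_def by (rule image_eqI[of _ _ 0]) (use x in \<open>auto simp: \<sigma>_zero\<close>)
      ultimately show "x \<in> S" by blast
    qed
  qed
  show "S = {} \<or> S = topspace T"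
  proof (cases "\<one> \<in> S")
    case True
    then show ?thesis using all[of S] S topspace_T by simp
  next
    case False
    have "\<one> \<in> topspace T" by (simp add: topspace_T)
    then have "carrier G - S = carrier G"
      by (intro all) (use S False in \<open>auto simp: topspace_T[symmetric] closedin_def\<close>)
    moreover have "S \<subseteq> carrier G" using S openin_subset topspace_T by metis
    ultimately show ?thesis by blast
  qed
qed

end

section \<open>Lie groups\<close>

lemma centered_chart_of_chart:
  assumes lie: "lie_group G M" and c: "(U, \<phi>) \<in> atlas M" and one: "\<one>\<^bsub>G\<^esub> \<in> U"
  shows "centered_chart G (mfd_top M) (model M) U (\<lambda>x. \<phi> x - \<phi> \<one>\<^bsub>G\<^esub>)"
    and "\<phi> \<one>\<^bsub>G\<^esub> \<in> model M"
proof -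
  define a where "a = \<phi> \<one>\<^bsub>G\<^esub>"
  from lie have G: "group G" and M: "smooth_manifold M" and top: "pts M = carrier G"
    and mult: "smooth_map (prod_mfd M M) M (\<lambda>(x, y). x \<otimes>\<^bsub>G\<^esub> y)"
    and inv: "smooth_map M M (\<lambda>x. inv\<^bsub>G\<^esub> x)"
    by (auto simp: lie_group_def)
  have V: "subspace (model M)" and H: "Hausdorff_space (mfd_top M)" and ch: "is_chart M (U, \<phi>)"
    using M c by (auto simp: smooth_manifold_def)
  from ch have U: "openin (mfd_top M) U" and im: "openin (top_of_set (model M)) (\<phi> ` U)"
    and hom: "homeomorphic_map (subtopology (mfd_top M) U) (top_of_set (\<phi> ` U)) \<phi>"
    by (auto simp: is_chart_def)
  show aV: "\<phi> \<one>\<^bsub>G\<^esub> \<in> model M" using im one openin_imp_subset by blast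
  have im': "(\<lambda>x. \<phi> x - a) ` U = (\<lambda>v. v - a) ` \<phi> ` U" by (simp add: image_image)
  have shift: "homeomorphic_map (top_of_set (\<phi> ` U)) (top_of_set ((\<lambda>v. v - a) ` \<phi> ` U)) (\<lambda>v. v - a)"
  proof (rule homeomorphic_maps_imp_map[where g="\<lambda>v. v + a"])
    show "homeomorphic_maps (top_of_set (\<phi> ` U)) (top_of_set ((\<lambda>v. v - a) ` \<phi> ` U)) (\<lambda>v. v - a) (\<lambda>v. v + a)"
      by (auto simp: homeomorphic_maps_def continuous_map_in_subtopology
          intro: continuous_on_add continuous_on_diff)
  qed
  have "openin (top_of_set (model M)) ((\<lambda>v. v - a) ` \<phi> ` U)"
    unfolding openin_contains_ball
  proof (intro conjI ballI)
    have sub: "\<phi> ` U \<subseteq> model M" using im openin_imp_subset by blast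
    then show "(\<lambda>v. v - a) ` \<phi> ` U \<subseteq> model M" using aV V by (auto simp: a_def intro!: subspace_diff)
    fix w assume "w \<in> (\<lambda>v. v - a) ` \<phi> ` U"
    then have "w + a \<in> \<phi> ` U" by auto
    then obtain e where e: "e > 0" "ball (w + a) e \<inter> model M \<subseteq> \<phi> ` U"
      using im unfolding openin_contains_ball by blast
    have "ball w e \<inter> model M \<subseteq> (\<lambda>v. v - a) ` \<phi> ` U"
    proof
      fix z assume z: "z \<in> ball w e \<inter> model M"
      then have "z + a \<in> ball (w + a) e \<inter> model M"
        using aV V by (auto simp: a_def dist_norm intro!: subspace_add)
      then have "z + a \<in> \<phi> ` U" using e(2) by blast
      then show "z \<in> (\<lambda>v. v - a) ` \<phi> ` U" by (rule rev_image_eqI) simp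
    qed
    then show "\<exists>e>0. ball w e \<inter> model M \<subseteq> (\<lambda>v. v - a) ` \<phi> ` U" using e(1) by blast
  qed
  then show "centered_chart G (mfd_top M) (model M) U (\<lambda>x. \<phi> x - \<phi> \<one>\<^bsub>G\<^esub>)"
    using G top mult inv H V U one homeomorphic_map_compose[OF hom shift]
    unfolding centered_chart_def centered_chart_axioms_def a_def[symmetric] im'
    by (simp add: smooth_map_def prod_mfd_def o_def a_def)
qed

theorem theorem1p1:
  fixes G :: "('p, 'r) monoid_scheme"
    and M :: "('p, 'e::euclidean_space) mfd"
    and A :: "'p vfield \<Rightarrow> 'p vfield"
    and \<delta> :: "real \<Rightarrow> 'p \<Rightarrow> 'p"
    and d :: "'p \<Rightarrow> 'p \<Rightarrow> real"
  assumes "lie_group G M"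
    and "A \<in> lie_derivations G M"
    and "one_param_aut_group G M \<delta>"
    and "\<And>s X. s > 0 \<Longrightarrow> X \<in> lie_algebra G M \<Longrightarrow> vf_push M (\<delta> s) X = endo_powr M s A X"
    and "homogeneous_distance G \<delta> d"
  shows "admissible G M d \<and> connected_space (mfd_top M)"
proof -
  from assms(1) have G: "group G" and M: "smooth_manifold M" and top: "pts M = carrier G"
    and mult: "smooth_map (prod_mfd M M) M (\<lambda>(x, y). x \<otimes>\<^bsub>G\<^esub> y)"
    by (auto simp: lie_group_def)
  interpret group G by (rule G)
  have "\<one>\<^bsub>G\<^esub> \<in> (\<Union>c\<in>atlas M. fst c)" using M top by (simp add: smooth_manifold_def)
  then obtain U \<phi> where c: "(U, \<phi>) \<in> atlas M" and one: "\<one>\<^bsub>G\<^esub> \<in> U" by auto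
  define \<kappa> where "\<kappa> x = \<phi> x - \<phi> \<one>\<^bsub>G\<^esub>" for x
  define \<sigma> where "\<sigma> t = \<delta> (exp t)" for t
  interpret chart: centered_chart G "mfd_top M" "model M" U \<kappa>
    unfolding \<kappa>_def by (rule centered_chart_of_chart(1)[OF assms(1) c one])
  have \<phi>1: "\<phi> \<one>\<^bsub>G\<^esub> \<in> model M" by (rule centered_chart_of_chart(2)[OF assms(1) c one])
  have aut: "\<delta> s \<in> iso G G" "smooth_map M M (\<delta> s)" if "s > 0" for s
    using assms(3) that by (auto simp: one_param_aut_group_def lie_group_aut_def)
  have \<delta>_mult: "\<delta> (s * t) x = \<delta> s (\<delta> t x)" if "s > 0" "t > 0" "x \<in> carrier G" for s t x
    using assms(3) that by (simp add: one_param_aut_group_def)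
  have hom: "\<sigma> t \<in> hom G G" for t using aut(1) by (simp add: \<sigma>_def iso_def)
  have closed: "\<sigma> t x \<in> carrier G" if "x \<in> carrier G" for t x
    using hom_in_carrier[OF hom that] .
  have smooth: "smooth_map M M (\<sigma> t)" for t using aut(2) by (simp add: \<sigma>_def)
  have zero: "\<sigma> 0 x = x" if x: "x \<in> carrier G" for x
  proof -
    have "\<delta> 1 (\<delta> 1 x) = \<delta> 1 x" using \<delta>_mult[of 1 1 x] x by simp
    moreover have "inj_on (\<delta> 1) (carrier G)" using aut(1)[of 1] by (auto simp: iso_def bij_betw_def)
    moreover have "\<delta> 1 x \<in> carrier G" using closed[OF x, of 0] by (simp add: \<sigma>_def)
    ultimately show ?thesis using x by (simp add: \<sigma>_def inj_on_def)
  qed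
  have cont: "continuous_map (prod_topology euclideanreal (mfd_top M)) (mfd_top M) (\<lambda>(t, x). \<sigma> t x)"
  proof -
    have "continuous_map (prod_topology euclideanreal (mfd_top M)) euclideanreal (\<lambda>p. exp (fst p))"
      using continuous_map_compose[OF continuous_map_fst[of euclideanreal "mfd_top M"], of euclideanreal exp]
      by (simp add: o_def continuous_on_exp)
    then have "continuous_map (prod_topology euclideanreal (mfd_top M))
        (prod_topology (top_of_set {0<..}) (mfd_top M)) (\<lambda>p. (exp (fst p), snd p))"
      by (intro continuous_map_pairedI continuous_map_snd)
        (auto simp: continuous_map_in_subtopology)
    moreover have "continuous_map (prod_topology (top_of_set {0<..}) (mfd_top M)) (mfd_top M) (\<lambda>(s, p). \<delta> s p)"
      using assms(3) by (simp add: one_param_aut_group_def)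
    ultimately have "continuous_map (prod_topology euclideanreal (mfd_top M)) (mfd_top M)
        ((\<lambda>(s, p). \<delta> s p) \<circ> (\<lambda>p. (exp (fst p), snd p)))"
      by (rule continuous_map_compose)
    then show ?thesis by (simp add: o_def case_prod_unfold \<sigma>_def)
  qed
  have prod_atlas: "(U \<times> U, map_prod \<phi> \<phi>) \<in> atlas (prod_mfd M M)"
    using c by (auto simp: prod_mfd_def)
  have mult_C1: "C_k_on 1 (model M \<times> model M)
      (map_prod \<phi> \<phi> ` {p \<in> U \<times> U. (\<lambda>(x, y). x \<otimes>\<^bsub>G\<^esub> y) p \<in> U})
      (\<phi> \<circ> (\<lambda>(x, y). x \<otimes>\<^bsub>G\<^esub> y) \<circ> inv_into (U \<times> U) (map_prod \<phi> \<phi>))"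
  proof -
    have "smooth_on (model (prod_mfd M M)) (map_prod \<phi> \<phi> ` {p \<in> U \<times> U. (\<lambda>(x, y). x \<otimes>\<^bsub>G\<^esub> y) p \<in> U})
      (\<phi> \<circ> (\<lambda>(x, y). x \<otimes>\<^bsub>G\<^esub> y) \<circ> inv_into (U \<times> U) (map_prod \<phi> \<phi>))"
      using mult prod_atlas c unfolding smooth_map_def by blast
    then show ?thesis unfolding smooth_on_def by (simp only: prod_mfd_def mfd.simps)
  qed
  have \<sigma>_C1: "C_k_on 1 (model M) (\<phi> ` {p \<in> U. \<sigma> t p \<in> U}) (\<phi> \<circ> \<sigma> t \<circ> inv_into U \<phi>)" for t
    using smooth[of t] c unfolding smooth_map_def smooth_on_def by blast
  have \<sigma>_cont: "continuous_map (mfd_top M) (mfd_top M) (\<sigma> t)" for t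
    using smooth[of t] by (simp add: smooth_map_def)
  have \<sigma>_one: "\<sigma> t \<one>\<^bsub>G\<^esub> = \<one>\<^bsub>G\<^esub>" for t using hom_one[OF hom G G] .
  have dist: "Metric_space (carrier G) d"
    "\<And>g x y. g \<in> carrier G \<Longrightarrow> x \<in> carrier G \<Longrightarrow> y \<in> carrier G \<Longrightarrow> d (g \<otimes>\<^bsub>G\<^esub> x) (g \<otimes>\<^bsub>G\<^esub> y) = d x y"
    "\<And>s x y. s > 0 \<Longrightarrow> x \<in> carrier G \<Longrightarrow> y \<in> carrier G \<Longrightarrow> d (\<delta> s x) (\<delta> s y) = s * d x y"
    using assms(5) by (auto simp: homogeneous_distance_def left_invariant_distance_def)
  interpret chart: group_chart G "mfd_top M" "model M" U \<kappa>
    by unfold_locales (rule chart.strictly_additive_mult[OF _ \<phi>1 mult_C1], simp_all add: \<kappa>_def)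
  interpret flow: automorphism_flow G "mfd_top M" "model M" U \<kappa> \<sigma>
  proof
    show "\<sigma> (s + t) x = \<sigma> s (\<sigma> t x)" if "x \<in> carrier G" for s t x
      using \<delta>_mult[of "exp s" "exp t" x] that by (simp add: \<sigma>_def exp_add)
    show "\<exists>L. linear L \<and> (\<forall>\<eta>>0. \<exists>r>0. \<forall>x\<in>U. norm (\<kappa> x) < r \<longrightarrow>
        \<sigma> t x \<in> U \<and> norm (\<kappa> (\<sigma> t x) - L (\<kappa> x)) \<le> \<eta> * norm (\<kappa> x))" for t
      by (rule chart.differentiable_at_one[OF _ \<phi>1 \<sigma>_cont \<sigma>_one \<sigma>_C1]) (simp add: \<kappa>_def)
  qed (fact hom zero cont)+
  have "homogeneous_flow_axioms G \<sigma> d"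
    using dist by (intro homogeneous_flow_axioms.intro) (simp_all add: \<sigma>_def)
  then interpret flow: homogeneous_flow G "mfd_top M" "model M" U \<kappa> \<sigma> d
    by (rule homogeneous_flow.intro[OF flow.automorphism_flow_axioms])
  show ?thesis using flow.metric_topology flow.connected_T by (simp add: admissible_def)
qed

end
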